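(* Let $p\in[1,\infty)$. Suppose that $X$ is the solution of the stochastic differential equation in the context, that $X_T$ has a bounded density $f_{X_T}$, and that $X_T^\pi$ is an approximation of $X_T$ (corresponding to a partition $\pi$ of $[0,T]$) such that, for some constants $\gamma>0$ and $C_r\ge0$, $$\|X_T-X_T^\pi\|_r\le C_r\,|\pi|^\gamma\qquad\text{for all } r\in[1,\infty).$$ Then for any $0<\varepsilon<\gamma$ we have, for $\theta=\frac{\varepsilon}{2\gamma-\varepsilon}$, the bump function $\varphi^{X_T}_{C,\theta}$ of the context built from $C=(C_r)_{r\in[1,\infty)}$, and $g\in\mathcal G_{p,\varphi^{X_T}_{C,\theta}}$, that $$\mathbb E|g(X_T)-g(X_T^\pi)|^p\le 3\cdot2^p\,(\sup f_{X_T})^{1-\frac{\varepsilon}{\gamma}}\,\Big(V_{p,\varphi^{X_T}_{C,\theta}}(g)\Big)^p\,C_{1/\theta}^{\,1-\frac{\varepsilon}{\gamma}}\,|\pi|^{\gamma-\varepsilon}.$$ Especially, every polynomial from $\mathbb R$ to $\mathbb R$ belongs to $\mathcal G_{p,\varphi^{X_T}_{C,\theta}}$.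
   Context: Fix $T>0$ and a standard one-dimensional Brownian motion $W$ on a complete filtered probability space, the filtration being the augmentation of the natural filtration of $W$. $X$ is the unique adapted strong solution of $dX_t=\sigma(t,X_t)\,dW_t+b(t,X_t)\,dt$, $X_0=x_0\in\mathbb R$, on $[0,T]$, where $\sigma,b\in C^{0,1}([0,T]\times\mathbb R)$ and there are constants $C_T$ and $\alpha\ge\frac12$ such that for $f\in\{\sigma,b\}$: $|f(t,x)|\le C_T(1+|x|)$; $|f(t,x)-f(t,y)|\le C_T|x-y|$; $|f(t,x)-f(s,x)|\le C_T(1+|x|)|t-s|^\alpha$. A partition $\pi$ of $[0,T]$ is $0=t_0<t_1<\dots<t_n=T$, with mesh size $|\pi|=\max_{0\le i<n}|t_{i+1}-t_i|$. $\|Z\|_r=(\mathbb E|Z|^r)^{1/r}$. Bump function: $\varphi:\mathbb R\to\mathbb R$ with $0<\varphi(z)\le1$ for all $z$, $\varphi$ increasing (not necessarily strictly) in $(-\infty,0]$ and decreasing (not necessarily strictly) in $(0,\infty)$, and $\lim_{|z|\to\infty}\varphi(z)=0$. The function $\varphi^{X_T}_{C,\theta}$, for $0<\theta<1$ and a family $C=(C_r)_{r\in[1,\infty)}$: put $\varphi^{0}(\lambda)=\min\big\{1,\inf_{r\in[1,\infty)}\frac{(C_r+\|X_T\|_r)^{\theta r}}{|\lambda|^{\theta r}}\big\}$ for $\lambda\ne0$ and $\varphi^{0}(0)=1$ (here $X_T\in L_r$ for all $r\in[1,\infty)$), and $\varphi^{X_T}_{C,\theta}=\max\{\varphi^{0},\psi\}$,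 where $\psi$ is a bump function chosen to decay faster than any polynomial (for instance $\psi(\lambda)=e^{-|\lambda|}$), so that $\varphi^{X_T}_{C,\theta}$ is a bump function that decays faster than any polynomial. Class $\mathcal G_{p,\varphi}$ ($p\in[1,\infty)$, $\varphi$ a bump function): let $\mathcal M$ be the set of all signed measures $\mu$ on the Borel sets of $\mathbb R$ such that $|\mu|$ is $\sigma$-finite, and let $\mathcal M_{p,\varphi}=\{\mu\in\mathcal M:\varphi\in L_1^{loc}(\mathbb R,|\mu|)\cap L_{1+\frac1p}(\mathbb R,|\mu|)\}$. For $\mu\in\mathcal M_{p,\varphi}$ put $g^\mu(x)=\int_{(0,x]}\varphi\,d\mu$ for $x\ge0$ and $g^\mu(x)=\int_{(x,0]}\varphi\,d\mu$ for $x<0$, with $(0,0]=\emptyset$. Let $\Delta_{p,\varphi}$ be the set of functions $\Delta_A(x)=\sum_{i=1}^\infty\lambda_i\varphi(a_i)\chi_{\{a_i\}}(x)$ with $A=(a_i)_{i=1}^\infty\subset\mathbb R$ countable, $a_i\ne a_j$ if $i\ne j$, $(\lambda_i)_{i=1}^\infty\subset\mathbb R$ and $\sum_{i=1}^\infty|\lambda_i|\varphi(a_i)^{1+\frac1p}<\infty$, where $\chi$ denotes indicator functions. Then $\mathcal G_{p,\varphi}$ is the set of all $g=c+g^\mu+\Delta_A$ with $c\in\mathbb R$, $\mu\in\mathcal M_{p,\varphi}$ and $\Delta_A\in\Delta_{p,\varphi}$ (this decomposition is unique), and $V_{p,\varphi}(g)=\int_{\mathbb R}\varphi^{1+\fr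ac1p}\,d|\mu|+\sum_{i=1}^\infty|\lambda_i|\varphi(a_i)^{1+\frac1p}$.
   Formalization: The estimate is stated for partitions with |π| ≤ 1 (it fails in general for |π| > 1); the polynomial claim is unrestricted. Signed measures may have infinite positive and negative parts, as is needed for polynomials such as g(x)=x to belong to the class. *)

theory Defs
  imports "HOL-Probability.Probability" "HOL-Computational_Algebra.Polynomial"
begin

section \<open>Moments and convergence in probability\<close>

definition in_Lr :: "'a measure \<Rightarrow> real \<Rightarrow> ('a \<Rightarrow> real) \<Rightarrow> bool" where
  "in_Lr M r Z \<longleftrightarrow> Z \<in> borel_measurable M \<and> integrable M (\<lambda>\<omega>. \<bar>Z \<omega>\<bar> powr r)"

text \<open>Only meaningful under \<^term>\<open>in_Lr M r Z\<close>, as the Bochner integral of a non-integrable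
  function is 0.\<close>

definition Lr_norm :: "'a measure \<Rightarrow> real \<Rightarrow> ('a \<Rightarrow> real) \<Rightarrow> real" where
  "Lr_norm M r Z = (\<integral>\<omega>. \<bar>Z \<omega>\<bar> powr r \<partial>M) powr (1 / r)"

definition converges_in_prob :: "'a measure \<Rightarrow> (nat \<Rightarrow> 'a \<Rightarrow> real) \<Rightarrow> ('a \<Rightarrow> real) \<Rightarrow> bool" where
  "converges_in_prob M Z Y \<longleftrightarrow>
     (\<forall>k. Z k \<in> borel_measurable M) \<and> Y \<in> borel_measurable M \<and>
     (\<forall>\<delta>>0. (\<lambda>k. measure M {\<omega> \<in> space M. \<bar>Z k \<omega> - Y \<omega>\<bar> > \<delta>}) \<longlonglongrightarrow> 0)"


section \<open>Partitions\<close>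

text \<open>\<open>0 = \<tau> 0 < \<tau> 1 < \<dots> < \<tau> n = T\<close>; values of \<open>\<tau>\<close> beyond \<open>n\<close> are irrelevant.\<close>

definition is_partition :: "real \<Rightarrow> nat \<Rightarrow> (nat \<Rightarrow> real) \<Rightarrow> bool" where
  "is_partition T n \<tau> \<longleftrightarrow> \<tau> 0 = 0 \<and> \<tau> n = T \<and> (\<forall>i<n. \<tau> i < \<tau> (Suc i))"

definition mesh :: "nat \<Rightarrow> (nat \<Rightarrow> real) \<Rightarrow> real" where
  "mesh n \<tau> = (MAX i\<in>{..<n}. \<bar>\<tau> (Suc i) - \<tau> i\<bar>)"


section \<open>Brownian motion and the stochastic differential equation\<close>

definition aug_filtration :: "'a measure \<Rightarrow> (real \<Rightarrow> 'a \<Rightarrow> real) \<Rightarrow> real \<Rightarrow> 'a measure" where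
  "aug_filtration M W t =
     sigma (space M) ({W s -` B \<inter> space M | s B. s \<in> {0..t} \<and> B \<in> sets borel} \<union> null_sets M)"

definition brownian_motion ::
    "'a measure \<Rightarrow> (real \<Rightarrow> 'a measure) \<Rightarrow> real \<Rightarrow> (real \<Rightarrow> 'a \<Rightarrow> real) \<Rightarrow> bool" where
  "brownian_motion M F T W \<longleftrightarrow>
     (\<forall>t\<in>{0..T}. W t \<in> borel_measurable M \<and> W t \<in> borel_measurable (F t)) \<and>
     (AE \<omega> in M. W 0 \<omega> = 0) \<and>
     (AE \<omega> in M. continuous_on {0..T} (\<lambda>t. W t \<omega>)) \<and>
     (\<forall>s t. 0 \<le> s \<and> s < t \<and> t \<le> T \<longrightarrow>
        distributed M lborel (\<lambda>\<omega>. W t \<omega> - W s \<omega>)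
          (\<lambda>x. ennreal (normal_density 0 (sqrt (t - s)) x)) \<and>
        prob_space.indep_set M (sets (F s))
          {(\<lambda>\<omega>. W t \<omega> - W s \<omega>) -` B \<inter> space M | B. B \<in> sets borel})"

text \<open>\<open>H\<close> is a simple integrand on \<open>[0,t]\<close>, with stochastic integral \<open>J\<close> over \<open>[0,t]\<close>.\<close>

definition simple_integral ::
    "'a measure \<Rightarrow> (real \<Rightarrow> 'a measure) \<Rightarrow> (real \<Rightarrow> 'a \<Rightarrow> real) \<Rightarrow> real \<Rightarrow>
     (real \<Rightarrow> 'a \<Rightarrow> real) \<Rightarrow> ('a \<Rightarrow> real) \<Rightarrow> bool" where
  "simple_integral M F W t H J \<longleftrightarrow>
     (\<exists>n \<tau> h. is_partition t n \<tau> \<and>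
        (\<forall>i<n. h i \<in> borel_measurable (F (\<tau> i)) \<and> (\<exists>K. \<forall>\<omega>\<in>space M. \<bar>h i \<omega>\<bar> \<le> K)) \<and>
        H = (\<lambda>s \<omega>. \<Sum>i<n. h i \<omega> * indicator {\<tau> i<..\<tau> (Suc i)} s) \<and>
        J = (\<lambda>\<omega>. \<Sum>i<n. h i \<omega> * (W (\<tau> (Suc i)) \<omega> - W (\<tau> i) \<omega>)))"

text \<open>\<open>J\<close> is a version of the Ito integral of \<open>H\<close> over \<open>[0,t]\<close>, for an adapted integrand \<open>H\<close> with
  almost surely square integrable paths: the limit in probability of the integrals of simple
  integrands \<open>G k\<close> with \<open>\<integral>\<^sub>0\<^sup>t (G k s - H s)\<^sup>2 ds \<rightarrow> 0\<close> in probability. Measurability of these random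
  variables is required explicitly, because non-measurable events would have measure 0.\<close>

definition ito_integral ::
    "'a measure \<Rightarrow> (real \<Rightarrow> 'a measure) \<Rightarrow> (real \<Rightarrow> 'a \<Rightarrow> real) \<Rightarrow> real \<Rightarrow>
     (real \<Rightarrow> 'a \<Rightarrow> real) \<Rightarrow> ('a \<Rightarrow> real) \<Rightarrow> bool" where
  "ito_integral M F W t H J \<longleftrightarrow>
     (\<forall>s\<in>{0..t}. H s \<in> borel_measurable (F s)) \<and>
     (AE \<omega> in M. set_borel_measurable lborel {0..t} (\<lambda>s. H s \<omega>) \<and>
                 set_integrable lborel {0..t} (\<lambda>s. (H s \<omega>)\<^sup>2)) \<and>
     (\<exists>G I. (\<forall>k. simple_integral M F W t (G k) (I k)) \<and>
        (\<forall>k. (\<lambda>\<omega>. \<integral>\<^sup>+s\<in>{0..t}. ennreal ((G k s \<omega> - H s \<omega>)\<^sup>2) \<partial>lborel) \<in> borel_measurable M) \<and>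
        (\<forall>\<delta>>0. (\<lambda>k. measure M {\<omega> \<in> space M.
           (\<integral>\<^sup>+s\<in>{0..t}. ennreal ((G k s \<omega> - H s \<omega>)\<^sup>2) \<partial>lborel) > ennreal \<delta>}) \<longlonglongrightarrow> 0) \<and>
        converges_in_prob M I J)"

text \<open>The class \<open>C\<^sup>0\<^sup>,\<^sup>1([0,T] \<times> \<real>)\<close> is read as: continuous, with continuous partial derivative in
  the space variable.\<close>

definition sde_coefficient :: "real \<Rightarrow> real \<Rightarrow> real \<Rightarrow> (real \<Rightarrow> real \<Rightarrow> real) \<Rightarrow> bool" where
  "sde_coefficient T K \<alpha> f \<longleftrightarrow>
     continuous_on ({0..T} \<times> UNIV) (\<lambda>(t, x). f t x) \<and>
     (\<exists>f'. (\<forall>t\<in>{0..T}. \<forall>x. (f t has_real_derivative f' t x) (at x)) \<and>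
           continuous_on ({0..T} \<times> UNIV) (\<lambda>(t, x). f' t x)) \<and>
     (\<forall>t\<in>{0..T}. \<forall>x. \<bar>f t x\<bar> \<le> K * (1 + \<bar>x\<bar>)) \<and>
     (\<forall>t\<in>{0..T}. \<forall>x y. \<bar>f t x - f t y\<bar> \<le> K * \<bar>x - y\<bar>) \<and>
     (\<forall>s\<in>{0..T}. \<forall>t\<in>{0..T}. \<forall>x. \<bar>f t x - f s x\<bar> \<le> K * (1 + \<bar>x\<bar>) * \<bar>t - s\<bar> powr \<alpha>)"

definition sde_solution ::
    "'a measure \<Rightarrow> (real \<Rightarrow> 'a measure) \<Rightarrow> (real \<Rightarrow> 'a \<Rightarrow> real) \<Rightarrow> real \<Rightarrow>
     (real \<Rightarrow> real \<Rightarrow> real) \<Rightarrow> (real \<Rightarrow> real \<Rightarrow> real) \<Rightarrow> real \<Rightarrow> (real \<Rightarrow> 'a \<Rightarrow> real) \<Rightarrow> bool" where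
  "sde_solution M F W T \<sigma> b x0 X \<longleftrightarrow>
     (\<forall>t\<in>{0..T}. X t \<in> borel_measurable (F t)) \<and>
     (AE \<omega> in M. continuous_on {0..T} (\<lambda>t. X t \<omega>)) \<and>
     (AE \<omega> in M. X 0 \<omega> = x0) \<and>
     (\<forall>t\<in>{0..T}. \<exists>J. ito_integral M F W t (\<lambda>s \<omega>. \<sigma> s (X s \<omega>)) J \<and>
        (AE \<omega> in M. X t \<omega> = x0 + J \<omega> + (LINT s:{0..t}|lborel. b s (X s \<omega>))))"


section \<open>Bump functions\<close>

definition bump_function :: "(real \<Rightarrow> real) \<Rightarrow> bool" where
  "bump_function \<phi> \<longleftrightarrow>
     (\<forall>z. 0 < \<phi> z \<and> \<phi> z \<le> 1) \<and> mono_on {..0} \<phi> \<and> antimono_on {0<..} \<phi> \<and>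
     (\<phi> \<longlongrightarrow> 0) at_infinity"

definition decays_faster_than_polynomials :: "(real \<Rightarrow> real) \<Rightarrow> bool" where
  "decays_faster_than_polynomials \<phi> \<longleftrightarrow>
     (\<forall>k::nat. ((\<lambda>z. \<bar>z\<bar> ^ k * \<phi> z) \<longlongrightarrow> 0) at_infinity)"

definition phi0 :: "'a measure \<Rightarrow> ('a \<Rightarrow> real) \<Rightarrow> (real \<Rightarrow> real) \<Rightarrow> real \<Rightarrow> real \<Rightarrow> real" where
  "phi0 M Z C \<theta> z =
     (if z = 0 then 1
      else min 1 (INF r\<in>{1..}. (C r + Lr_norm M r Z) powr (\<theta> * r) / \<bar>z\<bar> powr (\<theta> * r)))"

definition phi_bump ::
    "'a measure \<Rightarrow> ('a \<Rightarrow> real) \<Rightarrow> (real \<Rightarrow> real) \<Rightarrow> real \<Rightarrow> (real \<Rightarrow> real) \<Rightarrow> real \<Rightarrow> real" where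
  "phi_bump M Z C \<theta> \<psi> z = max (phi0 M Z C \<theta> z) (\<psi> z)"


section \<open>The class of functions G and the functional V\<close>

text \<open>A signed measure is represented by its Jordan decomposition \<open>(\<mu>\<^sup>+, \<mu>\<^sup>-)\<close>. Both parts may be
  infinite; this is needed to represent, for instance, the identity function, whose positive part
  lives on \<open>(0,\<infinity>)\<close> and whose negative part lives on \<open>(-\<infinity>,0]\<close>.\<close>

type_synonym signed_measure = "real measure \<times> real measure"

definition total_variation :: "signed_measure \<Rightarrow> real measure" where
  "total_variation \<mu> =
     measure_of UNIV (sets borel) (\<lambda>A. emeasure (fst \<mu>) A + emeasure (snd \<mu>) A)"

definition signed_sigma_finite :: "signed_measure \<Rightarrow> bool" where
  "signed_sigma_finite \<mu> \<longleftrightarrow>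
     sets (fst \<mu>) = sets borel \<and> sets (snd \<mu>) = sets borel \<and>
     (\<exists>P\<in>sets borel. emeasure (fst \<mu>) (- P) = 0 \<and> emeasure (snd \<mu>) P = 0) \<and>
     sigma_finite_measure (total_variation \<mu>)"

definition signed_integral :: "signed_measure \<Rightarrow> real set \<Rightarrow> (real \<Rightarrow> real) \<Rightarrow> real" where
  "signed_integral \<mu> A f = (LINT x:A|fst \<mu>. f x) - (LINT x:A|snd \<mu>. f x)"

definition M_class :: "real \<Rightarrow> (real \<Rightarrow> real) \<Rightarrow> signed_measure set" where
  "M_class p \<phi> = {\<mu>. signed_sigma_finite \<mu> \<and>
     (\<forall>K. compact K \<longrightarrow> set_integrable (total_variation \<mu>) K \<phi>) \<and>
     integrable (total_variation \<mu>) (\<lambda>x. \<phi> x powr (1 + 1 / p))}"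

definition g_meas :: "(real \<Rightarrow> real) \<Rightarrow> signed_measure \<Rightarrow> real \<Rightarrow> real" where
  "g_meas \<phi> \<mu> x =
     (if x \<ge> 0 then signed_integral \<mu> {0<..x} \<phi> else signed_integral \<mu> {x<..0} \<phi>)"

definition g_jump :: "(real \<Rightarrow> real) \<Rightarrow> (nat \<Rightarrow> real) \<Rightarrow> (nat \<Rightarrow> real) \<Rightarrow> real \<Rightarrow> real" where
  "g_jump \<phi> a l x = (\<Sum>i. l i * \<phi> (a i) * indicator {a i} x)"

definition G_decomp ::
    "real \<Rightarrow> (real \<Rightarrow> real) \<Rightarrow> (real \<Rightarrow> real) \<Rightarrow>
     real \<Rightarrow> signed_measure \<Rightarrow> (nat \<Rightarrow> real) \<Rightarrow> (nat \<Rightarrow> real) \<Rightarrow> bool" where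
  "G_decomp p \<phi> g c \<mu> a l \<longleftrightarrow>
     \<mu> \<in> M_class p \<phi> \<and> inj a \<and> summable (\<lambda>i. \<bar>l i\<bar> * \<phi> (a i) powr (1 + 1 / p)) \<and>
     g = (\<lambda>x. c + g_meas \<phi> \<mu> x + g_jump \<phi> a l x)"

definition G_class :: "real \<Rightarrow> (real \<Rightarrow> real) \<Rightarrow> (real \<Rightarrow> real) set" where
  "G_class p \<phi> = {g. \<exists>c \<mu> a l. G_decomp p \<phi> g c \<mu> a l}"

text \<open>Well defined for a bump function \<open>\<phi>\<close>: \<open>c\<close>, \<open>\<mu>\<close> and the function \<^term>\<open>g_jump \<phi> a l\<close> are then
  determined by \<open>g\<close>, and different pairs \<open>(a, l)\<close> representing the same jump function give the
  same sum.\<close>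

definition V_functional :: "real \<Rightarrow> (real \<Rightarrow> real) \<Rightarrow> (real \<Rightarrow> real) \<Rightarrow> real" where
  "V_functional p \<phi> g =
     (THE v. \<exists>c \<mu> a l. G_decomp p \<phi> g c \<mu> a l \<and>
        v = (\<integral>x. \<phi> x powr (1 + 1 / p) \<partial>(total_variation \<mu>)) +
            (\<Sum>i. \<bar>l i\<bar> * \<phi> (a i) powr (1 + 1 / p)))"

end

theory Submission
  imports Defs
begin

text \<open>Write \<open>[x,y]\<close> for the interval between \<open>x\<close> and \<open>y\<close>. For \<open>g = c + g\<^sup>\<mu> + \<Delta>\<close> the difference
  \<open>g x - g y\<close> is bounded by the integral of \<open>\<phi>\<^sup>-\<^sup>1\<^sup>/\<^sup>p\<close> over \<open>[x,y]\<close> against the measure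
  \<open>\<nu> = \<phi>\<^sup>1\<^sup>+\<^sup>1\<^sup>/\<^sup>p |\<mu>| + \<Sum> |\<lambda>\<^sub>i| \<phi>(a\<^sub>i)\<^sup>1\<^sup>+\<^sup>1\<^sup>/\<^sup>p \<delta>\<close>, whose total mass is \<open>V(g)\<close>. Jensen's inequality
  for \<open>\<nu>\<close> and Fubini reduce the claim to \<open>P(z \<in> [X\<^sub>T, X\<^sup>\<pi>]) \<le> K \<phi>(z)\<close>. This event has a tail bound, which
  is where \<open>\<phi>\<close> comes from, and, since the density is bounded, a bound of Avikainen type in terms of
  the \<open>L\<^sub>r\<close> distance with \<open>r = 1/\<theta>\<close>; the two are interpolated with weights \<open>\<theta>\<close> and \<open>1 - \<theta>\<close>.

  The tail bound needs all moments of \<open>X\<^sub>T\<close>. The Riemann sums of the stochastic equation, stopped as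
  soon as they differ from \<open>X\<close> by more than 1, form a scheme whose coefficients have linear growth in
  the scheme itself, so its moments are bounded uniformly in the grid. The Riemann sums converge to
  \<open>X\<close> uniformly in probability, hence with probability tending to one no stopping occurs.\<close>

section \<open>Elementary stochastic integrals\<close>

text \<open>The Ito integral is given for each time separately, as a limit in probability along a
  sequence that depends on that time, and no moment of the solution is known beforehand. So
  integrals are estimated as finite sums, where independence of the increments is enough, and the
  limits are taken in probability, with bounds that do not depend on the number of grid times.
  Stopping by the distance to \<open>X\<close> replaces the growth bound \<open>1 + |X|\<close> by
  \<open>2 + |Y|\<close> for the scheme \<open>Y\<close> itself, so that a discrete Gronwall
  argument closes.

  The value of \<theta> is forced. For r = 1/\<theta> the density estimate has exponent r/(r+1) =
  1/(1+\<theta>); raised to the power 1-\<theta> it becomes (1-\<theta>)/(1+\<theta>), which is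
  1-\<epsilon>/\<gamma> exactly for \<theta> = \<epsilon>/(2\<gamma>-\<epsilon>). The 3 of the claim
  bounds 2^\<theta> 3^(1-\<theta>), where 2 counts the tails of the two variables and 3 comes from
  balancing the density estimate. The tail bound needs \<open>C r\<close> alone as a bound of the
  distance in L_r, which is where a mesh of at most 1 enters.\<close>

locale brownian = prob_space M for M :: "'a measure" +
  fixes F :: "real \<Rightarrow> 'a measure" and W :: "real \<Rightarrow> 'a \<Rightarrow> real" and T :: real
  assumes T_pos: "T > 0"
    and space_F: "t \<in> {0..T} \<Longrightarrow> space (F t) = space M"
    and sets_F: "t \<in> {0..T} \<Longrightarrow> sets (F t) \<subseteq> sets M"
    and filtration: "0 \<le> s \<Longrightarrow> s \<le> t \<Longrightarrow> t \<le> T \<Longrightarrow> sets (F s) \<subseteq> sets (F t)"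
    and adapted_W: "t \<in> {0..T} \<Longrightarrow> W t \<in> borel_measurable (F t)"
    and distributed_increment: "0 \<le> s \<Longrightarrow> s < t \<Longrightarrow> t \<le> T \<Longrightarrow>
      distributed M lborel (\<lambda>\<omega>. W t \<omega> - W s \<omega>) (\<lambda>x. ennreal (normal_density 0 (sqrt (t - s)) x))"
    and indep_increment: "0 \<le> s \<Longrightarrow> s < t \<Longrightarrow> t \<le> T \<Longrightarrow>
      indep_set (sets (F s)) {(\<lambda>\<omega>. W t \<omega> - W s \<omega>) -` B \<inter> space M | B. B \<in> sets borel}"
begin

lemma measurable_F_mono:
  "f \<in> borel_measurable (F s) \<Longrightarrow> 0 \<le> s \<Longrightarrow> s \<le> t \<Longrightarrow> t \<le> T \<Longrightarrow> f \<in> borel_measurable (F t)"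
  using measurable_mono[OF order_refl refl filtration[of s t]] space_F[of s] space_F[of t] by auto

lemma measurable_F_M:
  "f \<in> borel_measurable (F s) \<Longrightarrow> 0 \<le> s \<Longrightarrow> s \<le> T \<Longrightarrow> f \<in> borel_measurable M"
  using measurable_mono[OF order_refl refl sets_F[of s]] space_F[of s] by auto

lemma W_measurable: "0 \<le> s \<Longrightarrow> s \<le> T \<Longrightarrow> W s \<in> borel_measurable M"
  using measurable_F_M adapted_W by auto

text \<open>The locale assumption speaks of two families of events. Both are closed under
  intersection, so independence passes to the generated sigma algebras, and the sigma algebra of
  \<open>Z\<close> lies inside that of \<open>F s\<close>.\<close>

lemma indep_var_increment:
  assumes Z: "Z \<in> borel_measurable (F s)" and st: "0 \<le> s" "s < t" "t \<le> T"
  shows "indep_var borel Z borel (\<lambda>\<omega>. W t \<omega> - W s \<omega>)"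
proof -
  have "indep_set (sigma_sets (space M) (sets (F s)))
      (sigma_sets (space M) {(\<lambda>\<omega>. W t \<omega> - W s \<omega>) -` B \<inter> space M | B. B \<in> sets borel})"
  proof (rule indep_set_sigma_sets[OF indep_increment[OF st]])
    show "Int_stable (sets (F s))" by (rule sets.Int_stable)
    show "Int_stable {(\<lambda>\<omega>. W t \<omega> - W s \<omega>) -` B \<inter> space M | B. B \<in> sets borel}"
      unfolding Int_stable_def
    proof safe
      fix A B :: "real set" assume "A \<in> sets borel" "B \<in> sets borel"
      then show "\<exists>C. (\<lambda>\<omega>. W t \<omega> - W s \<omega>) -` A \<inter> space M \<inter> ((\<lambda>\<omega>. W t \<omega> - W s \<omega>) -` B \<inter> space M)
          = (\<lambda>\<omega>. W t \<omega> - W s \<omega>) -` C \<inter> space M \<and> C \<in> sets borel"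
        by (intro exI[of _ "A \<inter> B"]) auto
    qed
  qed
  moreover have "sigma_sets (space M) {Z -` A \<inter> space M | A. A \<in> sets borel}
      \<subseteq> sigma_sets (space M) (sets (F s))"
    using measurable_sets[OF Z] space_F[of s] st by (intro sigma_sets_mono') auto
  ultimately have "indep_set (sigma_sets (space M) {Z -` A \<inter> space M | A. A \<in> sets borel})
      (sigma_sets (space M) {(\<lambda>\<omega>. W t \<omega> - W s \<omega>) -` B \<inter> space M | B. B \<in> sets borel})"
    unfolding indep_sets2_eq by blast
  moreover have "random_variable borel Z" using measurable_F_M[OF Z] st by auto
  moreover have "random_variable borel (\<lambda>\<omega>. W t \<omega> - W s \<omega>)"
    using W_measurable[of s] W_measurable[of t] st by auto
  ultimately show ?thesis by (simp add: indep_var_eq)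
qed

lemma
  assumes st: "0 \<le> s" "s < t" "t \<le> T"
  shows integrable_increment_power: "integrable M (\<lambda>\<omega>. (W t \<omega> - W s \<omega>) ^ k)"
    and increment_moment_odd: "odd k \<Longrightarrow> (\<integral>\<omega>. (W t \<omega> - W s \<omega>) ^ k \<partial>M) = 0"
    and increment_moment_even:
      "even k \<Longrightarrow> (\<integral>\<omega>. (W t \<omega> - W s \<omega>) ^ k \<partial>M)
         = fact k / (2 ^ (k div 2) * fact (k div 2)) * (t - s) ^ (k div 2)"
proof -
  let ?f = "normal_density 0 (sqrt (t - s))"
  have sp: "0 < sqrt (t - s)" using st by simp
  note D = distributed_increment[OF st]
  have i: "(\<integral>\<omega>. (W t \<omega> - W s \<omega>) ^ k \<partial>M) = (\<integral>x. ?f x * x ^ k \<partial>lborel)"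
    by (rule distributed_integral[OF D, symmetric]) auto
  show "integrable M (\<lambda>\<omega>. (W t \<omega> - W s \<omega>) ^ k)"
    using distributed_integrable[OF D, of "\<lambda>x. x ^ k"] integrable_normal_moment[OF sp, of 0 k] by simp
  show "(\<integral>\<omega>. (W t \<omega> - W s \<omega>) ^ k \<partial>M) = 0" if "odd k"
    using i integral_normal_moment_odd[OF sp, of 0 "k div 2"] that by (simp add: odd_two_times_div_two_succ)
  show "(\<integral>\<omega>. (W t \<omega> - W s \<omega>) ^ k \<partial>M)
         = fact k / (2 ^ (k div 2) * fact (k div 2)) * (t - s) ^ (k div 2)" if "even k"
    using i integral_normal_moment_even[OF sp, of 0 "k div 2"] that st by (simp add: power_divide)
qed

text \<open>A martingale transform of the increments along the grid. It is indexed by the grid point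
  and not by time, so that proofs run by induction on \<open>i\<close>; adaptedness of
  \<open>g\<close> is left to the lemmas.\<close>

definition grid_integral :: "(nat \<Rightarrow> real) \<Rightarrow> (nat \<Rightarrow> 'a \<Rightarrow> real) \<Rightarrow> nat \<Rightarrow> 'a \<Rightarrow> real" where
  "grid_integral \<rho> g i \<omega> = (\<Sum>j<i. g j \<omega> * (W (\<rho> (Suc j)) \<omega> - W (\<rho> j) \<omega>))"

end

lemma partition_strict_mono:
  assumes "is_partition t m \<rho>" "i < j" "j \<le> m"
  shows "\<rho> i < \<rho> j"
  using assms(2,3)
proof (induction j)
  case (Suc j)
  have "\<rho> j < \<rho> (Suc j)" using assms(1) Suc.prems by (auto simp: is_partition_def)
  then show ?case using Suc by (cases "i = j") (auto intro: less_trans)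
qed simp

lemma partition_mono: "is_partition t m \<rho> \<Longrightarrow> i \<le> j \<Longrightarrow> j \<le> m \<Longrightarrow> \<rho> i \<le> \<rho> j"
  using partition_strict_mono[of t m \<rho> i j] by (cases "i = j") (auto simp: less_imp_le)

lemma partition_range: "is_partition t m \<rho> \<Longrightarrow> i \<le> m \<Longrightarrow> 0 \<le> \<rho> i \<and> \<rho> i \<le> t"
  using partition_mono[of t m \<rho> 0 i] partition_mono[of t m \<rho> i m] by (auto simp: is_partition_def)

context brownian begin

lemma grid_integral_Suc: "grid_integral \<rho> g (Suc i) \<omega> = grid_integral \<rho> g i \<omega> + g i \<omega> * (W (\<rho> (Suc i)) \<omega> - W (\<rho> i) \<omega>)"
  by (simp add: grid_integral_def)

lemma grid_integral_0: "grid_integral \<rho> g 0 \<omega> = 0"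
  by (simp add: grid_integral_def)

lemma grid_integral_measurable:
  assumes "is_partition T m \<rho>" "\<And>j. j < m \<Longrightarrow> g j \<in> borel_measurable (F (\<rho> j))" "i \<le> m"
  shows "grid_integral \<rho> g i \<in> borel_measurable (F (\<rho> i))"
proof -
  have r: "0 \<le> \<rho> j" "\<rho> j \<le> \<rho> i" "\<rho> i \<le> T" if "j \<le> i" for j
    using that assms partition_range[OF assms(1)] partition_mono[OF assms(1), of j i] by auto
  have "g j \<in> borel_measurable (F (\<rho> i))" if "j < i" for j
    using measurable_F_mono[OF assms(2)] that r[of j] assms(3) by auto
  moreover have "W (\<rho> j) \<in> borel_measurable (F (\<rho> i))" if "j \<le> i" for j
    using measurable_F_mono[OF adapted_W] that r[of j] assms(3) by auto
  ultimately show ?thesis unfolding grid_integral_def by (intro borel_measurable_sum borel_measurable_times borel_measurable_diff) auto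
qed

text \<open>Stands in for conditioning on \<open>F s\<close>: the past factor is independent of the
  increment, hence the expectation of the product splits.\<close>

lemma integrable_mult_increment:
  assumes "A \<in> borel_measurable (F s)" "integrable M A" and st: "0 \<le> s" "s < t" "t \<le> T"
  shows "integrable M (\<lambda>\<omega>. A \<omega> * (W t \<omega> - W s \<omega>) ^ k)"
    and "(\<integral>\<omega>. A \<omega> * (W t \<omega> - W s \<omega>) ^ k \<partial>M) = (\<integral>\<omega>. A \<omega> \<partial>M) * (\<integral>\<omega>. (W t \<omega> - W s \<omega>) ^ k \<partial>M)"
proof -
  have "indep_var borel (id \<circ> A) borel ((\<lambda>x. x ^ k) \<circ> (\<lambda>\<omega>. W t \<omega> - W s \<omega>))"
    by (rule indep_var_compose[OF indep_var_increment[OF assms(1) st]]) auto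
  then have iv: "indep_var borel A borel (\<lambda>\<omega>. (W t \<omega> - W s \<omega>) ^ k)" by (simp add: comp_def)
  show "integrable M (\<lambda>\<omega>. A \<omega> * (W t \<omega> - W s \<omega>) ^ k)"
    by (rule indep_var_integrable[OF iv assms(2) integrable_increment_power[OF st]])
  show "(\<integral>\<omega>. A \<omega> * (W t \<omega> - W s \<omega>) ^ k \<partial>M) = (\<integral>\<omega>. A \<omega> \<partial>M) * (\<integral>\<omega>. (W t \<omega> - W s \<omega>) ^ k \<partial>M)"
    by (rule indep_var_lebesgue_integral[OF iv assms(2) integrable_increment_power[OF st]])
qed

text \<open>The discrete Ito isometry. In the square of the sum the mixed term is a past factor
  times a centred increment and vanishes, while the squared increment contributes the length of the
  step. The bounds serve integrability only, hence they may differ from step to step.\<close>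

lemma grid_integral_isometry:
  assumes P: "is_partition T m \<rho>" and g: "\<And>j. j < m \<Longrightarrow> g j \<in> borel_measurable (F (\<rho> j))"
    and bound: "\<And>j \<omega>. j < m \<Longrightarrow> \<omega> \<in> space M \<Longrightarrow> \<bar>g j \<omega>\<bar> \<le> B j" and i: "i \<le> m"
  shows "integrable M (\<lambda>\<omega>. (grid_integral \<rho> g i \<omega>)\<^sup>2) \<and>
    (\<integral>\<omega>. (grid_integral \<rho> g i \<omega>)\<^sup>2 \<partial>M) = (\<integral>\<omega>. (\<Sum>j<i. (g j \<omega>)\<^sup>2 * (\<rho> (Suc j) - \<rho> j)) \<partial>M)"
  using i
proof (induction i)
  case 0
  then show ?case by (simp add: grid_integral_0)
next
  case (Suc i)
  then have i: "i < m" by simp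
  have r: "0 \<le> \<rho> i" "\<rho> i < \<rho> (Suc i)" "\<rho> (Suc i) \<le> T"
    using partition_range[OF P] P i by (auto simp: is_partition_def)
  let ?D = "\<lambda>\<omega>. W (\<rho> (Suc i)) \<omega> - W (\<rho> i) \<omega>"
  note [measurable] = g[OF i]
  have [measurable]: "grid_integral \<rho> g i \<in> borel_measurable (F (\<rho> i))"
    using grid_integral_measurable[OF P g] i by auto
  have [measurable]: "g j \<in> borel_measurable M" if "j < m" for j
    using measurable_F_M[OF g[OF that]] partition_range[OF P, of j] that by auto
  have wM[measurable]: "grid_integral \<rho> g i \<in> borel_measurable M"
    by (rule measurable_F_M[of _ "\<rho> i"]) (use r in auto)
  have int2: "integrable M (\<lambda>\<omega>. (grid_integral \<rho> g i \<omega>)\<^sup>2)" using Suc by auto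
  have intg2: "integrable M (\<lambda>\<omega>. (g j \<omega>)\<^sup>2)" if "j < m" for j
  proof (rule integrable_const_bound[of _ "(B j)\<^sup>2"])
    show "AE x in M. norm ((g j x)\<^sup>2) \<le> (B j)\<^sup>2"
      using power_mono[OF bound[OF that] abs_ge_zero, of _ 2] by (intro AE_I2) simp
  qed (use that in measurable)
  have intc: "integrable M (\<lambda>\<omega>. grid_integral \<rho> g i \<omega> * g i \<omega>)"
  proof (rule Bochner_Integration.integrable_bound[of _ "\<lambda>\<omega>. (grid_integral \<rho> g i \<omega>)\<^sup>2 + (g i \<omega>)\<^sup>2"])
    show "AE \<omega> in M. norm (grid_integral \<rho> g i \<omega> * g i \<omega>) \<le> norm ((grid_integral \<rho> g i \<omega>)\<^sup>2 + (g i \<omega>)\<^sup>2)"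
    proof (rule AE_I2)
      fix \<omega>
      have "2 * (\<bar>grid_integral \<rho> g i \<omega>\<bar> * \<bar>g i \<omega>\<bar>) \<le> (grid_integral \<rho> g i \<omega>)\<^sup>2 + (g i \<omega>)\<^sup>2"
        using sum_squares_bound[of "\<bar>grid_integral \<rho> g i \<omega>\<bar>" "\<bar>g i \<omega>\<bar>"] by simp
      moreover have "0 \<le> \<bar>grid_integral \<rho> g i \<omega>\<bar> * \<bar>g i \<omega>\<bar>" by (intro mult_nonneg_nonneg) auto
      ultimately show "norm (grid_integral \<rho> g i \<omega> * g i \<omega>) \<le> norm ((grid_integral \<rho> g i \<omega>)\<^sup>2 + (g i \<omega>)\<^sup>2)"
        unfolding real_norm_def abs_mult by linarith
    qed
  qed (use int2 intg2 i in \<open>auto intro!: borel_measurable_times\<close>)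
  have eq: "(grid_integral \<rho> g (Suc i) \<omega>)\<^sup>2 = (grid_integral \<rho> g i \<omega>)\<^sup>2 + 2 * ((grid_integral \<rho> g i \<omega> * g i \<omega>) * ?D \<omega> ^ 1)
      + (g i \<omega>)\<^sup>2 * ?D \<omega> ^ 2" for \<omega>
    by (simp add: grid_integral_Suc power2_eq_square algebra_simps)
  note c = integrable_mult_increment[OF _ intc r, of 1] integrable_mult_increment[OF _ intg2[OF i] r, of 2]
  have 1: "integrable M (\<lambda>\<omega>. (grid_integral \<rho> g i \<omega> * g i \<omega>) * ?D \<omega> ^ 1)"
    "(\<integral>\<omega>. (grid_integral \<rho> g i \<omega> * g i \<omega>) * ?D \<omega> ^ 1 \<partial>M) = 0"
    using c(1,2) increment_moment_odd[OF r, of 1] by auto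
  have 2: "integrable M (\<lambda>\<omega>. (g i \<omega>)\<^sup>2 * ?D \<omega> ^ 2)"
    "(\<integral>\<omega>. (g i \<omega>)\<^sup>2 * ?D \<omega> ^ 2 \<partial>M) = (\<integral>\<omega>. (g i \<omega>)\<^sup>2 * (\<rho> (Suc i) - \<rho> i) \<partial>M)"
    using c(3,4) increment_moment_even[OF r, of 2] by (auto simp: fact_2)
  have intS: "integrable M (\<lambda>\<omega>. \<Sum>j<i. (g j \<omega>)\<^sup>2 * (\<rho> (Suc j) - \<rho> j))"
    using intg2 i by (intro Bochner_Integration.integrable_sum integrable_mult_left) auto
  have int12: "integrable M (\<lambda>\<omega>. (grid_integral \<rho> g i \<omega>)\<^sup>2 + 2 * ((grid_integral \<rho> g i \<omega> * g i \<omega>) * ?D \<omega> ^ 1))"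
    using int2 1 by (intro Bochner_Integration.integrable_add integrable_mult_right)
  have "(\<integral>\<omega>. (grid_integral \<rho> g (Suc i) \<omega>)\<^sup>2 \<partial>M) = (\<integral>\<omega>. (grid_integral \<rho> g i \<omega>)\<^sup>2 \<partial>M) + (\<integral>\<omega>. (g i \<omega>)\<^sup>2 * (\<rho> (Suc i) - \<rho> i) \<partial>M)"
    unfolding eq using int12 int2 1 2
    by (subst Bochner_Integration.integral_add Bochner_Integration.integral_mult_right_zero, (simp add: integrable_mult_right)+)+
  also have "\<dots> = (\<integral>\<omega>. (\<Sum>j<Suc i. (g j \<omega>)\<^sup>2 * (\<rho> (Suc j) - \<rho> j)) \<partial>M)"
    using Suc intS intg2[OF i] by simp
  finally show ?case unfolding eq using int12 2 by auto
qed

text \<open>The integrand is switched off as soon as its squared integral exceeds \<open>c\<close> or the integral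
  itself exceeds \<open>\<delta>\<close>; this turns Chebyshev's inequality at the final time into a maximal one.\<close>

lemma grid_integral_maximal:
  assumes P: "is_partition T m \<rho>" and g: "\<And>j. j < m \<Longrightarrow> g j \<in> borel_measurable (F (\<rho> j))"
    and c: "0 < c" and \<delta>: "0 < \<delta>"
  shows "prob {\<omega> \<in> space M. \<exists>i\<in>{..m}. \<bar>grid_integral \<rho> g i \<omega>\<bar> > \<delta>}
    \<le> prob {\<omega> \<in> space M. (\<Sum>j<m. (g j \<omega>)\<^sup>2 * (\<rho> (Suc j) - \<rho> j)) > c} + c / \<delta>\<^sup>2"
proof -
  define Q where "Q i \<omega> = (\<Sum>j<i. (g j \<omega>)\<^sup>2 * (\<rho> (Suc j) - \<rho> j))" for i \<omega>
  \<comment> \<open>\<open>A j\<close> has to be decided at the left end of step \<open>j\<close>.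
    Hence the integral is tested up to index \<open>j\<close> only, while the squared integral may
    already include step \<open>j\<close>, because \<open>g j\<close> is known at that time.\<close>
  define A where "A j \<omega> \<longleftrightarrow> Q (Suc j) \<omega> \<le> c \<and> (\<forall>k\<in>{..j}. \<bar>grid_integral \<rho> g k \<omega>\<bar> \<le> \<delta>)" for j \<omega>
  define g' where "g' j \<omega> = (if A j \<omega> then g j \<omega> else 0)" for j \<omega>
  have pos: "0 < \<rho> (Suc j) - \<rho> j" if "j < m" for j using P that by (auto simp: is_partition_def)
  have posn: "0 \<le> x\<^sup>2 * (\<rho> (Suc j) - \<rho> j)" if "j < m" for j x using pos[OF that] by (intro mult_nonneg_nonneg) auto
  have r: "0 \<le> \<rho> j" "\<rho> j \<le> T" if "j \<le> m" for j using partition_range[OF P that] by auto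
  have gle: "g k \<in> borel_measurable (F (\<rho> j))" if "k \<le> j" "j < m" for j k
    using measurable_F_mono[OF g[of k], of "\<rho> j"] r[of k] r[of j] partition_mono[OF P, of k j] that by auto
  have wle: "grid_integral \<rho> g k \<in> borel_measurable (F (\<rho> j))" if "k \<le> j" "j \<le> m" for j k
    using measurable_F_mono[OF grid_integral_measurable[OF P g, of k], of "\<rho> j"] r[of k] r[of j] partition_mono[OF P, of k j] that by auto
  have g': "g' j \<in> borel_measurable (F (\<rho> j))" if j: "j < m" for j
  proof -
    have [measurable]: "g j \<in> borel_measurable (F (\<rho> j))" by (rule g[OF j])
    have [measurable]: "Q (Suc j) \<in> borel_measurable (F (\<rho> j))"
      unfolding Q_def using gle j by (intro borel_measurable_sum borel_measurable_times borel_measurable_power) auto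
    have 1: "{\<omega> \<in> space (F (\<rho> j)). Q (Suc j) \<omega> \<le> c} \<in> sets (F (\<rho> j))" by measurable
    have 2: "{\<omega> \<in> space (F (\<rho> j)). \<forall>k\<in>{..j}. \<bar>grid_integral \<rho> g k \<omega>\<bar> \<le> \<delta>} \<in> sets (F (\<rho> j))"
    proof (rule sets.sets_Collect_finite_All)
      fix k assume "k \<in> {..j}"
      then have [measurable]: "grid_integral \<rho> g k \<in> borel_measurable (F (\<rho> j))" using wle j by auto
      show "{\<omega> \<in> space (F (\<rho> j)). \<bar>grid_integral \<rho> g k \<omega>\<bar> \<le> \<delta>} \<in> sets (F (\<rho> j))" by measurable
    qed auto
    have [measurable]: "Measurable.pred (F (\<rho> j)) (A j)"
      using sets.sets_Collect_conj[OF 2 1] unfolding A_def pred_def .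
    show ?thesis unfolding g'_def by measurable
  qed
  have Qmono: "Q i \<omega> \<le> Q k \<omega>" if "i \<le> k" "k \<le> m" for i k \<omega>
    unfolding Q_def using that by (intro sum_mono2) (auto intro!: posn)
  have Adec: "A i \<omega>" if "A j \<omega>" "i \<le> j" "j < m" for i j \<omega>
    using that Qmono[of "Suc i" "Suc j" \<omega>] unfolding A_def by auto
  have Q'le: "(\<Sum>j<i. (g' j \<omega>)\<^sup>2 * (\<rho> (Suc j) - \<rho> j)) \<le> c" if "i \<le> m" for i \<omega>
    using that
  proof (induction i)
    case (Suc i)
    show ?case
    proof (cases "A i \<omega>")
      case True
      have "(\<Sum>j<Suc i. (g' j \<omega>)\<^sup>2 * (\<rho> (Suc j) - \<rho> j)) = Q (Suc i) \<omega>"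
        unfolding Q_def using Adec[OF True] Suc.prems by (intro sum.cong) (auto simp: g'_def)
      then show ?thesis using True by (simp add: A_def)
    qed (use Suc in \<open>simp add: g'_def\<close>)
  qed (use c in simp)
  \<comment> \<open>\<open>g\<close> itself may be unbounded. The stopped integrand is bounded
    because a single summand of its squared integral is at most \<open>c\<close>.\<close>
  have bound: "\<bar>g' j \<omega>\<bar> \<le> sqrt (c / (\<rho> (Suc j) - \<rho> j))" if j: "j < m" for j \<omega>
  proof -
    have "(g' j \<omega>)\<^sup>2 * (\<rho> (Suc j) - \<rho> j) \<le> (\<Sum>j<Suc j. (g' j \<omega>)\<^sup>2 * (\<rho> (Suc j) - \<rho> j))"
      using j by (intro member_le_sum) (auto intro!: posn)
    also have "\<dots> \<le> c" using Q'le[of "Suc j"] j by auto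
    finally show ?thesis using pos[OF j] by (intro real_le_rsqrt) (simp add: pos_le_divide_eq)
  qed
  note iso = grid_integral_isometry[OF P g' bound order_refl]
  have gM: "g j \<in> borel_measurable M" "g' j \<in> borel_measurable M" if "j < m" for j
    using measurable_F_M[OF g[OF that]] measurable_F_M[OF g'[OF that]] r[of j] that by auto
  have wM: "grid_integral \<rho> g i \<in> borel_measurable M" "grid_integral \<rho> g' i \<in> borel_measurable M" if "i \<le> m" for i
    using measurable_F_M[OF grid_integral_measurable[OF P g that]] measurable_F_M[OF grid_integral_measurable[OF P g' that]]
      r[OF that] by auto
  have "(\<integral>\<omega>. (grid_integral \<rho> g' m \<omega>)\<^sup>2 \<partial>M) = (\<integral>\<omega>. (\<Sum>j<m. (g' j \<omega>)\<^sup>2 * (\<rho> (Suc j) - \<rho> j)) \<partial>M)"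
    using iso by auto
  also have "\<dots> \<le> (\<integral>\<omega>. c \<partial>M)"
  proof (rule integral_mono)
    show "integrable M (\<lambda>\<omega>. \<Sum>j<m. (g' j \<omega>)\<^sup>2 * (\<rho> (Suc j) - \<rho> j))"
    proof (rule integrable_const_bound[of _ c])
      show "AE \<omega> in M. norm (\<Sum>j<m. (g' j \<omega>)\<^sup>2 * (\<rho> (Suc j) - \<rho> j)) \<le> c"
        proof (intro AE_I2)
        fix \<omega>
        have "0 \<le> (\<Sum>j<m. (g' j \<omega>)\<^sup>2 * (\<rho> (Suc j) - \<rho> j))" using posn by (intro sum_nonneg) auto
        then show "norm (\<Sum>j<m. (g' j \<omega>)\<^sup>2 * (\<rho> (Suc j) - \<rho> j)) \<le> c" using Q'le[of m \<omega>] by simp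
      qed
    qed (intro borel_measurable_sum borel_measurable_times borel_measurable_power, use gM in auto)
  qed (use Q'le in auto)
  finally have E: "(\<integral>\<omega>. (grid_integral \<rho> g' m \<omega>)\<^sup>2 \<partial>M) \<le> c" by (simp add: prob_space)
  have Qm[measurable]: "Q m \<in> borel_measurable M"
    unfolding Q_def by (intro borel_measurable_sum borel_measurable_times borel_measurable_power, use gM in auto)
  have [measurable]: "grid_integral \<rho> g' m \<in> borel_measurable M" using wM by auto
  let ?B = "{\<omega> \<in> space M. \<delta>\<^sup>2 \<le> (grid_integral \<rho> g' m \<omega>)\<^sup>2}"
  have "prob {\<omega> \<in> space M. \<exists>i\<in>{..m}. \<bar>grid_integral \<rho> g i \<omega>\<bar> > \<delta>} \<le> prob ({\<omega> \<in> space M. Q m \<omega> > c} \<union> ?B)"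
  proof (rule finite_measure_mono)
    show "{\<omega> \<in> space M. Q m \<omega> > c} \<union> ?B \<in> events" by measurable
    show "{\<omega> \<in> space M. \<exists>i\<in>{..m}. \<bar>grid_integral \<rho> g i \<omega>\<bar> > \<delta>} \<subseteq> {\<omega> \<in> space M. Q m \<omega> > c} \<union> ?B"
    proof safe
      fix \<omega> i assume \<omega>: "\<omega> \<in> space M" "i \<le> m" "\<bar>grid_integral \<rho> g i \<omega>\<bar> > \<delta>" "\<not> \<delta>\<^sup>2 \<le> (grid_integral \<rho> g' m \<omega>)\<^sup>2"
      define i0 where "i0 = (LEAST i. \<bar>grid_integral \<rho> g i \<omega>\<bar> > \<delta>)"
      have i0: "\<bar>grid_integral \<rho> g i0 \<omega>\<bar> > \<delta>" "i0 \<le> i" "\<And>k. k < i0 \<Longrightarrow> \<bar>grid_integral \<rho> g k \<omega>\<bar> \<le> \<delta>"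
        unfolding i0_def using \<omega>(3) not_less_Least by (auto intro: LeastI Least_le simp: not_less[symmetric])
      show "Q m \<omega> > c"
      proof (rule ccontr)
        assume q: "\<not> Q m \<omega> > c"
        \<comment> \<open>While the squared integral stays below \<open>c\<close>, the integrand can
          only be switched off by the first crossing \<open>i0\<close>. So \<open>g'\<close> equals
          \<open>g\<close> before \<open>i0\<close> and is 0 afterwards, and the stopped integral
          keeps its crossing value until the end.\<close>
        have "A j \<omega>" if "j < i0" for j
          using that i0 q Qmono[of "Suc j" m \<omega>] \<omega>(2) unfolding A_def by auto
        moreover have "\<not> A j \<omega>" if "i0 \<le> j" for j using that i0(1) unfolding A_def by (auto simp: not_le)
        ultimately have "g' j \<omega> = (if j < i0 then g j \<omega> else 0)" for j by (auto simp: g'_def)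
        then have "grid_integral \<rho> g' m \<omega> = (\<Sum>j\<in>{..<m}. if j < i0 then g j \<omega> * (W (\<rho> (Suc j)) \<omega> - W (\<rho> j) \<omega>) else 0)"
          unfolding grid_integral_def by (intro sum.cong) auto
        also have "\<dots> = (\<Sum>j\<in>{..<m} \<inter> {j. j < i0}. g j \<omega> * (W (\<rho> (Suc j)) \<omega> - W (\<rho> j) \<omega>))"
          by (subst sum.inter_restrict) auto
        also have "{..<m} \<inter> {j. j < i0} = {..<i0}" using i0(2) \<omega>(2) by auto
        finally have "grid_integral \<rho> g' m \<omega> = grid_integral \<rho> g i0 \<omega>" by (simp add: grid_integral_def)
        then have "\<delta> \<le> \<bar>grid_integral \<rho> g' m \<omega>\<bar>" using i0(1) by simp
        then have "\<delta>\<^sup>2 \<le> \<bar>grid_integral \<rho> g' m \<omega>\<bar>\<^sup>2" using \<delta> by (intro power_mono) auto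
        then show False using \<omega>(4) by simp
      qed
    qed
  qed
  also have "\<dots> \<le> prob {\<omega> \<in> space M. Q m \<omega> > c} + prob ?B"
    by (rule measure_Un_le) measurable
  also have "prob ?B \<le> (\<integral>\<omega>. (grid_integral \<rho> g' m \<omega>)\<^sup>2 \<partial>M) / \<delta>\<^sup>2"
    by (rule integral_Markov_inequality_measure[of _ _ "{}"]) (use iso \<delta> in auto)
  also have "\<dots> \<le> c / \<delta>\<^sup>2" using E \<delta> by (intro divide_right_mono) auto
  finally show ?thesis unfolding Q_def by simp
qed

end

section \<open>Step processes and their integrals on common refinements\<close>

lemma partition_of_finite_set:
  fixes S :: "real set"
  assumes "finite S" "S \<subseteq> {0..T}" "0 \<in> S" "T \<in> S"
  obtains m \<rho> where "is_partition T m \<rho>" "\<rho> ` {..m} = S"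
proof
  let ?xs = "sorted_list_of_set S"
  have len: "length ?xs = card S" by simp
  have c: "0 < card S" using assms by (auto simp: card_gt_0_iff)
  have st: "sorted_wrt (<) ?xs" by simp
  have set: "set ?xs = S" using assms by simp
  have inS: "?xs ! i \<in> S" if "i < card S" for i using nth_mem[of i ?xs] that len set by simp
  have mono: "?xs ! i \<le> ?xs ! j" if "i \<le> j" "j < card S" for i j
    using sorted_nth_mono[of ?xs i j] that by simp
  show "(\<lambda>j. ?xs ! j) ` {..card S - 1} = S"
  proof -
    have "(\<lambda>j. ?xs ! j) ` {..card S - 1} = (\<lambda>j. ?xs ! j) ` {..<length ?xs}"
      using c by (intro arg_cong[where f="image _"]) auto
    also have "\<dots> = S" using set by (auto simp: set_conv_nth)
    finally show ?thesis .
  qed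
  have "?xs ! 0 = 0"
  proof -
    obtain i where "i < card S" "?xs ! i = 0" using \<open>0 \<in> S\<close> set len by (metis in_set_conv_nth)
    then have "?xs ! 0 \<le> 0" using mono[of 0 i] by simp
    moreover have "?xs ! 0 \<ge> 0" using inS[OF c] assms by auto
    ultimately show ?thesis by simp
  qed
  moreover have "?xs ! (card S - 1) = T"
  proof -
    obtain i where "i < card S" "?xs ! i = T" using \<open>T \<in> S\<close> set len by (metis in_set_conv_nth)
    then have "T \<le> ?xs ! (card S - 1)" using mono[of i "card S - 1"] by simp
    moreover have "?xs ! (card S - 1) \<le> T" using inS[of "card S - 1"] c assms by auto
    ultimately show ?thesis by simp
  qed
  moreover have "?xs ! i < ?xs ! Suc i" if "i < card S - 1" for i
    using sorted_wrt_nth_less[OF st, of i "Suc i"] that len by auto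
  ultimately show "is_partition T (card S - 1) (\<lambda>j. ?xs ! j)" by (auto simp: is_partition_def)
qed

text \<open>The integrand of \<open>simple_integral\<close>, kept together with its jump times and
  values. For a partition it vanishes at \<open>s = 0\<close>, since the intervals are open on the
  left; pathwise comparisons therefore leave out that point.\<close>

definition step_process :: "nat \<Rightarrow> (nat \<Rightarrow> real) \<Rightarrow> (nat \<Rightarrow> 'a \<Rightarrow> real) \<Rightarrow> real \<Rightarrow> 'a \<Rightarrow> real" where
  "step_process n \<tau> h s \<omega> = (\<Sum>i<n. h i \<omega> * indicator {\<tau> i<..\<tau> (Suc i)} s)"

lemma image_atMost_subsetE:
  fixes \<tau> \<rho> :: "nat \<Rightarrow> real"
  assumes "\<tau> ` {..n} \<subseteq> \<rho> ` {..m}" "k \<le> n"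
  obtains a where "\<tau> k = \<rho> a" "a \<le> m"
  using assms by (metis atMost_iff imageE imageI subsetD)

text \<open>All jump times are points of the finer grid, so no half-open grid interval is cut by one
  of them. The process is left continuous, which is why the right end of the interval represents
  it.\<close>

lemma step_process_const:
  assumes P: "is_partition T m \<rho>" and sub: "\<tau> ` {..n} \<subseteq> \<rho> ` {..m}" and j: "j < m"
    and s: "s \<in> {\<rho> j<..\<rho> (Suc j)}"
  shows "step_process n \<tau> h s \<omega> = step_process n \<tau> h (\<rho> (Suc j)) \<omega>"
proof -
  have "indicator {\<tau> i<..\<tau> (Suc i)} s = (indicator {\<tau> i<..\<tau> (Suc i)} (\<rho> (Suc j)) :: real)" if i: "i < n" for i
  proof -
    obtain a where "\<tau> i = \<rho> a" "a \<le> m" by (rule image_atMost_subsetE[OF sub, of i]) (use i in auto)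
    moreover obtain a' where "\<tau> (Suc i) = \<rho> a'" "a' \<le> m"
      by (rule image_atMost_subsetE[OF sub, of "Suc i"]) (use i in auto)
    ultimately have a: "\<tau> i = \<rho> a" "a \<le> m" "\<tau> (Suc i) = \<rho> a'" "a' \<le> m" by auto
    have lt: "\<rho> k < s \<longleftrightarrow> k \<le> j" "\<rho> k < \<rho> (Suc j) \<longleftrightarrow> k \<le> j" 
      "s \<le> \<rho> k \<longleftrightarrow> Suc j \<le> k" "\<rho> (Suc j) \<le> \<rho> k \<longleftrightarrow> Suc j \<le> k" if "k \<le> m" for k
    proof -
      have m: "k \<le> j \<Longrightarrow> \<rho> k \<le> \<rho> j" "Suc j \<le> k \<Longrightarrow> \<rho> (Suc j) \<le> \<rho> k"
        using partition_mono[OF P, of k j] partition_mono[OF P, of "Suc j" k] that j by auto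
      have "k \<le> j \<or> Suc j \<le> k" by linarith
      then have "(k \<le> j \<and> \<rho> k \<le> \<rho> j) \<or> (\<not> k \<le> j \<and> Suc j \<le> k \<and> \<rho> (Suc j) \<le> \<rho> k)" using m by auto
      moreover have "\<rho> j < s" "s \<le> \<rho> (Suc j)" using s by auto
      ultimately show "\<rho> k < s \<longleftrightarrow> k \<le> j" "\<rho> k < \<rho> (Suc j) \<longleftrightarrow> k \<le> j" 
        "s \<le> \<rho> k \<longleftrightarrow> Suc j \<le> k" "\<rho> (Suc j) \<le> \<rho> k \<longleftrightarrow> Suc j \<le> k"
        by linarith+
    qed
    have "(\<tau> i < s) = (\<tau> i < \<rho> (Suc j))" "(s \<le> \<tau> (Suc i)) = (\<rho> (Suc j) \<le> \<tau> (Suc i))"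
      unfolding a by (simp_all add: lt a(2,4))
    then show ?thesis by (auto simp: indicator_def)
  qed
  then show ?thesis unfolding step_process_def by simp
qed

lemma partition_le_iff:
  assumes "is_partition t m \<rho>" "i \<le> m" "j \<le> m"
  shows "\<rho> i \<le> \<rho> j \<longleftrightarrow> i \<le> j"
  using partition_mono[OF assms(1), of i j] partition_strict_mono[OF assms(1), of j i] assms by fastforce

lemma partition_less_iff:
  assumes "is_partition t m \<rho>" "i \<le> m" "j \<le> m"
  shows "\<rho> i < \<rho> j \<longleftrightarrow> i < j"
  using partition_le_iff[OF assms(1,3,2)] by auto

lemma nn_integral_piecewise_const:
  fixes d :: "real \<Rightarrow> real"
  assumes P: "is_partition T m \<rho>" and d: "\<And>j s. j < m \<Longrightarrow> s \<in> {\<rho> j<..\<rho> (Suc j)} \<Longrightarrow> d s = d (\<rho> (Suc j))"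
    and [measurable]: "d \<in> borel_measurable borel" and b: "b \<le> m"
  shows "(\<integral>\<^sup>+s\<in>{0..\<rho> b}. ennreal ((d s)\<^sup>2) \<partial>lborel) = ennreal (\<Sum>j<b. (d (\<rho> (Suc j)))\<^sup>2 * (\<rho> (Suc j) - \<rho> j))"
  using b
proof (induction b)
  case 0
  have "\<rho> 0 = 0" using P by (simp add: is_partition_def)
  then have "(\<integral>\<^sup>+s\<in>{0..\<rho> 0}. ennreal ((d s)\<^sup>2) \<partial>lborel) = (\<integral>\<^sup>+s\<in>{0}. ennreal ((d s)\<^sup>2) \<partial>lborel)" by simp
  also have "\<dots> = 0" by (rule nn_integral_null_set) auto
  finally show ?case by simp
next
  case (Suc b)
  have r: "0 \<le> \<rho> b" "\<rho> b < \<rho> (Suc b)"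
    using partition_range[OF P, of b] P Suc.prems by (auto simp: is_partition_def)
  have "(\<integral>\<^sup>+s\<in>{0..\<rho> (Suc b)}. ennreal ((d s)\<^sup>2) \<partial>lborel)
      = (\<integral>\<^sup>+s. ennreal ((d s)\<^sup>2) * indicator {0..\<rho> b} s + ennreal ((d (\<rho> (Suc b)))\<^sup>2) * indicator {\<rho> b<..\<rho> (Suc b)} s \<partial>lborel)"
  proof (rule nn_integral_cong)
    fix s
    show "ennreal ((d s)\<^sup>2) * indicator {0..\<rho> (Suc b)} s = ennreal ((d s)\<^sup>2) * indicator {0..\<rho> b} s
      + ennreal ((d (\<rho> (Suc b)))\<^sup>2) * indicator {\<rho> b<..\<rho> (Suc b)} s"
    proof (cases "s \<in> {\<rho> b<..\<rho> (Suc b)}")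
      case True
      have "d s = d (\<rho> (Suc b))" by (rule d[OF _ True]) (use Suc.prems in simp)
      then show ?thesis using True r by (simp add: indicator_def)
    qed (use r in \<open>auto simp: indicator_def\<close>)
  qed
  also have "\<dots> = (\<integral>\<^sup>+s\<in>{0..\<rho> b}. ennreal ((d s)\<^sup>2) \<partial>lborel) + ennreal ((d (\<rho> (Suc b)))\<^sup>2) * ennreal (\<rho> (Suc b) - \<rho> b)"
    using r by (subst nn_integral_add) (auto simp: nn_integral_cmult_indicator)
  also have "\<dots> = ennreal (\<Sum>j<Suc b. (d (\<rho> (Suc j)))\<^sup>2 * (\<rho> (Suc j) - \<rho> j))"
  proof -
    have "0 \<le> (\<Sum>j<b. (d (\<rho> (Suc j)))\<^sup>2 * (\<rho> (Suc j) - \<rho> j))"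
      using P Suc.prems by (intro sum_nonneg mult_nonneg_nonneg) (auto simp: is_partition_def less_imp_le)
    then have "ennreal (\<Sum>j<b. (d (\<rho> (Suc j)))\<^sup>2 * (\<rho> (Suc j) - \<rho> j))
        + ennreal ((d (\<rho> (Suc b)))\<^sup>2) * ennreal (\<rho> (Suc b) - \<rho> b)
        = ennreal ((\<Sum>j<b. (d (\<rho> (Suc j)))\<^sup>2 * (\<rho> (Suc j) - \<rho> j)) + (d (\<rho> (Suc b)))\<^sup>2 * (\<rho> (Suc b) - \<rho> b))"
      using r by (subst ennreal_mult[symmetric], simp, simp, subst ennreal_plus[symmetric]) auto
    then show ?thesis using Suc by simp
  qed
  finally show ?case .
qed

lemma step_process_measurable[measurable]: "(\<lambda>s. step_process n \<tau> h s \<omega>) \<in> borel_measurable borel"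
  unfolding step_process_def by measurable

context brownian begin

text \<open>The stochastic integral of \<open>step_process\<close> over \<open>[0,u]\<close>. The
  minimum freezes all increments at time \<open>u\<close>, so one simple integrand can be integrated
  up to every \<open>u\<close>.\<close>

definition elem_integral :: "nat \<Rightarrow> (nat \<Rightarrow> real) \<Rightarrow> (nat \<Rightarrow> 'a \<Rightarrow> real) \<Rightarrow> real \<Rightarrow> 'a \<Rightarrow> real" where
  "elem_integral n \<tau> h u \<omega> = (\<Sum>i<n. h i \<omega> * (W (min (\<tau> (Suc i)) u) \<omega> - W (min (\<tau> i) u) \<omega>))"

text \<open>Refining the grid does not change the integral: for each \<open>i\<close> the grid
  increments inside the \<open>i\<close>-th interval telescope, cut off at
  \<open>\<rho> b\<close>.\<close>

lemma grid_integral_step_process: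
  assumes P: "is_partition T m \<rho>" and sub: "\<tau> ` {..n} \<subseteq> \<rho> ` {..m}" and b: "b \<le> m"
    and Q: "is_partition t n \<tau>"
  shows "grid_integral \<rho> (\<lambda>j. step_process n \<tau> h (\<rho> (Suc j))) b \<omega> = elem_integral n \<tau> h (\<rho> b) \<omega>"
proof -
  let ?W = "\<lambda>j. W (\<rho> j) \<omega>"
  have inner: "(\<Sum>j<b. indicator {\<tau> i<..\<tau> (Suc i)} (\<rho> (Suc j)) * (?W (Suc j) - ?W j))
      = W (min (\<tau> (Suc i)) (\<rho> b)) \<omega> - W (min (\<tau> i) (\<rho> b)) \<omega>" if i: "i < n" for i
  proof -
    obtain a where "\<tau> i = \<rho> a" "a \<le> m" by (rule image_atMost_subsetE[OF sub, of i]) (use i in auto)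
    moreover obtain a' where "\<tau> (Suc i) = \<rho> a'" "a' \<le> m"
      by (rule image_atMost_subsetE[OF sub, of "Suc i"]) (use i in auto)
    ultimately have a: "\<tau> i = \<rho> a" "a \<le> m" "\<tau> (Suc i) = \<rho> a'" "a' \<le> m" by auto
    have "\<rho> a < \<rho> a'" using Q i a by (auto simp: is_partition_def)
    then have aa: "a < a'" using partition_less_iff[OF P a(2,4)] by simp
    have "(\<Sum>j<b. indicator {\<tau> i<..\<tau> (Suc i)} (\<rho> (Suc j)) * (?W (Suc j) - ?W j))
        = (\<Sum>j<b. if j \<in> {a..<a'} then ?W (Suc j) - ?W j else 0)"
    proof (rule sum.cong)
      fix j assume "j \<in> {..<b}"
      then have "Suc j \<le> m" using b by auto
      then show "indicator {\<tau> i<..\<tau> (Suc i)} (\<rho> (Suc j)) * (?W (Suc j) - ?W j)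
          = (if j \<in> {a..<a'} then ?W (Suc j) - ?W j else 0)"
        unfolding a using partition_less_iff[OF P a(2), of "Suc j"] partition_le_iff[OF P _ a(4), of "Suc j"]
        by (auto simp: indicator_def)
    qed simp
    also have "\<dots> = (\<Sum>j\<in>{..<b} \<inter> {a..<a'}. ?W (Suc j) - ?W j)"
      by (subst sum.inter_restrict) auto
    also have "{..<b} \<inter> {a..<a'} = {min a b..<min a' b}" by auto
    also have "(\<Sum>j\<in>{min a b..<min a' b}. ?W (Suc j) - ?W j) = ?W (min a' b) - ?W (min a b)"
      using aa by (intro sum_Suc_diff') auto
    also have "\<rho> (min a' b) = min (\<tau> (Suc i)) (\<rho> b)"
      using partition_le_iff[OF P a(4) b] a by (auto simp: min_def)
    also have "\<rho> (min a b) = min (\<tau> i) (\<rho> b)"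
      using partition_le_iff[OF P a(2) b] a by (auto simp: min_def)
    finally show ?thesis .
  qed
  have "grid_integral \<rho> (\<lambda>j. step_process n \<tau> h (\<rho> (Suc j))) b \<omega>
     = (\<Sum>j<b. \<Sum>i<n. h i \<omega> * (indicator {\<tau> i<..\<tau> (Suc i)} (\<rho> (Suc j)) * (?W (Suc j) - ?W j)))"
    unfolding grid_integral_def step_process_def sum_distrib_right by (simp only: mult.assoc)
  also have "\<dots> = (\<Sum>i<n. h i \<omega> * (\<Sum>j<b. indicator {\<tau> i<..\<tau> (Suc i)} (\<rho> (Suc j)) * (?W (Suc j) - ?W j)))"
    by (subst sum.swap) (simp only: sum_distrib_left)
  also have "\<dots> = elem_integral n \<tau> h (\<rho> b) \<omega>" unfolding elem_integral_def using inner by (intro sum.cong) auto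
  finally show ?thesis .
qed

text \<open>The value at the right end of a grid interval is known at its left end: a jump time
  strictly before \<open>\<rho> (Suc j)\<close> is a grid point and hence at most
  \<open>\<rho> j\<close>.\<close>

lemma step_process_adapted:
  assumes P: "is_partition T m \<rho>" and sub: "\<tau> ` {..n} \<subseteq> \<rho> ` {..m}" and j: "j < m"
    and h: "\<And>i. i < n \<Longrightarrow> h i \<in> borel_measurable (F (\<tau> i))"
  shows "step_process n \<tau> h (\<rho> (Suc j)) \<in> borel_measurable (F (\<rho> j))"
  unfolding step_process_def
proof (rule borel_measurable_sum)
  fix i assume "i \<in> {..<n}"
  then have i: "i < n" by simp
  obtain a where a: "\<tau> i = \<rho> a" "a \<le> m" by (rule image_atMost_subsetE[OF sub, of i]) (use i in auto)
  show "(\<lambda>\<omega>. h i \<omega> * indicator {\<tau> i<..\<tau> (Suc i)} (\<rho> (Suc j))) \<in> borel_measurable (F (\<rho> j))"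
  proof (cases "\<tau> i < \<rho> (Suc j)")
    case True
    then have "a \<le> j" using partition_less_iff[OF P a(2), of "Suc j"] j a by auto
    then have "\<tau> i \<le> \<rho> j" "0 \<le> \<tau> i" "\<rho> j \<le> T"
      using partition_mono[OF P, of a j] partition_range[OF P a(2)] partition_range[OF P, of j] j a by auto
    then have "h i \<in> borel_measurable (F (\<rho> j))" using measurable_F_mono[OF h[OF i]] by auto
    then show ?thesis by (intro borel_measurable_times) auto
  qed (simp add: indicator_def)
qed

end

section \<open>Riemann sums converge to the Ito integral\<close>

lemma (in prob_space) prob_tendsto_0_if_AE_eventually:
  assumes A: "\<And>k::nat. A k \<in> events" and ae: "AE \<omega> in M. eventually (\<lambda>k. \<omega> \<notin> A k) sequentially"
  shows "(\<lambda>k. prob (A k)) \<longlonglongrightarrow> 0"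
proof -
  have "(\<lambda>k. \<integral>\<omega>. indicator (A k) \<omega> \<partial>M :: real) \<longlonglongrightarrow> (\<integral>\<omega>. 0 \<partial>M)"
  proof (rule integral_dominated_convergence[where w="\<lambda>_. 1"])
    show "AE \<omega> in M. (\<lambda>k. indicator (A k) \<omega> :: real) \<longlonglongrightarrow> 0"
      using ae
    proof eventually_elim
      case (elim \<omega>)
      show ?case by (rule tendsto_eventually, rule eventually_mono[OF elim]) (simp add: indicator_def)
    qed
  qed (use A in \<open>auto simp: indicator_def\<close>)
  then show ?thesis using A by simp
qed

text \<open>The maximal inequality leaves an error proportional to its free level \<open>c\<close>.
  For each \<open>c\<close> a different null sequence is allowed, and \<open>c\<close> is sent to 0
  last.\<close>

lemma tendsto_0_if_le_plus_small:
  fixes x :: "nat \<Rightarrow> real"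
  assumes nonneg: "\<And>n. 0 \<le> x n" and K: "0 \<le> K"
    and le: "\<And>c. 0 < c \<Longrightarrow> \<exists>a. a \<longlonglongrightarrow> 0 \<and> eventually (\<lambda>n. x n \<le> a n + K * c) sequentially"
  shows "x \<longlonglongrightarrow> 0"
proof (rule tendstoI)
  fix e :: real assume e: "0 < e"
  define c where "c = e / (2 * (K + 1))"
  have c: "0 < c" "K * c < e / 2"
  proof -
    show "0 < c" using e K by (simp add: c_def)
    have "K * c < (K + 1) * c" using \<open>0 < c\<close> by simp
    also have "\<dots> = e / 2" using K by (simp add: c_def field_simps)
    finally show "K * c < e / 2" .
  qed
  obtain a where a: "a \<longlonglongrightarrow> 0" "eventually (\<lambda>n. x n \<le> a n + K * c) sequentially" using le[OF c(1)] by blast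
  have "eventually (\<lambda>n. a n < e / 2) sequentially" using order_tendstoD(2)[OF a(1), of "e/2"] e by simp
  with a(2) show "eventually (\<lambda>n. dist (x n) 0 < e) sequentially"
    by eventually_elim (use nonneg c(2) in \<open>auto simp: dist_real_def\<close>)
qed

context brownian begin

text \<open>On a common refinement the difference of the two step processes is one adapted grid
  integrand, to which \<open>grid_integral_maximal\<close> applies. The bound is independent of the
  number of times in \<open>U\<close>; this uniformity is what the Riemann sums need later.\<close>

lemma
  assumes Q: "is_partition t n \<tau>" and h: "\<And>i. i < n \<Longrightarrow> h i \<in> borel_measurable (F (\<tau> i))" and t: "t \<le> T"
    and Q': "is_partition t' n' \<tau>'" and h': "\<And>i. i < n' \<Longrightarrow> h' i \<in> borel_measurable (F (\<tau>' i))" and t': "t' \<le> T"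
    and v: "v \<in> {0..T}"
  shows step_diff_measurable:
    "(\<lambda>\<omega>. \<integral>\<^sup>+s\<in>{0..v}. ennreal ((step_process n \<tau> h s \<omega> - step_process n' \<tau>' h' s \<omega>)\<^sup>2) \<partial>lborel) \<in> borel_measurable M"
    and elem_integral_compare:
    "finite U \<Longrightarrow> U \<subseteq> {0..v} \<Longrightarrow> 0 < c \<Longrightarrow> 0 < \<delta> \<Longrightarrow>
     prob {\<omega> \<in> space M. \<exists>u\<in>U. \<bar>elem_integral n \<tau> h u \<omega> - elem_integral n' \<tau>' h' u \<omega>\<bar> > \<delta>}
      \<le> prob {\<omega> \<in> space M. (\<integral>\<^sup>+s\<in>{0..v}. ennreal ((step_process n \<tau> h s \<omega> - step_process n' \<tau>' h' s \<omega>)\<^sup>2) \<partial>lborel) > ennreal c} + c / \<delta>\<^sup>2"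
proof -
  let ?I = "\<lambda>\<omega>. \<integral>\<^sup>+s\<in>{0..v}. ennreal ((step_process n \<tau> h s \<omega> - step_process n' \<tau>' h' s \<omega>)\<^sup>2) \<partial>lborel"
  have main: "\<exists>m \<rho> b g. is_partition T m \<rho> \<and> b \<le> m \<and> (\<forall>j<m. g j \<in> borel_measurable (F (\<rho> j))) \<and>
      (\<forall>\<omega>. ?I \<omega> = ennreal (\<Sum>j<m. (g j \<omega>)\<^sup>2 * (\<rho> (Suc j) - \<rho> j))) \<and>
      (\<forall>u\<in>U. \<exists>i\<le>m. \<forall>\<omega>. grid_integral \<rho> g i \<omega> = elem_integral n \<tau> h u \<omega> - elem_integral n' \<tau>' h' u \<omega>)"
    if U: "finite U" "U \<subseteq> {0..v}" for U
  proof -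
    define S where "S = {0, T, v} \<union> U \<union> \<tau> ` {..n} \<union> \<tau>' ` {..n'}"
    have "\<tau> i \<in> {0..T}" if "i \<le> n" for i using partition_range[OF Q that] t by auto
    moreover have "\<tau>' i \<in> {0..T}" if "i \<le> n'" for i using partition_range[OF Q' that] t' by auto
    ultimately have "finite S" "S \<subseteq> {0..T}" "0 \<in> S" "T \<in> S"
      using U v T_pos by (auto simp: S_def)
    then obtain m \<rho> where P: "is_partition T m \<rho>" and rS: "\<rho> ` {..m} = S" by (rule partition_of_finite_set)
    have sub: "\<tau> ` {..n} \<subseteq> \<rho> ` {..m}" "\<tau>' ` {..n'} \<subseteq> \<rho> ` {..m}" unfolding rS by (auto simp: S_def)
    have "v \<in> \<rho> ` {..m}" unfolding rS by (simp add: S_def)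
    then obtain b where b: "b \<le> m" "v = \<rho> b" by auto
    define d where "d s \<omega> = step_process n \<tau> h s \<omega> - step_process n' \<tau>' h' s \<omega>" for s \<omega>
    \<comment> \<open>Switching the integrand off after \<open>v\<close> turns the squared integral
      over the whole grid into the one over \<open>[0,v]\<close>, without affecting the integral at
      times up to \<open>v\<close>.\<close>
    define g where "g j \<omega> = (if j < b then d (\<rho> (Suc j)) \<omega> else 0)" for j \<omega>
    have g: "g j \<in> borel_measurable (F (\<rho> j))" if "j < m" for j
      using step_process_adapted[OF P sub(1) that h] step_process_adapted[OF P sub(2) that h']
      unfolding g_def d_def by (cases "j < b") (auto intro!: borel_measurable_diff)
    have I: "?I \<omega> = ennreal (\<Sum>j<m. (g j \<omega>)\<^sup>2 * (\<rho> (Suc j) - \<rho> j))" for \<omega>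
    proof -
      have "?I \<omega> = (\<integral>\<^sup>+s\<in>{0..\<rho> b}. ennreal ((d s \<omega>)\<^sup>2) \<partial>lborel)" unfolding d_def b(2) ..
      also have "\<dots> = ennreal (\<Sum>j<b. (d (\<rho> (Suc j)) \<omega>)\<^sup>2 * (\<rho> (Suc j) - \<rho> j))"
      proof (rule nn_integral_piecewise_const[OF P _ _ b(1)])
        fix j s assume js: "j < m" "s \<in> {\<rho> j<..\<rho> (Suc j)}"
        show "d s \<omega> = d (\<rho> (Suc j)) \<omega>"
          unfolding d_def by (simp only: step_process_const[OF P sub(1) js] step_process_const[OF P sub(2) js])
      qed (simp add: d_def)
      also have "(\<Sum>j<b. (d (\<rho> (Suc j)) \<omega>)\<^sup>2 * (\<rho> (Suc j) - \<rho> j)) = (\<Sum>j<m. (g j \<omega>)\<^sup>2 * (\<rho> (Suc j) - \<rho> j))"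
        using b(1) by (intro sum.mono_neutral_cong_left) (auto simp: g_def)
      finally show ?thesis .
    qed
    have "\<exists>i\<le>m. \<forall>\<omega>. grid_integral \<rho> g i \<omega> = elem_integral n \<tau> h u \<omega> - elem_integral n' \<tau>' h' u \<omega>" if u: "u \<in> U" for u
    proof -
      have "u \<in> \<rho> ` {..m}" unfolding rS using u by (simp add: S_def)
      then obtain i where i: "i \<le> m" "u = \<rho> i" by auto
      have "\<rho> i \<le> \<rho> b" using u U i b by auto
      then have ib: "i \<le> b" using partition_le_iff[OF P i(1) b(1)] by simp
      have "grid_integral \<rho> g i \<omega> = elem_integral n \<tau> h u \<omega> - elem_integral n' \<tau>' h' u \<omega>" for \<omega>
      proof -
        have "grid_integral \<rho> g i \<omega> = grid_integral \<rho> (\<lambda>j. step_process n \<tau> h (\<rho> (Suc j))) i \<omega> - grid_integral \<rho> (\<lambda>j. step_process n' \<tau>' h' (\<rho> (Suc j))) i \<omega>"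
          unfolding grid_integral_def sum_subtractf[symmetric] using ib by (intro sum.cong) (auto simp: g_def d_def algebra_simps)
        then show ?thesis unfolding i(2) by (simp only: grid_integral_step_process[OF P sub(1) i(1) Q] grid_integral_step_process[OF P sub(2) i(1) Q'])
      qed
      then show ?thesis using i by auto
    qed
    then show ?thesis using P b(1) g I by blast
  qed
  have meas: "\<exists>G\<in>borel_measurable M. \<forall>\<omega>. ?I \<omega> = ennreal (G \<omega>)"
  proof -
    from main[of "{}"] obtain m \<rho> b g where P: "is_partition T m \<rho>" and g: "\<And>j. j<m \<Longrightarrow> g j \<in> borel_measurable (F (\<rho> j))"
      and I: "\<And>\<omega>. ?I \<omega> = ennreal (\<Sum>j<m. (g j \<omega>)\<^sup>2 * (\<rho> (Suc j) - \<rho> j))" by auto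
    have "g j \<in> borel_measurable M" if "j < m" for j
      using measurable_F_M[OF g[OF that]] partition_range[OF P, of j] that by auto
    then have "(\<lambda>\<omega>. \<Sum>j<m. (g j \<omega>)\<^sup>2 * (\<rho> (Suc j) - \<rho> j)) \<in> borel_measurable M"
      by (intro borel_measurable_sum borel_measurable_times borel_measurable_power) auto
    then show ?thesis using I by (intro bexI) auto
  qed
  then show "?I \<in> borel_measurable M" by auto
  assume U: "finite U" "U \<subseteq> {0..v}" and c: "0 < c" and \<delta>: "0 < \<delta>"
  from main[OF U] obtain m \<rho> b g where P: "is_partition T m \<rho>" and g: "\<And>j. j<m \<Longrightarrow> g j \<in> borel_measurable (F (\<rho> j))"
    and I: "\<And>\<omega>. ?I \<omega> = ennreal (\<Sum>j<m. (g j \<omega>)\<^sup>2 * (\<rho> (Suc j) - \<rho> j))"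
    and i: "\<And>u. u \<in> U \<Longrightarrow> \<exists>i\<le>m. \<forall>\<omega>. grid_integral \<rho> g i \<omega> = elem_integral n \<tau> h u \<omega> - elem_integral n' \<tau>' h' u \<omega>" by blast
  have wM: "grid_integral \<rho> g i \<in> borel_measurable M" if "i \<le> m" for i
    using measurable_F_M[OF grid_integral_measurable[OF P g that]] partition_range[OF P that] by auto
  have "prob {\<omega> \<in> space M. \<exists>u\<in>U. \<bar>elem_integral n \<tau> h u \<omega> - elem_integral n' \<tau>' h' u \<omega>\<bar> > \<delta>}
      \<le> prob {\<omega> \<in> space M. \<exists>i\<in>{..m}. \<bar>grid_integral \<rho> g i \<omega>\<bar> > \<delta>}"
  proof (rule finite_measure_mono)
    show "{\<omega> \<in> space M. \<exists>i\<in>{..m}. \<bar>grid_integral \<rho> g i \<omega>\<bar> > \<delta>} \<in> events"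
    proof (rule sets.sets_Collect_finite_Ex)
      fix i assume "i \<in> {..m}"
      then have [measurable]: "grid_integral \<rho> g i \<in> borel_measurable M" using wM by auto
      show "{\<omega> \<in> space M. \<delta> < \<bar>grid_integral \<rho> g i \<omega>\<bar>} \<in> events" by measurable
    qed auto
    show "{\<omega> \<in> space M. \<exists>u\<in>U. \<bar>elem_integral n \<tau> h u \<omega> - elem_integral n' \<tau>' h' u \<omega>\<bar> > \<delta>}
       \<subseteq> {\<omega> \<in> space M. \<exists>i\<in>{..m}. \<bar>grid_integral \<rho> g i \<omega>\<bar> > \<delta>}"
    proof safe
      fix \<omega> u assume u: "u \<in> U" "\<delta> < \<bar>elem_integral n \<tau> h u \<omega> - elem_integral n' \<tau>' h' u \<omega>\<bar>"
      obtain i where "i \<le> m" "\<forall>\<omega>. grid_integral \<rho> g i \<omega> = elem_integral n \<tau> h u \<omega> - elem_integral n' \<tau>' h' u \<omega>" using i[OF u(1)] by blast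
      then show "\<exists>i\<in>{..m}. \<delta> < \<bar>grid_integral \<rho> g i \<omega>\<bar>" using u(2) by (intro bexI[of _ i]) auto
    qed
  qed
  also have "\<dots> \<le> prob {\<omega> \<in> space M. (\<Sum>j<m. (g j \<omega>)\<^sup>2 * (\<rho> (Suc j) - \<rho> j)) > c} + c / \<delta>\<^sup>2"
    by (rule grid_integral_maximal[OF P g c \<delta>])
  also have "(\<lambda>\<omega>. (\<Sum>j<m. (g j \<omega>)\<^sup>2 * (\<rho> (Suc j) - \<rho> j)) > c) = (\<lambda>\<omega>. ?I \<omega> > ennreal c)"
    unfolding I using c by (auto simp: ennreal_less_iff)
  finally show "prob {\<omega> \<in> space M. \<exists>u\<in>U. \<bar>elem_integral n \<tau> h u \<omega> - elem_integral n' \<tau>' h' u \<omega>\<bar> > \<delta>}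
      \<le> prob {\<omega> \<in> space M. ?I \<omega> > ennreal c} + c / \<delta>\<^sup>2" .
qed

text \<open>Truncation at 1 turns convergence in probability into convergence in mean, which has an
  almost surely convergent subsequence. The truncation is invisible in the limit, since the
  truncated values are eventually below 1.\<close>

lemma AE_subseq_if_tendsto_prob:
  fixes E :: "nat \<Rightarrow> 'a \<Rightarrow> ennreal"
  assumes [measurable]: "\<And>k. E k \<in> borel_measurable M"
    and lim: "\<And>\<delta>. 0 < \<delta> \<Longrightarrow> (\<lambda>k. prob {\<omega> \<in> space M. E k \<omega> > ennreal \<delta>}) \<longlonglongrightarrow> 0"
  shows "\<exists>r::nat\<Rightarrow>nat. strict_mono r \<and> (AE \<omega> in M. (\<lambda>k. E (r k) \<omega>) \<longlonglongrightarrow> 0)"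
proof -
  define u where "u k \<omega> = enn2real (min (E k \<omega>) 1)" for k \<omega>
  have [measurable]: "u k \<in> borel_measurable M" for k unfolding u_def by measurable
  have u: "0 \<le> u k \<omega>" "u k \<omega> \<le> 1" for k \<omega>
    unfolding u_def using enn2real_mono[of "min (E k \<omega>) 1" 1] by auto
  have eu: "ennreal (u k \<omega>) = min (E k \<omega>) 1" for k \<omega>
    unfolding u_def by (rule ennreal_enn2real) (simp add: min.strict_coboundedI2)
  have int: "integrable M (u k)" for k
    by (rule integrable_const_bound[of _ 1]) (use u in auto)
  have "(\<lambda>k. \<integral>\<omega>. norm (u k \<omega>) \<partial>M) \<longlonglongrightarrow> 0"
  proof (rule tendsto_0_if_le_plus_small[of _ 1])
    fix c :: real assume c: "0 < c"
    have "(\<integral>\<omega>. norm (u k \<omega>) \<partial>M) \<le> prob {\<omega> \<in> space M. E k \<omega> > ennreal c} + 1 * c" for k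
    proof -
      have "(\<integral>\<omega>. norm (u k \<omega>) \<partial>M) \<le> (\<integral>\<omega>. indicator {\<omega> \<in> space M. E k \<omega> > ennreal c} \<omega> + c \<partial>M)"
      proof (rule integral_mono)
        show "integrable M (\<lambda>\<omega>. norm (u k \<omega>))" using int by auto
        show "integrable M (\<lambda>\<omega>. indicator {\<omega> \<in> space M. E k \<omega> > ennreal c} \<omega> + c)"
          by (intro Bochner_Integration.integrable_add integrable_real_indicator) (auto simp: emeasure_eq_measure)
        fix \<omega> assume \<omega>: "\<omega> \<in> space M"
        show "norm (u k \<omega>) \<le> indicator {\<omega> \<in> space M. E k \<omega> > ennreal c} \<omega> + c"
        proof (cases "E k \<omega> > ennreal c")
          case True then show ?thesis using \<omega> u c by (auto simp: add_increasing2)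
        next
          case False
          then have "ennreal (u k \<omega>) \<le> ennreal c" unfolding eu by (simp add: min.coboundedI1)
          then have "u k \<omega> \<le> c" using c by (simp add: ennreal_le_iff)
          then show ?thesis using False u by simp
        qed
      qed
      also have "\<dots> = prob {\<omega> \<in> space M. E k \<omega> > ennreal c} + c"
        by (subst Bochner_Integration.integral_add) (auto simp: prob_space emeasure_eq_measure)
      finally show ?thesis by simp
    qed
    then show "\<exists>a. a \<longlonglongrightarrow> 0 \<and> eventually (\<lambda>n. (\<integral>\<omega>. norm (u n \<omega>) \<partial>M) \<le> a n + 1 * c) sequentially"
      using lim[OF c] by (intro exI[of _ "\<lambda>k. prob {\<omega> \<in> space M. E k \<omega> > ennreal c}"]) auto
  qed auto
  from tendsto_L1_AE_subseq[OF int this] obtain r where r: "strict_mono r" "AE \<omega> in M. (\<lambda>k. u (r k) \<omega>) \<longlonglongrightarrow> 0"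
    by auto
  from r(2) have "AE \<omega> in M. (\<lambda>k. E (r k) \<omega>) \<longlonglongrightarrow> 0"
  proof eventually_elim
    case (elim \<omega>)
    have 1: "(\<lambda>k. ennreal (u (r k) \<omega>)) \<longlonglongrightarrow> ennreal 0" by (rule tendsto_ennrealI[OF elim])
    have "eventually (\<lambda>k. u (r k) \<omega> < 1) sequentially" by (rule order_tendstoD(2)[OF elim]) simp
    then have "eventually (\<lambda>k. ennreal (u (r k) \<omega>) = E (r k) \<omega>) sequentially"
    proof eventually_elim
      case (elim k)
      then have "ennreal (u (r k) \<omega>) < 1" by (simp add: u(1) ennreal_less_one_iff)
      then have "\<not> 1 \<le> E (r k) \<omega>" using eu[of "r k" \<omega>] by (auto simp: min_def split: if_splits)
      then show ?case by (simp add: eu min_def not_le less_imp_le)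
    qed
    from Lim_transform_eventually[OF 1 this] show ?case by simp
  qed
  then show ?thesis using r(1) by auto
qed

text \<open>Along a subsequence the squared distance to \<open>H\<close> tends to 0 for almost every
  path. Different approximations of \<open>H\<close> can then be compared path by path with the
  triangle inequality.\<close>

lemma ito_integral_AE_sequence:
  assumes I: "ito_integral M F W t H J"
  shows "\<exists>n \<tau> h. (\<forall>k::nat. is_partition t (n k) (\<tau> k)) \<and>
    (\<forall>k. \<forall>i<n k. h k i \<in> borel_measurable (F (\<tau> k i))) \<and>
    (AE \<omega> in M. (\<lambda>k. \<integral>\<^sup>+s\<in>{0..t}. ennreal ((step_process (n k) (\<tau> k) (h k) s \<omega> - H s \<omega>)\<^sup>2) \<partial>lborel) \<longlonglongrightarrow> 0) \<and>
    converges_in_prob M (\<lambda>k. elem_integral (n k) (\<tau> k) (h k) t) J"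
proof -
  obtain G I where GI: "\<And>k. simple_integral M F W t (G k) (I k)"
     and meas: "\<And>k::nat. (\<lambda>\<omega>. \<integral>\<^sup>+s\<in>{0..t}. ennreal ((G k s \<omega> - H s \<omega>)\<^sup>2) \<partial>lborel) \<in> borel_measurable M"
     and lim: "\<And>\<delta>. 0 < \<delta> \<Longrightarrow> (\<lambda>k. prob {\<omega> \<in> space M.
           (\<integral>\<^sup>+s\<in>{0..t}. ennreal ((G k s \<omega> - H s \<omega>)\<^sup>2) \<partial>lborel) > ennreal \<delta>}) \<longlonglongrightarrow> 0"
     and cv: "converges_in_prob M I J" using I unfolding ito_integral_def by blast
  have "\<forall>k. \<exists>n \<tau> h. is_partition t n \<tau> \<and> (\<forall>i<n. h i \<in> borel_measurable (F (\<tau> i))) \<and>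
      G k = step_process n \<tau> h \<and> I k = elem_integral n \<tau> h t"
  proof
    fix k
    obtain n \<tau> h where P: "is_partition t n \<tau>" and h: "\<forall>i<n. h i \<in> borel_measurable (F (\<tau> i))"
      and G: "G k = (\<lambda>s \<omega>. \<Sum>i<n. h i \<omega> * indicator {\<tau> i<..\<tau> (Suc i)} s)"
      and Ik: "I k = (\<lambda>\<omega>. \<Sum>i<n. h i \<omega> * (W (\<tau> (Suc i)) \<omega> - W (\<tau> i) \<omega>))"
      using GI[of k] unfolding simple_integral_def by blast
    have "I k = elem_integral n \<tau> h t"
    proof
      fix \<omega> show "I k \<omega> = elem_integral n \<tau> h t \<omega>"
        unfolding Ik elem_integral_def using partition_range[OF P] by (intro sum.cong) (auto simp: min_absorb1)
    qed
    moreover have "G k = step_process n \<tau> h" unfolding G step_process_def by (intro ext) simp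
    ultimately show "\<exists>n \<tau> h. is_partition t n \<tau> \<and> (\<forall>i<n. h i \<in> borel_measurable (F (\<tau> i))) \<and>
      G k = step_process n \<tau> h \<and> I k = elem_integral n \<tau> h t" using P h by blast
  qed
  then obtain n \<tau> h where s: "\<And>k. is_partition t (n k) (\<tau> k)"
    "\<And>k i. i < n k \<Longrightarrow> h k i \<in> borel_measurable (F (\<tau> k i))"
    "\<And>k. G k = step_process (n k) (\<tau> k) (h k)" "\<And>k. I k = elem_integral (n k) (\<tau> k) (h k) t" by metis
  obtain r :: "nat \<Rightarrow> nat" where r: "strict_mono r"
    "AE \<omega> in M. (\<lambda>k. \<integral>\<^sup>+s\<in>{0..t}. ennreal ((G (r k) s \<omega> - H s \<omega>)\<^sup>2) \<partial>lborel) \<longlonglongrightarrow> 0"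
    using AE_subseq_if_tendsto_prob[OF meas lim] by blast
  show ?thesis
  proof (rule exI[of _ "\<lambda>k. n (r k)"], rule exI[of _ "\<lambda>k. \<tau> (r k)"], rule exI[of _ "\<lambda>k. h (r k)"],
      intro conjI allI impI)
    show "is_partition t (n (r k)) (\<tau> (r k))" for k by (rule s)
    show "h (r k) i \<in> borel_measurable (F (\<tau> (r k) i))" if "i < n (r k)" for k i by (rule s(2)[OF that])
    show "AE \<omega> in M. (\<lambda>k. \<integral>\<^sup>+s\<in>{0..t}. ennreal ((step_process (n (r k)) (\<tau> (r k)) (h (r k)) s \<omega> - H s \<omega>)\<^sup>2) \<partial>lborel) \<longlonglongrightarrow> 0"
      using r(2) unfolding s(3) .
    show "converges_in_prob M (\<lambda>k. elem_integral (n (r k)) (\<tau> (r k)) (h (r k)) t) J"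
      unfolding converges_in_prob_def
    proof (intro conjI allI impI)
      show "elem_integral (n (r k)) (\<tau> (r k)) (h (r k)) t \<in> borel_measurable M" for k
        using cv unfolding converges_in_prob_def s(4) by blast
      show "J \<in> borel_measurable M" using cv unfolding converges_in_prob_def by blast
      fix \<delta> :: real assume "0 < \<delta>"
      then have "(\<lambda>k. prob {\<omega> \<in> space M. \<bar>elem_integral (n k) (\<tau> k) (h k) t \<omega> - J \<omega>\<bar> > \<delta>}) \<longlonglongrightarrow> 0"
        using cv unfolding converges_in_prob_def s(4) by blast
      from LIMSEQ_subseq_LIMSEQ[OF this r(1)]
      show "(\<lambda>k. prob {\<omega> \<in> space M. \<bar>elem_integral (n (r k)) (\<tau> (r k)) (h (r k)) t \<omega> - J \<omega>\<bar> > \<delta>}) \<longlonglongrightarrow> 0"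
        by (simp add: comp_def)
    qed
  qed
qed

end

section \<open>Left-point approximations on uniform grids\<close>

lemma partition_cover:
  assumes P: "is_partition t m \<rho>" and s: "0 < s" "s \<le> t"
  obtains j where "j < m" "s \<in> {\<rho> j<..\<rho> (Suc j)}"
proof -
  define i where "i = (LEAST i. s \<le> \<rho> i)"
  have m: "s \<le> \<rho> m" using P s by (simp add: is_partition_def)
  have i: "s \<le> \<rho> i" "i \<le> m" "\<And>k. k < i \<Longrightarrow> \<rho> k < s"
    using m not_less_Least unfolding i_def by (auto intro: LeastI Least_le simp: not_le[symmetric])
  have "i \<noteq> 0" using i(1) s P by (auto simp: is_partition_def intro: gr0I)
  then have "i - 1 < m" "s \<in> {\<rho> (i - 1)<..\<rho> (Suc (i - 1))}" using i by auto
  then show ?thesis by (rule that)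
qed

lemma step_process_at:
  assumes P: "is_partition t m \<rho>" and j: "j < m" and s: "s \<in> {\<rho> j<..\<rho> (Suc j)}"
  shows "step_process m \<rho> h s \<omega> = h j \<omega>"
proof -
  have "indicator {\<rho> i<..\<rho> (Suc i)} s = (if i = j then 1 else 0 :: real)" if "i < m" for i
  proof (cases i j rule: linorder_cases)
    case less
    then show ?thesis using partition_mono[OF P, of "Suc i" j] s j by (auto simp: indicator_def)
  next
    case greater
    then show ?thesis using partition_mono[OF P, of "Suc j" i] s that by (auto simp: indicator_def)
  qed (use s in \<open>auto simp: indicator_def\<close>)
  then have "step_process m \<rho> h s \<omega> = (\<Sum>i<m. if i = j then h i \<omega> else 0)"
    unfolding step_process_def by (intro sum.cong) auto
  then show ?thesis using j by simp
qed

definition unigrid :: "real \<Rightarrow> nat \<Rightarrow> nat \<Rightarrow> real" where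
  "unigrid T N j = real j * T / real (Suc N)"

lemma unigrid_diff: "unigrid T N (Suc j) - unigrid T N j = T / real (Suc N)"
  unfolding unigrid_def by (simp add: diff_divide_distrib[symmetric] algebra_simps)

lemma is_partition_unigrid:
  assumes "0 < T"
  shows "is_partition T (Suc N) (unigrid T N)"
proof -
  have "unigrid T N i < unigrid T N (Suc i)" for i
  proof -
    have "0 < unigrid T N (Suc i) - unigrid T N i" unfolding unigrid_diff using assms by simp
    then show ?thesis by simp
  qed
  then show ?thesis by (auto simp: is_partition_def unigrid_def)
qed

lemma unigrid_uniform:
  fixes f :: "real \<Rightarrow> real"
  assumes T: "0 < T" and f: "continuous_on {0..T} f" and e: "0 < e"
  shows "eventually (\<lambda>N. \<forall>j<Suc N. \<forall>s\<in>{unigrid T N j..unigrid T N (Suc j)}. \<bar>f s - f (unigrid T N j)\<bar> \<le> e) sequentially"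
proof -
  have "uniformly_continuous_on {0..T} f" by (rule compact_uniformly_continuous[OF f]) simp
  then obtain d where d: "0 < d" "\<And>x y. x \<in> {0..T} \<Longrightarrow> y \<in> {0..T} \<Longrightarrow> dist x y < d \<Longrightarrow> dist (f x) (f y) < e"
    using e unfolding uniformly_continuous_on_def by metis
  have "(\<lambda>N. T / real (Suc N)) \<longlonglongrightarrow> 0" by (rule LIMSEQ_Suc[OF lim_const_over_n])
  then have "eventually (\<lambda>N. T / real (Suc N) < d) sequentially" by (rule order_tendstoD(2)[OF _ d(1)])
  then show ?thesis
  proof eventually_elim
    case (elim N)
    show ?case
    proof (intro allI impI ballI)
      fix j s assume j: "j < Suc N" and s: "s \<in> {unigrid T N j..unigrid T N (Suc j)}"
      note P = is_partition_unigrid[OF T, of N]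
      have "unigrid T N j \<in> {0..T}" "s \<in> {0..T}"
        using partition_range[OF P, of j] partition_range[OF P, of "Suc j"] j s by auto
      moreover have "dist s (unigrid T N j) < d" using s unigrid_diff[of T N j] elim by (auto simp: dist_real_def)
      ultimately show "\<bar>f s - f (unigrid T N j)\<bar> \<le> e" using d(2)[of s "unigrid T N j"] by (auto simp: dist_real_def)
    qed
  qed
qed

text \<open>Purely pathwise: a continuous path on a compact interval is uniformly continuous, so
  neither bounds nor moments of \<open>f\<close> enter.\<close>

lemma unigrid_step_approx:
  fixes f :: "real \<Rightarrow> 'a \<Rightarrow> real"
  assumes T: "0 < T" and f: "continuous_on {0..T} (\<lambda>s. f s \<omega>)"
  shows "(\<lambda>N. \<integral>\<^sup>+s\<in>{0..T}. ennreal ((step_process (Suc N) (unigrid T N) (\<lambda>j. f (unigrid T N j)) s \<omega> - f s \<omega>)\<^sup>2) \<partial>lborel) \<longlonglongrightarrow> 0"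
    (is "?D \<longlonglongrightarrow> 0")
proof (rule order_tendstoI)
  fix a :: ennreal assume "a < 0" then show "eventually (\<lambda>N. a < ?D N) sequentially" by simp
next
  fix a :: ennreal assume a: "0 < a"
  obtain y where y: "0 < y" "y < a" using dense[OF a] by auto
  obtain r where r: "0 < r" "ennreal r < a" using y by (cases y) auto
  \<comment> \<open>Chosen so that a uniform error \<open>e\<close> gives the squared integral
    \<open>e\<^sup>2 * T = r\<close>, which lies below \<open>a\<close>.\<close>
  define e where "e = sqrt (r / T)"
  have e: "0 < e" "e\<^sup>2 * T = r" using r T by (auto simp: e_def)
  from unigrid_uniform[OF T f e(1)] show "eventually (\<lambda>N. ?D N < a) sequentially"
  proof eventually_elim
    case (elim N)
    note P = is_partition_unigrid[OF T, of N] and close = elim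
    have "?D N \<le> (\<integral>\<^sup>+s. ennreal (e\<^sup>2) * indicator {0..T} s \<partial>lborel)"
    proof (rule nn_integral_mono_AE)
      \<comment> \<open>At \<open>s = 0\<close> the step process has the default value 0, which need
        not be close to \<open>f\<close>.\<close>
      have "AE s in lborel. s \<noteq> (0::real)" by (rule AE_lborel_singleton)
      then show "AE s in lborel. ennreal ((step_process (Suc N) (unigrid T N) (\<lambda>j. f (unigrid T N j)) s \<omega> - f s \<omega>)\<^sup>2) * indicator {0..T} s
        \<le> ennreal (e\<^sup>2) * indicator {0..T} s"
      proof eventually_elim
        case (elim s)
        show ?case
        proof (cases "s \<in> {0..T}")
          case True
          then have "0 < s" "s \<le> T" using elim by auto
          then obtain j where j: "j < Suc N" "s \<in> {unigrid T N j<..unigrid T N (Suc j)}" by (rule partition_cover[OF P])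
          have "s \<in> {unigrid T N j..unigrid T N (Suc j)}" using j(2) by simp
          then have "\<bar>f s \<omega> - f (unigrid T N j) \<omega>\<bar> \<le> e" using close j(1) by blast
          then have "\<bar>f (unigrid T N j) \<omega> - f s \<omega>\<bar> \<le> e" by (simp only: abs_minus_commute)
          then have "(f (unigrid T N j) \<omega> - f s \<omega>)\<^sup>2 \<le> e\<^sup>2" using power_mono[of "\<bar>f (unigrid T N j) \<omega> - f s \<omega>\<bar>" e 2] by simp
          then show ?thesis using True by (simp add: step_process_at[OF P j] ennreal_leI)
        qed simp
      qed
    qed
    also have "\<dots> = ennreal (e\<^sup>2 * T)" using T by (simp add: nn_integral_cmult_indicator ennreal_mult)
    also have "\<dots> < a" using e r by simp
    finally show ?case .
  qed
qed

lemma sq_integral_triangle: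
  fixes G G' H :: "real \<Rightarrow> real"
  assumes [measurable]: "G \<in> borel_measurable borel" "G' \<in> borel_measurable borel"
    and H: "set_borel_measurable lborel {0..u} H"
  shows "(\<integral>\<^sup>+s\<in>{0..u}. ennreal ((G s - G' s)\<^sup>2) \<partial>lborel)
    \<le> 2 * (\<integral>\<^sup>+s\<in>{0..u}. ennreal ((G s - H s)\<^sup>2) \<partial>lborel) + 2 * (\<integral>\<^sup>+s\<in>{0..u}. ennreal ((G' s - H s)\<^sup>2) \<partial>lborel)"
proof -
  \<comment> \<open>\<open>H\<close> is known to be measurable only on the interval, so it is
    multiplied by the indicator before sums are split.\<close>
  have Hm[measurable]: "(\<lambda>s. indicator {0..u} s * H s) \<in> borel_measurable lborel"
    using H unfolding set_borel_measurable_def by simp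
  have m: "(\<lambda>s. ennreal ((g s - H s)\<^sup>2) * indicator {0..u} s) \<in> borel_measurable lborel"
    if [measurable]: "g \<in> borel_measurable borel" for g :: "real \<Rightarrow> real"
  proof -
    have "(\<lambda>s. ennreal ((g s - H s)\<^sup>2) * indicator {0..u} s)
        = (\<lambda>s. ennreal ((g s - indicator {0..u} s * H s)\<^sup>2) * indicator {0..u} s)"
      by (auto simp: indicator_def)
    then show ?thesis by simp
  qed
  have "(\<integral>\<^sup>+s\<in>{0..u}. ennreal ((G s - G' s)\<^sup>2) \<partial>lborel)
    \<le> (\<integral>\<^sup>+s. 2 * (ennreal ((G s - H s)\<^sup>2) * indicator {0..u} s) + 2 * (ennreal ((G' s - H s)\<^sup>2) * indicator {0..u} s) \<partial>lborel)"
  proof (rule nn_integral_mono)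
    fix s
    have "(G s - G' s)\<^sup>2 \<le> 2 * (G s - H s)\<^sup>2 + 2 * (G' s - H s)\<^sup>2"
      using sum_squares_ge_zero[of "G s - H s + (G' s - H s)" 0] by (simp add: power2_eq_square algebra_simps)
    then have "ennreal ((G s - G' s)\<^sup>2) \<le> ennreal (2 * (G s - H s)\<^sup>2 + 2 * (G' s - H s)\<^sup>2)" by (rule ennreal_leI)
    also have "\<dots> = 2 * ennreal ((G s - H s)\<^sup>2) + 2 * ennreal ((G' s - H s)\<^sup>2)"
      by (simp add: ennreal_plus ennreal_mult)
    finally show "ennreal ((G s - G' s)\<^sup>2) * indicator {0..u} s
      \<le> 2 * (ennreal ((G s - H s)\<^sup>2) * indicator {0..u} s) + 2 * (ennreal ((G' s - H s)\<^sup>2) * indicator {0..u} s)"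
      by (auto simp: indicator_def)
  qed
  also have "\<dots> = 2 * (\<integral>\<^sup>+s\<in>{0..u}. ennreal ((G s - H s)\<^sup>2) \<partial>lborel) + 2 * (\<integral>\<^sup>+s\<in>{0..u}. ennreal ((G' s - H s)\<^sup>2) \<partial>lborel)"
    using m[of G] m[of G'] by (subst nn_integral_add, simp, simp, subst (1 2) nn_integral_cmult) auto
  finally show ?thesis .
qed

lemma tendsto_0_ennreal_sandwich:
  fixes S A B :: "nat \<Rightarrow> ennreal"
  assumes "A \<longlonglongrightarrow> 0" "B \<longlonglongrightarrow> 0" "\<And>k. S k \<le> 2 * A k + 2 * B k"
  shows "S \<longlonglongrightarrow> 0"
proof (rule tendsto_sandwich[OF _ _ tendsto_const])
  have "(\<lambda>k. 2 * A k + 2 * B k) \<longlonglongrightarrow> 2 * 0 + 2 * 0"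
    by (intro tendsto_add ennreal_tendsto_cmult assms) auto
  then show "(\<lambda>k. 2 * A k + 2 * B k) \<longlonglongrightarrow> 0" by simp
qed (use assms in auto)

lemma (in prob_space) prob_exceed_tendsto_0:
  fixes S :: "nat \<Rightarrow> 'a \<Rightarrow> ennreal"
  assumes [measurable]: "\<And>k. S k \<in> borel_measurable M" and ae: "AE \<omega> in M. (\<lambda>k. S k \<omega>) \<longlonglongrightarrow> 0"
    and c: "0 < c"
  shows "(\<lambda>k. prob {\<omega> \<in> space M. S k \<omega> > ennreal c}) \<longlonglongrightarrow> 0"
proof (rule prob_tendsto_0_if_AE_eventually)
  show "AE \<omega> in M. \<forall>\<^sub>F k in sequentially. \<omega> \<notin> {\<omega> \<in> space M. ennreal c < S k \<omega>}"
    using ae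
  proof eventually_elim
    case (elim \<omega>)
    have "eventually (\<lambda>k. S k \<omega> < ennreal c) sequentially" by (rule order_tendstoD(2)[OF elim]) (use c in simp)
    then show ?case by eventually_elim auto
  qed
qed measurable

context brownian begin

lemma elem_integral_measurable:
  assumes "is_partition t n \<tau>" "\<And>i. i < n \<Longrightarrow> h i \<in> borel_measurable (F (\<tau> i))" "t \<le> T" "0 \<le> u" "u \<le> T"
  shows "elem_integral n \<tau> h u \<in> borel_measurable M"
proof -
  have r: "0 \<le> \<tau> i" "\<tau> i \<le> T" if "i \<le> n" for i using partition_range[OF assms(1) that] assms(3) by auto
  have "h i \<in> borel_measurable M" if "i < n" for i using measurable_F_M[OF assms(2)[OF that]] r[of i] that by auto
  moreover have "W (min (\<tau> i) u) \<in> borel_measurable M" if "i \<le> n" for i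
    using W_measurable[of "min (\<tau> i) u"] r[of i] that assms by auto
  ultimately show ?thesis unfolding elem_integral_def by (intro borel_measurable_sum borel_measurable_times borel_measurable_diff) auto
qed

text \<open>\<open>J\<close> is defined through some sequence on \<open>[0,u]\<close> of its own.
  Here any adapted step processes that approximate \<open>H\<close> on \<open>[0,T]\<close> are
  shown to compute it: on \<open>[0,u]\<close> they are close to the defining sequence, and
  closeness of integrands is passed to the integrals by \<open>elem_integral_compare\<close>. Thus
  one sequence serves all times simultaneously.\<close>

lemma elem_integral_tendsto_ito:
  assumes P: "\<And>k::nat. is_partition T (n k) (\<tau> k)"
    and h: "\<And>k i. i < n k \<Longrightarrow> h k i \<in> borel_measurable (F (\<tau> k i))"
    and lim: "AE \<omega> in M. (\<lambda>k. \<integral>\<^sup>+s\<in>{0..T}. ennreal ((step_process (n k) (\<tau> k) (h k) s \<omega> - H s \<omega>)\<^sup>2) \<partial>lborel) \<longlonglongrightarrow> 0"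
    and I: "ito_integral M F W u H J" and u: "u \<in> {0..T}" and \<delta>: "0 < \<delta>"
  shows "(\<lambda>k. prob {\<omega> \<in> space M. \<bar>elem_integral (n k) (\<tau> k) (h k) u \<omega> - J \<omega>\<bar> > \<delta>}) \<longlonglongrightarrow> 0"
proof -
  obtain n' \<tau>' h' where P': "\<And>k::nat. is_partition u (n' k) (\<tau>' k)"
    and h': "\<And>k i. i < n' k \<Longrightarrow> h' k i \<in> borel_measurable (F (\<tau>' k i))"
    and lim': "AE \<omega> in M. (\<lambda>k. \<integral>\<^sup>+s\<in>{0..u}. ennreal ((step_process (n' k) (\<tau>' k) (h' k) s \<omega> - H s \<omega>)\<^sup>2) \<partial>lborel) \<longlonglongrightarrow> 0"
    and cv: "converges_in_prob M (\<lambda>k. elem_integral (n' k) (\<tau>' k) (h' k) u) J"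
    using ito_integral_AE_sequence[OF I] by blast
  have Hm: "AE \<omega> in M. set_borel_measurable lborel {0..u} (\<lambda>s. H s \<omega>)"
    using I unfolding ito_integral_def by (auto elim: eventually_mono)
  define S where "S k \<omega> = (\<integral>\<^sup>+s\<in>{0..u}. ennreal ((step_process (n k) (\<tau> k) (h k) s \<omega> - step_process (n' k) (\<tau>' k) (h' k) s \<omega>)\<^sup>2) \<partial>lborel)" for k \<omega>
  have u': "u \<le> T" using u by simp
  have Sm[measurable]: "S k \<in> borel_measurable M" for k
    unfolding S_def by (rule step_diff_measurable[OF P h order_refl P' h' u' u])
  have "AE \<omega> in M. (\<lambda>k. S k \<omega>) \<longlonglongrightarrow> 0"
    using lim lim' Hm
  proof eventually_elim
    case (elim \<omega>)
    show ?case
    proof (rule tendsto_0_ennreal_sandwich[OF elim(1,2)])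
      fix k
      have "S k \<omega> \<le> 2 * (\<integral>\<^sup>+s\<in>{0..u}. ennreal ((step_process (n k) (\<tau> k) (h k) s \<omega> - H s \<omega>)\<^sup>2) \<partial>lborel)
         + 2 * (\<integral>\<^sup>+s\<in>{0..u}. ennreal ((step_process (n' k) (\<tau>' k) (h' k) s \<omega> - H s \<omega>)\<^sup>2) \<partial>lborel)"
        unfolding S_def by (rule sq_integral_triangle[OF step_process_measurable step_process_measurable elim(3)])
      moreover have "(\<integral>\<^sup>+s\<in>{0..u}. ennreal ((step_process (n k) (\<tau> k) (h k) s \<omega> - H s \<omega>)\<^sup>2) \<partial>lborel)
          \<le> (\<integral>\<^sup>+s\<in>{0..T}. ennreal ((step_process (n k) (\<tau> k) (h k) s \<omega> - H s \<omega>)\<^sup>2) \<partial>lborel)"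
        using u by (intro nn_integral_mono) (auto simp: indicator_def)
      ultimately show "S k \<omega> \<le> 2 * (\<integral>\<^sup>+s\<in>{0..T}. ennreal ((step_process (n k) (\<tau> k) (h k) s \<omega> - H s \<omega>)\<^sup>2) \<partial>lborel)
         + 2 * (\<integral>\<^sup>+s\<in>{0..u}. ennreal ((step_process (n' k) (\<tau>' k) (h' k) s \<omega> - H s \<omega>)\<^sup>2) \<partial>lborel)"
        by (rule order_trans[OF _ add_right_mono[OF mult_left_mono]]) auto
    qed
  qed
  note S0 = prob_exceed_tendsto_0[OF Sm this]
  have Jm[measurable]: "J \<in> borel_measurable M" using cv by (auto simp: converges_in_prob_def)
  have [measurable]: "elem_integral (n k) (\<tau> k) (h k) u \<in> borel_measurable M" for k
    by (rule elem_integral_measurable[OF P h]) (use u in auto)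
  have [measurable]: "elem_integral (n' k) (\<tau>' k) (h' k) u \<in> borel_measurable M" for k
    by (rule elem_integral_measurable[OF P' h']) (use u in auto)
  show ?thesis
  proof (rule tendsto_0_if_le_plus_small[of _ "1 / (\<delta>/2)\<^sup>2"])
    fix c :: real assume c: "0 < c"
    let ?b = "\<lambda>k. prob {\<omega> \<in> space M. \<bar>elem_integral (n' k) (\<tau>' k) (h' k) u \<omega> - J \<omega>\<bar> > \<delta>/2}"
    let ?a = "\<lambda>k. prob {\<omega> \<in> space M. S k \<omega> > ennreal c} + ?b k"
    have "?b \<longlonglongrightarrow> 0" using cv \<delta> unfolding converges_in_prob_def by (auto elim: allE[of _ "\<delta>/2"])
    then have "?a \<longlonglongrightarrow> 0 + 0" by (intro tendsto_add S0[OF c])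
    moreover have "prob {\<omega> \<in> space M. \<bar>elem_integral (n k) (\<tau> k) (h k) u \<omega> - J \<omega>\<bar> > \<delta>} \<le> ?a k + 1 / (\<delta>/2)\<^sup>2 * c" for k
    proof -
      have "prob {\<omega> \<in> space M. \<bar>elem_integral (n k) (\<tau> k) (h k) u \<omega> - J \<omega>\<bar> > \<delta>}
        \<le> prob ({\<omega> \<in> space M. \<exists>v\<in>{u}. \<bar>elem_integral (n k) (\<tau> k) (h k) v \<omega> - elem_integral (n' k) (\<tau>' k) (h' k) v \<omega>\<bar> > \<delta>/2}
           \<union> {\<omega> \<in> space M. \<bar>elem_integral (n' k) (\<tau>' k) (h' k) u \<omega> - J \<omega>\<bar> > \<delta>/2})"
      proof (rule finite_measure_mono)
        show "{\<omega> \<in> space M. \<bar>elem_integral (n k) (\<tau> k) (h k) u \<omega> - J \<omega>\<bar> > \<delta>}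
          \<subseteq> {\<omega> \<in> space M. \<exists>v\<in>{u}. \<bar>elem_integral (n k) (\<tau> k) (h k) v \<omega> - elem_integral (n' k) (\<tau>' k) (h' k) v \<omega>\<bar> > \<delta>/2}
           \<union> {\<omega> \<in> space M. \<bar>elem_integral (n' k) (\<tau>' k) (h' k) u \<omega> - J \<omega>\<bar> > \<delta>/2}"
        proof
          fix \<omega> assume \<omega>: "\<omega> \<in> {\<omega> \<in> space M. \<bar>elem_integral (n k) (\<tau> k) (h k) u \<omega> - J \<omega>\<bar> > \<delta>}"
          then have "\<bar>elem_integral (n k) (\<tau> k) (h k) u \<omega> - J \<omega>\<bar> > \<delta>" by simp
          then have "\<bar>elem_integral (n k) (\<tau> k) (h k) u \<omega> - elem_integral (n' k) (\<tau>' k) (h' k) u \<omega>\<bar> > \<delta>/2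
              \<or> \<bar>elem_integral (n' k) (\<tau>' k) (h' k) u \<omega> - J \<omega>\<bar> > \<delta>/2" by linarith
          then show "\<omega> \<in> {\<omega> \<in> space M. \<exists>v\<in>{u}. \<bar>elem_integral (n k) (\<tau> k) (h k) v \<omega> - elem_integral (n' k) (\<tau>' k) (h' k) v \<omega>\<bar> > \<delta>/2}
           \<union> {\<omega> \<in> space M. \<bar>elem_integral (n' k) (\<tau>' k) (h' k) u \<omega> - J \<omega>\<bar> > \<delta>/2}" using \<omega> by auto
        qed
      qed auto
      also have "\<dots> \<le> prob {\<omega> \<in> space M. \<exists>v\<in>{u}. \<bar>elem_integral (n k) (\<tau> k) (h k) v \<omega> - elem_integral (n' k) (\<tau>' k) (h' k) v \<omega>\<bar> > \<delta>/2} + ?b k"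
        by (rule measure_Un_le) auto
      also have "prob {\<omega> \<in> space M. \<exists>v\<in>{u}. \<bar>elem_integral (n k) (\<tau> k) (h k) v \<omega> - elem_integral (n' k) (\<tau>' k) (h' k) v \<omega>\<bar> > \<delta>/2}
          \<le> prob {\<omega> \<in> space M. S k \<omega> > ennreal c} + c / (\<delta>/2)\<^sup>2"
        unfolding S_def by (rule elem_integral_compare[OF P h order_refl P' h' u' u]) (use u c \<delta> in auto)
      finally show ?thesis by simp
    qed
    ultimately show "\<exists>a. a \<longlonglongrightarrow> 0 \<and> (\<forall>\<^sub>F k in sequentially.
        prob {\<omega> \<in> space M. \<delta> < \<bar>elem_integral (n k) (\<tau> k) (h k) u \<omega> - J \<omega>\<bar>} \<le> a k + 1 / (\<delta>/2)\<^sup>2 * c)"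
      by (intro exI[of _ ?a]) auto
  qed auto
qed

lemma prob_finite_union_le:
  assumes "finite I" "\<And>i. i \<in> I \<Longrightarrow> {\<omega> \<in> space M. Q i \<omega>} \<in> events"
  shows "prob {\<omega> \<in> space M. \<exists>i\<in>I. Q i \<omega>} \<le> (\<Sum>i\<in>I. prob {\<omega> \<in> space M. Q i \<omega>})"
proof -
  have "{\<omega> \<in> space M. \<exists>i\<in>I. Q i \<omega>} = (\<Union>i\<in>I. {\<omega> \<in> space M. Q i \<omega>})" by auto
  then show ?thesis using measure_UNION_le[OF assms(1), of "\<lambda>i. {\<omega> \<in> space M. Q i \<omega>}" M] assms(2) by simp
qed

text \<open>A diagonal argument. At level \<open>N\<close> there are finitely many grid times, so an
  index \<open>k N\<close> makes the simple integrals close to \<open>J\<close> at all of them with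
  high probability. The distance between simple integrals and Riemann sums is then controlled by the
  maximal inequality, whose bound does not grow with the number of grid times.\<close>

lemma riemann_sums_tendsto_ito:
  assumes cont: "AE \<omega> in M. continuous_on {0..T} (\<lambda>s. H s \<omega>)"
    and adapted: "\<And>s. s \<in> {0..T} \<Longrightarrow> H s \<in> borel_measurable (F s)"
    and I: "\<And>u. u \<in> {0..T} \<Longrightarrow> ito_integral M F W u H (J u)" and \<delta>: "0 < \<delta>"
  shows "(\<lambda>N. prob {\<omega> \<in> space M. \<exists>i\<in>{..Suc N}. \<bar>J (unigrid T N i) \<omega>
     - elem_integral (Suc N) (unigrid T N) (\<lambda>j. H (unigrid T N j)) (unigrid T N i) \<omega>\<bar> > \<delta>}) \<longlonglongrightarrow> 0"
proof -
  have TT: "T \<in> {0..T}" using T_pos by simp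
  obtain n \<tau> h where P: "\<And>k::nat. is_partition T (n k) (\<tau> k)"
    and h: "\<And>k i. i < n k \<Longrightarrow> h k i \<in> borel_measurable (F (\<tau> k i))"
    and lim: "AE \<omega> in M. (\<lambda>k. \<integral>\<^sup>+s\<in>{0..T}. ennreal ((step_process (n k) (\<tau> k) (h k) s \<omega> - H s \<omega>)\<^sup>2) \<partial>lborel) \<longlonglongrightarrow> 0"
    and "converges_in_prob M (\<lambda>k. elem_integral (n k) (\<tau> k) (h k) T) (J T)"
    using ito_integral_AE_sequence[OF I[OF TT]] by blast
  have Hm: "AE \<omega> in M. set_borel_measurable lborel {0..T} (\<lambda>s. H s \<omega>)"
    using I[OF TT] unfolding ito_integral_def by (auto elim: eventually_mono)
  have Jm: "J u \<in> borel_measurable M" if "u \<in> {0..T}" for u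
    using I[OF that] unfolding ito_integral_def converges_in_prob_def by blast
  let ?g = "unigrid T"
  note PN = is_partition_unigrid[OF T_pos]
  have gT: "?g N i \<in> {0..T}" if "i \<le> Suc N" for N i using partition_range[OF PN that] by auto
  have hN: "H (?g N i) \<in> borel_measurable (F (?g N i))" if "i < Suc N" for N i
    by (rule adapted) (use gT[of i N] that in auto)
  let ?R = "\<lambda>N. elem_integral (Suc N) (?g N) (\<lambda>j. H (?g N j))"
  define p where "p N k = prob {\<omega> \<in> space M. \<exists>i\<in>{..Suc N}. \<bar>elem_integral (n k) (\<tau> k) (h k) (?g N i) \<omega> - J (?g N i) \<omega>\<bar> > \<delta>/2}" for N k
  have sm[measurable]: "elem_integral (n k) (\<tau> k) (h k) u \<in> borel_measurable M" if "u \<in> {0..T}" for k u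
    by (rule elem_integral_measurable[OF P h]) (use that in auto)
  have Rm: "?R N u \<in> borel_measurable M" if "u \<in> {0..T}" for N u
    by (rule elem_integral_measurable[OF PN hN]) (use that in auto)
  have evm: "{\<omega> \<in> space M. \<bar>elem_integral (n k) (\<tau> k) (h k) (?g N i) \<omega> - J (?g N i) \<omega>\<bar> > \<delta>/2} \<in> events"
    if "i \<le> Suc N" for k N i using sm[OF gT[OF that], of k] Jm[OF gT[OF that]] by measurable
  have p0: "p N \<longlonglongrightarrow> 0" for N
  proof (rule tendsto_sandwich[OF _ _ tendsto_const])
    have "(\<lambda>k. \<Sum>i\<in>{..Suc N}. prob {\<omega> \<in> space M. \<bar>elem_integral (n k) (\<tau> k) (h k) (?g N i) \<omega> - J (?g N i) \<omega>\<bar> > \<delta>/2}) \<longlonglongrightarrow> (\<Sum>i\<in>{..Suc N}. 0)"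
    proof (rule tendsto_sum)
      fix i assume "i \<in> {..Suc N}"
      then have i: "?g N i \<in> {0..T}" using gT by auto
      show "(\<lambda>k. prob {\<omega> \<in> space M. \<bar>elem_integral (n k) (\<tau> k) (h k) (?g N i) \<omega> - J (?g N i) \<omega>\<bar> > \<delta>/2}) \<longlonglongrightarrow> 0"
        by (rule elem_integral_tendsto_ito[OF P h lim I[OF i] i]) (use \<delta> in auto)
    qed
    then show "(\<lambda>k. \<Sum>i\<in>{..Suc N}. prob {\<omega> \<in> space M. \<bar>elem_integral (n k) (\<tau> k) (h k) (?g N i) \<omega> - J (?g N i) \<omega>\<bar> > \<delta>/2}) \<longlonglongrightarrow> 0" by (simp only: sum.neutral_const)
    show "\<forall>\<^sub>F k in sequentially. p N k \<le> (\<Sum>i\<in>{..Suc N}. prob {\<omega> \<in> space M. \<bar>elem_integral (n k) (\<tau> k) (h k) (?g N i) \<omega> - J (?g N i) \<omega>\<bar> > \<delta>/2})"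
      unfolding p_def using evm by (intro always_eventually allI prob_finite_union_le) auto
  qed (auto simp: p_def)
  \<comment> \<open>The condition \<open>k \<ge> N\<close> makes the diagonal index tend to
    infinity, so the pathwise approximation of \<open>H\<close> persists along it.\<close>
  have "\<exists>k\<ge>N. p N k < 1 / real (Suc N)" for N
  proof -
    have "eventually (\<lambda>k. p N k < 1 / real (Suc N)) sequentially" by (rule order_tendstoD(2)[OF p0]) simp
    then obtain K where "\<And>k. K \<le> k \<Longrightarrow> p N k < 1 / real (Suc N)" unfolding eventually_sequentially by blast
    then show ?thesis by (intro exI[of _ "max K N"]) simp
  qed
  then obtain k where k: "\<And>N. N \<le> k N" "\<And>N. p N (k N) < 1 / real (Suc N)" by metis
  have kinf: "filterlim k at_top sequentially"
    by (rule filterlim_at_top_mono[OF filterlim_ident]) (use k in auto)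
  have pk: "(\<lambda>N. p N (k N)) \<longlonglongrightarrow> 0"
  proof (rule tendsto_sandwich[OF _ _ tendsto_const])
    show "(\<lambda>N. 1 / real (Suc N)) \<longlonglongrightarrow> 0" by (rule LIMSEQ_Suc[OF lim_const_over_n])
    show "\<forall>\<^sub>F N in sequentially. p N (k N) \<le> 1 / real (Suc N)"
      using k(2) by (intro always_eventually allI less_imp_le) blast
  qed (simp add: p_def)
  define S where "S N \<omega> = (\<integral>\<^sup>+s\<in>{0..T}. ennreal ((step_process (n (k N)) (\<tau> (k N)) (h (k N)) s \<omega>
      - step_process (Suc N) (?g N) (\<lambda>j. H (?g N j)) s \<omega>)\<^sup>2) \<partial>lborel)" for N \<omega>
  have Sm: "S N \<in> borel_measurable M" for N
    unfolding S_def by (rule step_diff_measurable[OF P h order_refl PN hN order_refl TT])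
  have "AE \<omega> in M. (\<lambda>N. S N \<omega>) \<longlonglongrightarrow> 0"
    using lim Hm cont
  proof eventually_elim
    case (elim \<omega>)
    show ?case
    proof (rule tendsto_0_ennreal_sandwich)
      show "(\<lambda>N. \<integral>\<^sup>+s\<in>{0..T}. ennreal ((step_process (n (k N)) (\<tau> (k N)) (h (k N)) s \<omega> - H s \<omega>)\<^sup>2) \<partial>lborel) \<longlonglongrightarrow> 0"
        by (rule filterlim_compose[OF elim(1) kinf])
      show "(\<lambda>N. \<integral>\<^sup>+s\<in>{0..T}. ennreal ((step_process (Suc N) (?g N) (\<lambda>j. H (?g N j)) s \<omega> - H s \<omega>)\<^sup>2) \<partial>lborel) \<longlonglongrightarrow> 0"
        by (rule unigrid_step_approx[where f=H and \<omega>=\<omega>, OF T_pos elim(3)])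
    qed (unfold S_def, rule sq_integral_triangle[OF step_process_measurable step_process_measurable elim(2)])
  qed
  note S0 = prob_exceed_tendsto_0[OF Sm this]
  show ?thesis
  proof (rule tendsto_0_if_le_plus_small[of _ "1 / (\<delta>/2)\<^sup>2"])
    fix c :: real assume c: "0 < c"
    let ?a = "\<lambda>N. prob {\<omega> \<in> space M. S N \<omega> > ennreal c} + p N (k N)"
    have "?a \<longlonglongrightarrow> 0 + 0" by (intro tendsto_add S0[OF c] pk)
    moreover have "prob {\<omega> \<in> space M. \<exists>i\<in>{..Suc N}. \<bar>J (?g N i) \<omega> - ?R N (?g N i) \<omega>\<bar> > \<delta>} \<le> ?a N + 1 / (\<delta>/2)\<^sup>2 * c" for N
    proof -
      let ?A = "{\<omega> \<in> space M. \<exists>v\<in>?g N ` {..Suc N}. \<bar>elem_integral (n (k N)) (\<tau> (k N)) (h (k N)) v \<omega> - ?R N v \<omega>\<bar> > \<delta>/2}"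
      let ?B = "{\<omega> \<in> space M. \<exists>i\<in>{..Suc N}. \<bar>elem_integral (n (k N)) (\<tau> (k N)) (h (k N)) (?g N i) \<omega> - J (?g N i) \<omega>\<bar> > \<delta>/2}"
      have A: "?A \<in> events"
      proof (rule sets.sets_Collect_finite_Ex)
        fix v assume "v \<in> ?g N ` {..Suc N}"
        then have "v \<in> {0..T}" using gT by auto
        from sm[OF this, of "k N"] Rm[OF this, of N]
        show "{\<omega> \<in> space M. \<delta>/2 < \<bar>elem_integral (n (k N)) (\<tau> (k N)) (h (k N)) v \<omega> - ?R N v \<omega>\<bar>} \<in> events" by measurable
      qed auto
      have B: "?B \<in> events" using evm by (intro sets.sets_Collect_finite_Ex) auto
      have "prob {\<omega> \<in> space M. \<exists>i\<in>{..Suc N}. \<bar>J (?g N i) \<omega> - ?R N (?g N i) \<omega>\<bar> > \<delta>} \<le> prob (?A \<union> ?B)"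
      proof (rule finite_measure_mono)
        show "{\<omega> \<in> space M. \<exists>i\<in>{..Suc N}. \<bar>J (?g N i) \<omega> - ?R N (?g N i) \<omega>\<bar> > \<delta>} \<subseteq> ?A \<union> ?B"
        proof
          fix \<omega> assume "\<omega> \<in> {\<omega> \<in> space M. \<exists>i\<in>{..Suc N}. \<bar>J (?g N i) \<omega> - ?R N (?g N i) \<omega>\<bar> > \<delta>}"
          then obtain i where i: "\<omega> \<in> space M" "i \<in> {..Suc N}" "\<bar>J (?g N i) \<omega> - ?R N (?g N i) \<omega>\<bar> > \<delta>" by auto
          let ?s = "elem_integral (n (k N)) (\<tau> (k N)) (h (k N)) (?g N i) \<omega>"
          have "\<bar>?s - ?R N (?g N i) \<omega>\<bar> > \<delta>/2 \<or> \<bar>?s - J (?g N i) \<omega>\<bar> > \<delta>/2" using i(3) by linarith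
          then show "\<omega> \<in> ?A \<union> ?B" using i(1,2) by blast
        qed
      qed (use A B in auto)
      also have "\<dots> \<le> prob ?A + p N (k N)" unfolding p_def by (rule measure_Un_le[OF A B])
      also have "prob ?A \<le> prob {\<omega> \<in> space M. S N \<omega> > ennreal c} + c / (\<delta>/2)\<^sup>2"
        unfolding S_def by (rule elem_integral_compare[OF P h order_refl PN hN order_refl TT]) (use gT c \<delta> in auto)
      finally show ?thesis by simp
    qed
    ultimately show "\<exists>a. a \<longlonglongrightarrow> 0 \<and> (\<forall>\<^sub>F N in sequentially.
        prob {\<omega> \<in> space M. \<exists>i\<in>{..Suc N}. \<delta> < \<bar>J (?g N i) \<omega> - ?R N (?g N i) \<omega>\<bar>} \<le> a N + 1 / (\<delta>/2)\<^sup>2 * c)"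
      by (intro exI[of _ ?a]) auto
  qed auto
qed

end

section \<open>Moments of solutions of stochastic differential equations\<close>

lemma even_power_le_mult:
  fixes y g :: real
  assumes "even n" and "\<bar>g\<bar> \<le> B" 
  shows "g ^ n \<le> B ^ n"
  using power_mono[OF assms(2) abs_ge_zero, of n] assms(1) by (simp add: power_even_abs)

context brownian begin

text \<open>The power is expanded around \<open>A\<close>, the value after the drift. Odd moments of
  the increment vanish and even ones of positive order are at most \<open>fact k * (t - s)\<close>
  because the step is at most 1, so every term with \<open>k \<ge> 1\<close> is of order
  \<open>t - s\<close>; the drift costs the same order by convexity. Adding 1 to the moment absorbs
  the constant part of the linear growth, and the \<open>4 ^ n\<close> in \<open>C\<close> comes
  from \<open>(2 + |y|) ^ n \<le> 4 ^ n * (1 + y ^ n)\<close>.\<close>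

lemma one_step_moment:
  fixes m :: nat and K :: real
  defines "n \<equiv> 2 * m"
  defines "C \<equiv> 4 ^ n * (1 + (\<Sum>k\<le>n. real (n choose k) * fact k)) * (1 + K) ^ n"
  assumes st: "0 \<le> s" "s < t" "t \<le> T" and d: "t - s \<le> 1" and K: "0 \<le> K"
    and Y: "Y \<in> borel_measurable (F s)" and g: "g \<in> borel_measurable (F s)" and \<beta>: "\<beta> \<in> borel_measurable (F s)"
    and int: "integrable M (\<lambda>\<omega>. Y \<omega> ^ n)"
    and bound: "\<And>\<omega>. \<omega> \<in> space M \<Longrightarrow> \<bar>g \<omega>\<bar> \<le> K * (2 + \<bar>Y \<omega>\<bar>)" "\<And>\<omega>. \<omega> \<in> space M \<Longrightarrow> \<bar>\<beta> \<omega>\<bar> \<le> K * (2 + \<bar>Y \<omega>\<bar>)"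
  shows "integrable M (\<lambda>\<omega>. (Y \<omega> + (g \<omega> * (W t \<omega> - W s \<omega>) + \<beta> \<omega> * (t - s))) ^ n)"
    and "(\<integral>\<omega>. (Y \<omega> + (g \<omega> * (W t \<omega> - W s \<omega>) + \<beta> \<omega> * (t - s))) ^ n \<partial>M) + 1
      \<le> (1 + C * (t - s)) * ((\<integral>\<omega>. Y \<omega> ^ n \<partial>M) + 1)"
proof -
  define D where "D \<omega> = W t \<omega> - W s \<omega>" for \<omega>
  define A where "A \<omega> = Y \<omega> + \<beta> \<omega> * (t - s)" for \<omega>
  define U where "U \<omega> = (1 + K) * (2 + \<bar>Y \<omega>\<bar>)" for \<omega>
  have en: "even n" unfolding n_def by simp
  have d0: "0 < t - s" using st by simp
  have U0: "0 \<le> U \<omega>" for \<omega> using K by (simp add: U_def)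
  have [measurable]: "Y \<in> borel_measurable M" "g \<in> borel_measurable M" "\<beta> \<in> borel_measurable M"
    using measurable_F_M[OF Y] measurable_F_M[OF g] measurable_F_M[OF \<beta>] st by auto
  have Am: "A \<in> borel_measurable (F s)" unfolding A_def using Y \<beta> by auto
  have [measurable]: "A \<in> borel_measurable M" "U \<in> borel_measurable M" unfolding A_def U_def by auto
  have Kle: "K * (2 + \<bar>Y \<omega>\<bar>) + \<bar>Y \<omega>\<bar> \<le> U \<omega>" for \<omega> by (simp add: U_def algebra_simps)
  have gU: "\<bar>g \<omega>\<bar> \<le> U \<omega>" if "\<omega> \<in> space M" for \<omega> using bound(1)[OF that] Kle[of \<omega>] by linarith
  have Yb: "\<bar>Y \<omega> + \<beta> \<omega>\<bar> \<le> U \<omega>" if "\<omega> \<in> space M" for \<omega> using bound(2)[OF that] Kle[of \<omega>] by linarith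
  have AU: "\<bar>A \<omega>\<bar> \<le> U \<omega>" if "\<omega> \<in> space M" for \<omega>
  proof -
    have "\<bar>\<beta> \<omega> * (t - s)\<bar> \<le> \<bar>\<beta> \<omega>\<bar>" using d d0 by (simp add: abs_mult mult_left_le)
    then show ?thesis unfolding A_def using bound(2)[OF that] Kle[of \<omega>] by linarith
  qed
  have Upow: "U \<omega> ^ n \<le> (1 + K) ^ n * (4 ^ n * (1 + Y \<omega> ^ n))" for \<omega>
  proof -
    have "(2 + \<bar>Y \<omega>\<bar>) ^ n \<le> (2 * max 2 \<bar>Y \<omega>\<bar>) ^ n" by (intro power_mono) auto
    also have "\<dots> = 2 ^ n * max 2 \<bar>Y \<omega>\<bar> ^ n" by (simp add: power_mult_distrib)
    also have "max 2 \<bar>Y \<omega>\<bar> ^ n \<le> 2 ^ n + \<bar>Y \<omega>\<bar> ^ n" by (auto simp: max_def)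
    also have "\<bar>Y \<omega>\<bar> ^ n = Y \<omega> ^ n" using en by (simp add: power_even_abs)
    also have "2 ^ n + Y \<omega> ^ n \<le> 2 ^ n * (1 + Y \<omega> ^ n)"
    proof -
      have "0 \<le> Y \<omega> ^ n" using en by (simp add: zero_le_even_power)
      then have "1 * Y \<omega> ^ n \<le> 2 ^ n * Y \<omega> ^ n" by (intro mult_right_mono) auto
      then show ?thesis by (simp add: distrib_left)
    qed
    finally have "(2 + \<bar>Y \<omega>\<bar>) ^ n \<le> 2 ^ n * (2 ^ n * (1 + Y \<omega> ^ n))" by simp
    also have "\<dots> = 4 ^ n * (1 + Y \<omega> ^ n)" by (simp add: power_mult_distrib[symmetric] mult.assoc[symmetric])
    finally show ?thesis unfolding U_def power_mult_distrib using K by (intro mult_left_mono) auto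
  qed
  have intU: "integrable M (\<lambda>\<omega>. U \<omega> ^ n)"
  proof (rule Bochner_Integration.integrable_bound)
    show "integrable M (\<lambda>\<omega>. (1 + K) ^ n * (4 ^ n * (1 + Y \<omega> ^ n)))" using int by auto
    show "AE \<omega> in M. norm (U \<omega> ^ n) \<le> norm ((1 + K) ^ n * (4 ^ n * (1 + Y \<omega> ^ n)))"
      using Upow U0 by (intro AE_I2) (auto intro: order_trans[OF _ abs_ge_self])
  qed measurable
  have cross: "\<bar>g \<omega> ^ k * A \<omega> ^ (n - k)\<bar> \<le> U \<omega> ^ n" if "\<omega> \<in> space M" "k \<le> n" for \<omega> k
  proof -
    have "\<bar>g \<omega> ^ k * A \<omega> ^ (n - k)\<bar> \<le> U \<omega> ^ k * U \<omega> ^ (n - k)"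
      unfolding abs_mult power_abs using gU[OF that(1)] AU[OF that(1)] U0 by (intro mult_mono power_mono) auto
    also have "\<dots> = U \<omega> ^ n" using that by (simp add: power_add[symmetric])
    finally show ?thesis .
  qed
  have intc: "integrable M (\<lambda>\<omega>. g \<omega> ^ k * A \<omega> ^ (n - k))" if "k \<le> n" for k
    by (rule Bochner_Integration.integrable_bound[OF intU])
       (use cross[OF _ that] U0 in \<open>auto intro!: AE_I2 simp: abs_of_nonneg\<close>)
  have cm: "(\<lambda>\<omega>. g \<omega> ^ k * A \<omega> ^ (n - k)) \<in> borel_measurable (F s)" for k using g Am by auto
  let ?c = "\<lambda>k. real (n choose k)"
  let ?X = "\<lambda>k \<omega>. (g \<omega> ^ k * A \<omega> ^ (n - k)) * D \<omega> ^ k"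
  have expand: "(Y \<omega> + (g \<omega> * (W t \<omega> - W s \<omega>) + \<beta> \<omega> * (t - s))) ^ n = (\<Sum>k\<le>n. ?c k * ?X k \<omega>)" for \<omega>
  proof -
    have "Y \<omega> + (g \<omega> * (W t \<omega> - W s \<omega>) + \<beta> \<omega> * (t - s)) = g \<omega> * D \<omega> + A \<omega>" by (simp add: A_def D_def)
    then have "(Y \<omega> + (g \<omega> * (W t \<omega> - W s \<omega>) + \<beta> \<omega> * (t - s))) ^ n
        = (\<Sum>k\<le>n. ?c k * (g \<omega> * D \<omega>) ^ k * A \<omega> ^ (n - k))" by (simp only: binomial_ring)
    also have "\<dots> = (\<Sum>k\<le>n. ?c k * ?X k \<omega>)" by (intro sum.cong refl) (simp only: power_mult_distrib mult_ac)
    finally show ?thesis .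
  qed
  have intX: "integrable M (?X k)" if "k \<le> n" for k
    unfolding D_def by (rule integrable_mult_increment(1)[OF cm intc[OF that] st])
  have EX: "(\<integral>\<omega>. ?X k \<omega> \<partial>M) = (\<integral>\<omega>. g \<omega> ^ k * A \<omega> ^ (n - k) \<partial>M) * (\<integral>\<omega>. D \<omega> ^ k \<partial>M)" if "k \<le> n" for k
    unfolding D_def by (rule integrable_mult_increment(2)[OF cm intc[OF that] st])
  show 1: "integrable M (\<lambda>\<omega>. (Y \<omega> + (g \<omega> * (W t \<omega> - W s \<omega>) + \<beta> \<omega> * (t - s))) ^ n)"
    unfolding expand using intX by (intro Bochner_Integration.integrable_sum integrable_mult_right) auto
  have mom: "\<bar>\<integral>\<omega>. D \<omega> ^ k \<partial>M\<bar> \<le> fact k * (t - s)" if "1 \<le> k" for k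
  proof (cases "even k")
    case True
    then have k2: "1 \<le> k div 2" using that by auto
    define a where "a = (fact k / (2 ^ (k div 2) * fact (k div 2)) :: real)"
    have E: "(\<integral>\<omega>. D \<omega> ^ k \<partial>M) = a * (t - s) ^ (k div 2)"
      unfolding D_def a_def by (rule increment_moment_even[OF st True])
    have a0: "0 \<le> a" by (simp add: a_def)
    have a1: "a \<le> fact k"
    proof -
      have "1 * 1 \<le> (2 ^ (k div 2) * fact (k div 2) :: real)" by (intro mult_mono) (auto simp: fact_ge_1)
      then show ?thesis unfolding a_def by (simp add: divide_le_eq_1 pos_divide_le_eq mult_le_cancel_left1)
    qed
    have b: "(t - s) ^ (k div 2) \<le> (t - s) ^ 1" using d d0 k2 by (intro power_decreasing) auto
    have "a * (t - s) ^ (k div 2) \<le> fact k * (t - s) ^ 1"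
      by (rule mult_mono[OF a1 b]) (use d0 in auto)
    moreover have "0 \<le> a * (t - s) ^ (k div 2)" using d0 a0 by simp
    ultimately show ?thesis unfolding E by simp
  next
    case False
    then show ?thesis using increment_moment_odd[OF st False] d0 unfolding D_def by simp
  qed
  define EU where "EU = (\<integral>\<omega>. U \<omega> ^ n \<partial>M)"
  have EU0: "0 \<le> EU" unfolding EU_def using U0 by (intro integral_nonneg_AE) auto
  have EA: "(\<integral>\<omega>. A \<omega> ^ n \<partial>M) \<le> (\<integral>\<omega>. Y \<omega> ^ n \<partial>M) + (t - s) * EU"
  proof -
    have "(\<integral>\<omega>. A \<omega> ^ n \<partial>M) \<le> (\<integral>\<omega>. Y \<omega> ^ n + (t - s) * U \<omega> ^ n \<partial>M)"
    proof (rule integral_mono)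
      show "integrable M (\<lambda>\<omega>. A \<omega> ^ n)" using intc[of 0] by simp
      fix \<omega> assume \<omega>: "\<omega> \<in> space M"
      \<comment> \<open>\<open>A\<close> is a convex combination of \<open>Y\<close> and
        \<open>Y + \<beta>\<close> with weight \<open>t - s\<close> on the latter, so convexity of
        the even power extracts the factor \<open>t - s\<close>.\<close>
      have "A \<omega> ^ n = ((1 - (t - s)) *\<^sub>R Y \<omega> + (t - s) *\<^sub>R (Y \<omega> + \<beta> \<omega>)) ^ n"
        unfolding A_def by (simp add: algebra_simps)
      also have "\<dots> \<le> (1 - (t - s)) * Y \<omega> ^ n + (t - s) * (Y \<omega> + \<beta> \<omega>) ^ n"
        using convex_onD[OF convex_power_even[OF en], of "t - s" "Y \<omega>" "Y \<omega> + \<beta> \<omega>"] d d0 by simp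
      also have "\<dots> \<le> 1 * Y \<omega> ^ n + (t - s) * U \<omega> ^ n"
        using even_power_le_mult[OF en Yb[OF \<omega>]] d0 en by (intro add_mono mult_mono mult_right_mono) (auto simp: zero_le_even_power)
      finally show "A \<omega> ^ n \<le> Y \<omega> ^ n + (t - s) * U \<omega> ^ n" by simp
    qed (use int intU in auto)
    also have "\<dots> = (\<integral>\<omega>. Y \<omega> ^ n \<partial>M) + (t - s) * EU" using int intU by (simp add: EU_def)
    finally show ?thesis .
  qed
  have EX1: "(\<integral>\<omega>. ?X k \<omega> \<partial>M) \<le> fact k * (t - s) * EU" if "1 \<le> k" "k \<le> n" for k
  proof -
    have "\<bar>\<integral>\<omega>. g \<omega> ^ k * A \<omega> ^ (n - k) \<partial>M\<bar> \<le> (\<integral>\<omega>. \<bar>g \<omega> ^ k * A \<omega> ^ (n - k)\<bar> \<partial>M)" by (rule integral_abs_bound)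
    also have "\<dots> \<le> EU" unfolding EU_def using intc[OF that(2)] intU cross[OF _ that(2)] by (intro integral_mono) auto
    finally have a: "\<bar>\<integral>\<omega>. g \<omega> ^ k * A \<omega> ^ (n - k) \<partial>M\<bar> \<le> EU" .
    have "(\<integral>\<omega>. ?X k \<omega> \<partial>M) \<le> \<bar>\<integral>\<omega>. g \<omega> ^ k * A \<omega> ^ (n - k) \<partial>M\<bar> * \<bar>\<integral>\<omega>. D \<omega> ^ k \<partial>M\<bar>"
      unfolding EX[OF that(2)] abs_mult[symmetric] by simp
    also have "\<dots> \<le> EU * (fact k * (t - s))" by (intro mult_mono a mom that EU0) auto
    finally show ?thesis by (simp add: mult_ac)
  qed
  have "(\<integral>\<omega>. (Y \<omega> + (g \<omega> * (W t \<omega> - W s \<omega>) + \<beta> \<omega> * (t - s))) ^ n \<partial>M) = (\<Sum>k\<le>n. ?c k * (\<integral>\<omega>. ?X k \<omega> \<partial>M))"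
    unfolding expand using intX by (subst Bochner_Integration.integral_sum) auto
  also have "\<dots> \<le> (\<Sum>k\<le>n. (if k = 0 then (\<integral>\<omega>. A \<omega> ^ n \<partial>M) else 0) + ?c k * fact k * ((t - s) * EU))"
  proof (rule sum_mono)
    fix k assume k: "k \<in> {..n}"
    show "?c k * (\<integral>\<omega>. ?X k \<omega> \<partial>M) \<le> (if k = 0 then (\<integral>\<omega>. A \<omega> ^ n \<partial>M) else 0) + ?c k * fact k * ((t - s) * EU)"
    proof (cases "k = 0")
      case True then show ?thesis using d0 EU0 by simp
    next
      case False
      then have "?c k * (\<integral>\<omega>. ?X k \<omega> \<partial>M) \<le> ?c k * (fact k * (t - s) * EU)"
        using EX1[of k] k by (intro mult_left_mono) auto
      then show ?thesis using False by (simp add: mult_ac)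
    qed
  qed
  also have "\<dots> = (\<integral>\<omega>. A \<omega> ^ n \<partial>M) + (\<Sum>k\<le>n. ?c k * fact k) * ((t - s) * EU)"
    by (simp add: sum.distrib sum_distrib_right)
  finally have main: "(\<integral>\<omega>. (Y \<omega> + (g \<omega> * (W t \<omega> - W s \<omega>) + \<beta> \<omega> * (t - s))) ^ n \<partial>M)
      \<le> (\<integral>\<omega>. Y \<omega> ^ n \<partial>M) + (1 + (\<Sum>k\<le>n. ?c k * fact k)) * ((t - s) * EU)"
    using EA by (simp add: algebra_simps)
  have "EU \<le> (\<integral>\<omega>. (1 + K) ^ n * (4 ^ n * (1 + Y \<omega> ^ n)) \<partial>M)"
    unfolding EU_def using intU int Upow by (intro integral_mono) auto
  also have "\<dots> = (1 + K) ^ n * (4 ^ n * (1 + (\<integral>\<omega>. Y \<omega> ^ n \<partial>M)))" using int by (simp add: prob_space)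
  finally have EUle: "EU \<le> (1 + K) ^ n * (4 ^ n * (1 + (\<integral>\<omega>. Y \<omega> ^ n \<partial>M)))" .
  have S0: "0 \<le> 1 + (\<Sum>k\<le>n. ?c k * fact k)" by (intro add_nonneg_nonneg sum_nonneg) auto
  have "(1 + (\<Sum>k\<le>n. ?c k * fact k)) * ((t - s) * EU)
     \<le> (1 + (\<Sum>k\<le>n. ?c k * fact k)) * ((t - s) * ((1 + K) ^ n * (4 ^ n * (1 + (\<integral>\<omega>. Y \<omega> ^ n \<partial>M)))))"
    using EUle d0 S0 by (intro mult_left_mono) auto
  also have "\<dots> = C * (t - s) * ((\<integral>\<omega>. Y \<omega> ^ n \<partial>M) + 1)" unfolding C_def by (simp add: mult_ac add_ac)
  finally show "(\<integral>\<omega>. (Y \<omega> + (g \<omega> * (W t \<omega> - W s \<omega>) + \<beta> \<omega> * (t - s))) ^ n \<partial>M) + 1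
      \<le> (1 + C * (t - s)) * ((\<integral>\<omega>. Y \<omega> ^ n \<partial>M) + 1)"
    using main by (simp add: algebra_simps)
qed

text \<open>The discrete Gronwall argument. The coefficients are arbitrary adapted variables,
  bounded only in terms of the scheme's own value. The product of the growth factors is at most
  \<open>exp (C * T)\<close>, a bound that does not depend on \<open>N\<close>.\<close>

lemma euler_type_moment:
  fixes m :: nat and K x0 :: real
  defines "n \<equiv> 2 * m"
  defines "C \<equiv> 4 ^ n * (1 + (\<Sum>k\<le>n. real (n choose k) * fact k)) * (1 + K) ^ n"
  assumes d: "T / real (Suc N) \<le> 1" and K: "0 \<le> K"
    and Y: "\<And>i \<omega>. Y i \<omega> = x0 + (\<Sum>j<i. g j \<omega> * (W (unigrid T N (Suc j)) \<omega> - W (unigrid T N j) \<omega>) + \<beta> j \<omega> * (T / real (Suc N)))"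
    and g: "\<And>j. j < Suc N \<Longrightarrow> g j \<in> borel_measurable (F (unigrid T N j))"
    and \<beta>: "\<And>j. j < Suc N \<Longrightarrow> \<beta> j \<in> borel_measurable (F (unigrid T N j))"
    and bound: "\<And>j \<omega>. j < Suc N \<Longrightarrow> \<omega> \<in> space M \<Longrightarrow> \<bar>g j \<omega>\<bar> \<le> K * (2 + \<bar>Y j \<omega>\<bar>)"
      "\<And>j \<omega>. j < Suc N \<Longrightarrow> \<omega> \<in> space M \<Longrightarrow> \<bar>\<beta> j \<omega>\<bar> \<le> K * (2 + \<bar>Y j \<omega>\<bar>)"
  shows "Y (Suc N) \<in> borel_measurable M \<and> integrable M (\<lambda>\<omega>. Y (Suc N) \<omega> ^ n) \<and>
    (\<integral>\<omega>. Y (Suc N) \<omega> ^ n \<partial>M) + 1 \<le> exp (C * T) * (x0 ^ n + 1)"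
proof -
  note P = is_partition_unigrid[OF T_pos, of N]
  let ?g = "unigrid T N"
  define d where "d = T / real (Suc N)"
  have d0: "0 < d" unfolding d_def using T_pos by simp
  have C0: "0 \<le> C" unfolding C_def using K by (intro mult_nonneg_nonneg add_nonneg_nonneg sum_nonneg) auto
  have YS: "Y (Suc i) \<omega> = Y i \<omega> + (g i \<omega> * (W (?g (Suc i)) \<omega> - W (?g i) \<omega>) + \<beta> i \<omega> * (?g (Suc i) - ?g i))" for i \<omega>
    unfolding Y unigrid_diff by simp
  have "Y i \<in> borel_measurable (F (?g i)) \<and> integrable M (\<lambda>\<omega>. Y i \<omega> ^ n) \<and>
     (\<integral>\<omega>. Y i \<omega> ^ n \<partial>M) + 1 \<le> (1 + C * d) ^ i * (x0 ^ n + 1)" if "i \<le> Suc N" for i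
    using that
  proof (induction i)
    case 0
    have "Y 0 = (\<lambda>\<omega>. x0)" unfolding Y by auto
    then show ?case by (simp add: prob_space)
  next
    case (Suc i)
    then have i: "i < Suc N" by simp
    have r: "0 \<le> ?g i" "?g i < ?g (Suc i)" "?g (Suc i) \<le> T"
      using partition_range[OF P, of i] partition_range[OF P, of "Suc i"] P i by (auto simp: is_partition_def)
    have dd: "?g (Suc i) - ?g i = d" "d \<le> 1" using unigrid_diff d by (auto simp: d_def)
    have IH: "Y i \<in> borel_measurable (F (?g i))" "integrable M (\<lambda>\<omega>. Y i \<omega> ^ n)"
      "(\<integral>\<omega>. Y i \<omega> ^ n \<partial>M) + 1 \<le> (1 + C * d) ^ i * (x0 ^ n + 1)" using Suc by auto
    note step = one_step_moment[where m=m and K=K, folded n_def, folded C_def, OF r _ K IH(1) g[OF i] \<beta>[OF i] IH(2) bound(1)[OF i] bound(2)[OF i], unfolded dd(1), OF dd(2)]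
    have eq: "Y (Suc i) = (\<lambda>\<omega>. Y i \<omega> + (g i \<omega> * (W (?g (Suc i)) \<omega> - W (?g i) \<omega>) + \<beta> i \<omega> * d))"
      by (rule ext) (simp only: YS dd(1))
    have lift: "f \<in> borel_measurable (F (?g (Suc i)))" if "f \<in> borel_measurable (F (?g i))" for f
      by (rule measurable_F_mono[OF that r(1) less_imp_le[OF r(2)] r(3)])
    have "W (?g i) \<in> borel_measurable (F (?g i))" "W (?g (Suc i)) \<in> borel_measurable (F (?g (Suc i)))"
      by (rule adapted_W, use r in simp)+
    note meas = lift[OF this(1)] this(2) lift[OF IH(1)] lift[OF g[OF i]] lift[OF \<beta>[OF i]]
    have "Y (Suc i) \<in> borel_measurable (F (?g (Suc i)))"
      unfolding eq by (intro borel_measurable_add borel_measurable_times borel_measurable_diff borel_measurable_const meas)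
    moreover have "(\<integral>\<omega>. Y (Suc i) \<omega> ^ n \<partial>M) + 1 \<le> (1 + C * d) ^ Suc i * (x0 ^ n + 1)"
    proof -
      have "(\<integral>\<omega>. Y (Suc i) \<omega> ^ n \<partial>M) + 1 \<le> (1 + C * d) * ((\<integral>\<omega>. Y i \<omega> ^ n \<partial>M) + 1)"
        using step(2) unfolding eq .
      also have "\<dots> \<le> (1 + C * d) * ((1 + C * d) ^ i * (x0 ^ n + 1))"
        using IH(3) C0 d0 by (intro mult_left_mono) auto
      finally show ?thesis by (simp add: mult_ac)
    qed
    ultimately show ?case using step(1) unfolding eq by blast
  qed
  from this[of "Suc N"] have Y1: "Y (Suc N) \<in> borel_measurable (F (?g (Suc N)))" "integrable M (\<lambda>\<omega>. Y (Suc N) \<omega> ^ n)"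
     "(\<integral>\<omega>. Y (Suc N) \<omega> ^ n \<partial>M) + 1 \<le> (1 + C * d) ^ Suc N * (x0 ^ n + 1)" by auto
  have "(1 + C * d) ^ Suc N \<le> exp (C * d) ^ Suc N"
    using C0 d0 by (intro power_mono) (auto simp: exp_ge_add_one_self add.commute)
  also have "\<dots> = exp (real (Suc N) * (C * d))" by (rule exp_of_nat_mult[symmetric])
  also have "real (Suc N) * (C * d) = C * T" by (simp add: d_def)
  finally have "(1 + C * d) ^ Suc N * (x0 ^ n + 1) \<le> exp (C * T) * (x0 ^ n + 1)"
    unfolding n_def by (intro mult_right_mono) (auto simp: add_nonneg_nonneg)
  moreover have "Y (Suc N) \<in> borel_measurable M"
    using measurable_F_M[OF Y1(1)] partition_range[OF P, of "Suc N"] by auto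
  ultimately show ?thesis using Y1 by auto
qed

end

section \<open>The drift integral and the moments of the solution\<close>

lemma unigrid_riemann_integral:
  fixes f :: "real \<Rightarrow> real"
  assumes T: "0 < T" and f: "continuous_on {0..T} f" and e: "0 < e"
  shows "eventually (\<lambda>N. \<forall>i\<le>Suc N. \<bar>(LINT s:{0..unigrid T N i}|lborel. f s)
     - (\<Sum>j<i. f (unigrid T N j) * (T / real (Suc N)))\<bar> \<le> e) sequentially"
proof -
  \<comment> \<open>An error of \<open>e / T\<close> per unit of time adds up to at most
    \<open>e\<close> at every grid time.\<close>
  have e': "0 < e / T" using e T by simp
  from unigrid_uniform[OF T f e'] show ?thesis
  proof eventually_elim
    case (elim N)
    let ?g = "unigrid T N"
    note P = is_partition_unigrid[OF T, of N]
    define d where "d = T / real (Suc N)"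
    have d0: "0 < d" using T by (simp add: d_def)
    have gd: "?g (Suc j) - ?g j = d" for j by (simp add: unigrid_diff d_def)
    have sub: "{0..?g i} \<subseteq> {0..T}" if "i \<le> Suc N" for i using partition_range[OF P that] by auto
    have L: "(LINT s:{0..?g i}|lborel. f s) = integral {0..?g i} f" if "i \<le> Suc N" for i
      by (rule set_borel_integral_eq_integral(2), rule borel_integrable_atLeastAtMost', rule continuous_on_subset[OF f sub[OF that]])
    have "\<bar>integral {0..?g i} f - (\<Sum>j<i. f (?g j) * d)\<bar> \<le> real i * (e / T * d)" if "i \<le> Suc N" for i
      using that
    proof (induction i)
      case 0
      then show ?case by (simp add: unigrid_def)
    next
      case (Suc i)
      then have i: "i < Suc N" by simp
      have r: "0 \<le> ?g i" "?g i \<le> ?g (Suc i)" "?g (Suc i) \<le> T"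
        using partition_range[OF P, of i] partition_range[OF P, of "Suc i"] partition_mono[OF P, of i "Suc i"] i by auto
      have c1: "continuous_on {0..?g (Suc i)} f" by (rule continuous_on_subset[OF f]) (use r in auto)
      have c2: "continuous_on {?g i..?g (Suc i)} f" by (rule continuous_on_subset[OF f]) (use r in auto)
      have "integral {0..?g i} f + integral {?g i..?g (Suc i)} f = integral {0..?g (Suc i)} f"
        by (rule Henstock_Kurzweil_Integration.integral_combine[OF r(1,2) integrable_continuous_interval[OF c1]])
      moreover have "integral {?g i..?g (Suc i)} (\<lambda>s. f s - f (?g i)) = integral {?g i..?g (Suc i)} f - f (?g i) * d"
      proof -
        have "integral {?g i..?g (Suc i)} (\<lambda>s. f s - f (?g i)) = integral {?g i..?g (Suc i)} f - integral {?g i..?g (Suc i)} (\<lambda>s. f (?g i))"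
          by (rule Henstock_Kurzweil_Integration.integral_diff[OF integrable_continuous_interval[OF c2]]) (rule integrable_const_ivl)
        then show ?thesis using r gd by (simp add: mult.commute)
      qed
      moreover have "norm (integral {?g i..?g (Suc i)} (\<lambda>s. f s - f (?g i))) \<le> e / T * (?g (Suc i) - ?g i)"
        using elim i by (intro integral_bound r continuous_on_diff c2 continuous_on_const) auto
      ultimately have "\<bar>integral {0..?g (Suc i)} f - (\<Sum>j<Suc i. f (?g j) * d)\<bar> \<le> real i * (e / T * d) + e / T * d"
        using Suc.IH i gd by simp
      also have "\<dots> = real (Suc i) * (e / T * d)" by (simp only: of_nat_Suc distrib_right mult_1 mult_1_left add.commute)
      finally show ?case .
    qed
    note bnd = this
    show ?case
    proof (intro allI impI)
      fix i assume i: "i \<le> Suc N"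
      have "real i * (e / T * d) \<le> real (Suc N) * (e / T * d)" using i e T d0 by (intro mult_right_mono) auto
      also have "\<dots> = e" using T by (simp add: d_def)
      finally show "\<bar>(LINT s:{0..?g i}|lborel. f s) - (\<Sum>j<i. f (?g j) * (T / real (Suc N)))\<bar> \<le> e"
        using bnd[OF i] L[OF i] by (simp add: d_def)
    qed
  qed
qed

lemma sde_coefficient_continuous:
  assumes c: "sde_coefficient T K \<alpha> f" and x: "continuous_on {0..T} x"
  shows "continuous_on {0..T} (\<lambda>s. f s (x s))"
proof -
  have "continuous_on ({0..T} \<times> UNIV) (\<lambda>(t, x). f t x)" using c by (simp add: sde_coefficient_def)
  moreover have "continuous_on {0..T} (\<lambda>s. (s, x s))" by (intro continuous_on_Pair continuous_on_id x)
  ultimately have "continuous_on {0..T} ((\<lambda>(t, x). f t x) \<circ> (\<lambda>s. (s, x s)))"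
    by (intro continuous_on_compose) (auto elim: continuous_on_subset)
  then show ?thesis by (simp add: comp_def)
qed

lemma sde_coefficient_measurable:
  assumes c: "sde_coefficient T K \<alpha> f" and t: "t \<in> {0..T}"
  shows "f t \<in> borel_measurable borel"
proof -
  obtain f' where "\<forall>t\<in>{0..T}. \<forall>x. (f t has_real_derivative f' t x) (at x)"
    using c unfolding sde_coefficient_def by (elim conjE exE) (rule that)
  then have "(f t has_real_derivative f' t x) (at x)" for x using t by blast
  then have "isCont (f t) x" for x by (rule DERIV_isCont)
  then show ?thesis by (intro borel_measurable_continuous_onI) (simp add: continuous_at_imp_continuous_on)
qed

context brownian begin

lemma elem_integral_unigrid:
  assumes "i \<le> Suc N"
  shows "elem_integral (Suc N) (unigrid T N) h (unigrid T N i) \<omega>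
    = (\<Sum>j<i. h j \<omega> * (W (unigrid T N (Suc j)) \<omega> - W (unigrid T N j) \<omega>))"
proof -
  note P = is_partition_unigrid[OF T_pos, of N]
  have "unigrid T N (Suc j) \<in> {unigrid T N j<..unigrid T N (Suc j)}" if "j < i" for j
    using P that assms by (auto simp: is_partition_def)
  then have "step_process (Suc N) (unigrid T N) h (unigrid T N (Suc j)) \<omega> = h j \<omega>" if "j < i" for j
    using step_process_at[OF P, of j "unigrid T N (Suc j)" h \<omega>] that assms by auto
  then show ?thesis using grid_integral_step_process[OF P order_refl assms P, of h \<omega>] by (simp add: grid_integral_def)
qed

text \<open>Convergence in probability controls only bounded functions of the solution. Moments are
  therefore bounded for truncations, uniformly in the level, and recovered by monotone
  convergence.\<close>

lemma integrable_if_truncations_bounded: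
  fixes Z :: "'a \<Rightarrow> real"
  assumes [measurable]: "Z \<in> borel_measurable M" and Z: "\<And>\<omega>. 0 \<le> Z \<omega>"
    and bound: "\<And>R::nat. (\<integral>\<omega>. min (Z \<omega>) (real R) \<partial>M) \<le> B"
  shows "integrable M Z"
proof (rule integrableI_bounded)
  have inc: "incseq (\<lambda>R \<omega>. ennreal (min (Z \<omega>) (real R)))"
    by (auto simp: incseq_def le_fun_def intro!: ennreal_leI)
  have "(\<integral>\<^sup>+\<omega>. ennreal (norm (Z \<omega>)) \<partial>M) = (\<integral>\<^sup>+\<omega>. (SUP R. ennreal (min (Z \<omega>) (real R))) \<partial>M)"
  proof (rule nn_integral_cong)
    fix \<omega>
    have "(SUP R. ennreal (min (Z \<omega>) (real R))) = ennreal (Z \<omega>)"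
    proof (rule antisym)
      obtain R where "Z \<omega> \<le> real R" using real_arch_simple by blast
      then have "ennreal (Z \<omega>) = ennreal (min (Z \<omega>) (real R))" by simp
      also have "\<dots> \<le> (SUP R. ennreal (min (Z \<omega>) (real R)))" by (rule SUP_upper) simp
      finally show "ennreal (Z \<omega>) \<le> (SUP R. ennreal (min (Z \<omega>) (real R)))" .
    qed (auto intro!: SUP_least ennreal_leI)
    then show "ennreal (norm (Z \<omega>)) = (SUP R. ennreal (min (Z \<omega>) (real R)))" using Z[of \<omega>] by simp
  qed
  also have "\<dots> = (SUP R. \<integral>\<^sup>+\<omega>. ennreal (min (Z \<omega>) (real R)) \<partial>M)"
    by (rule nn_integral_monotone_convergence_SUP[OF inc]) measurable
  also have "\<dots> \<le> ennreal B"
  proof (rule SUP_least)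
    fix R :: nat
    have "integrable M (\<lambda>\<omega>. min (Z \<omega>) (real R))"
      by (rule integrable_const_bound[of _ "real R"]) (use Z in auto)
    then have "(\<integral>\<^sup>+\<omega>. ennreal (min (Z \<omega>) (real R)) \<partial>M) = ennreal (\<integral>\<omega>. min (Z \<omega>) (real R) \<partial>M)"
      using Z by (intro nn_integral_eq_integral) auto
    then show "(\<integral>\<^sup>+\<omega>. ennreal (min (Z \<omega>) (real R)) \<partial>M) \<le> ennreal B" using bound[of R] by (simp add: ennreal_leI)
  qed
  finally show "(\<integral>\<^sup>+\<omega>. ennreal (norm (Z \<omega>)) \<partial>M) < \<infinity>" by (simp add: le_less_trans[OF _ ennreal_less_top])
qed measurable

text \<open>At truncation level \<open>R\<close> the expectation is at most
  \<open>Q + R * prob (bad N)\<close>, where \<open>Q\<close> comes from the stopped scheme and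
  depends on neither \<open>N\<close> nor \<open>R\<close>. The order of limits matters: first
  \<open>N\<close> tends to infinity for fixed \<open>R\<close>, then \<open>R\<close>
  grows.\<close>

lemma sde_solution_moments:
  assumes coeff: "sde_coefficient T K \<alpha> \<sigma>" "sde_coefficient T K \<alpha> b"
    and sde: "sde_solution M F W T \<sigma> b x0 X"
  shows "integrable M (\<lambda>\<omega>. X T \<omega> ^ (2 * m))"
proof -
  let ?g = "unigrid T"
  note PN = is_partition_unigrid[OF T_pos]
  have gT: "?g N i \<in> {0..T}" if "i \<le> Suc N" for N i using partition_range[OF PN that] by auto
  have gend: "?g N (Suc N) = T" for N using PN[of N] by (simp add: is_partition_def)
  have TT: "T \<in> {0..T}" using T_pos by simp
  have lin: "\<bar>f t x\<bar> \<le> K * (1 + \<bar>x\<bar>)" if "sde_coefficient T K \<alpha> f" "t \<in> {0..T}" for f t x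
    using that unfolding sde_coefficient_def by blast
  have K: "0 \<le> K" using lin[OF coeff(1) TT, of 0] by simp
  have Xad: "X t \<in> borel_measurable (F t)" if "t \<in> {0..T}" for t using sde that unfolding sde_solution_def by blast
  have XM: "X t \<in> borel_measurable M" if "t \<in> {0..T}" for t using measurable_F_M[OF Xad[OF that]] that by auto
  have Xc: "AE \<omega> in M. continuous_on {0..T} (\<lambda>t. X t \<omega>)" using sde unfolding sde_solution_def by blast
  define H where "H s \<omega> = \<sigma> s (X s \<omega>)" for s \<omega>
  define B where "B s \<omega> = b s (X s \<omega>)" for s \<omega>
  have "\<forall>t\<in>{0..T}. \<exists>J. ito_integral M F W t H J \<and> (AE \<omega> in M. X t \<omega> = x0 + J \<omega> + (LINT s:{0..t}|lborel. B s \<omega>))"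
    using sde unfolding sde_solution_def H_def[abs_def] B_def by blast
  then obtain J where J: "\<And>t. t \<in> {0..T} \<Longrightarrow> ito_integral M F W t H (J t)"
    "\<And>t. t \<in> {0..T} \<Longrightarrow> AE \<omega> in M. X t \<omega> = x0 + J t \<omega> + (LINT s:{0..t}|lborel. B s \<omega>)" by metis
  have JM: "J t \<in> borel_measurable M" if "t \<in> {0..T}" for t
    using J(1)[OF that] unfolding ito_integral_def converges_in_prob_def by blast
  have Had: "H t \<in> borel_measurable (F t)" if "t \<in> {0..T}" for t
    unfolding H_def using measurable_compose[OF Xad[OF that] sde_coefficient_measurable[OF coeff(1) that]] .
  have Bad: "B t \<in> borel_measurable (F t)" if "t \<in> {0..T}" for t
    unfolding B_def using measurable_compose[OF Xad[OF that] sde_coefficient_measurable[OF coeff(2) that]] .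
  have HM: "H t \<in> borel_measurable M" "B t \<in> borel_measurable M" if "t \<in> {0..T}" for t
    using measurable_F_M[OF Had[OF that]] measurable_F_M[OF Bad[OF that]] that by auto
  have Hc: "AE \<omega> in M. continuous_on {0..T} (\<lambda>t. H t \<omega>)"
    using Xc by eventually_elim (simp add: H_def sde_coefficient_continuous[OF coeff(1)])
  define d where "d N = T / real (Suc N)" for N
  define D where "D N j \<omega> = W (?g N (Suc j)) \<omega> - W (?g N j) \<omega>" for N j \<omega>
  have DM: "D N j \<in> borel_measurable M" if "j < Suc N" for N j
    unfolding D_def using W_measurable gT[of j N] gT[of "Suc j" N] that by (intro borel_measurable_diff) auto
  define Z where "Z N i \<omega> = x0 + (\<Sum>j<i. H (?g N j) \<omega> * D N j \<omega> + B (?g N j) \<omega> * d N)" for N i \<omega>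
  have ZM: "Z N i \<in> borel_measurable M" if "i \<le> Suc N" for N i
    unfolding Z_def using HM gT DM that by (intro borel_measurable_add borel_measurable_sum borel_measurable_times) auto
  define bad where "bad N = {\<omega> \<in> space M. \<exists>i\<in>{..Suc N}. \<bar>X (?g N i) \<omega> - Z N i \<omega>\<bar> > 1}" for N
  have badM: "bad N \<in> events" for N
    unfolding bad_def
  proof (rule sets.sets_Collect_finite_Ex)
    fix i assume "i \<in> {..Suc N}"
    then have i: "i \<le> Suc N" by simp
    from XM[OF gT[OF i]] ZM[OF i] show "{\<omega> \<in> space M. 1 < \<bar>X (?g N i) \<omega> - Z N i \<omega>\<bar>} \<in> events" by measurable
  qed auto
  let ?R = "\<lambda>N. elem_integral (Suc N) (?g N) (\<lambda>j. H (?g N j))"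
  \<comment> \<open>The deviation of \<open>X\<close> from the Riemann sums is split into the
    stochastic part \<open>A1\<close> and the drift part \<open>A2\<close>; each may use half of the
    tolerance 1.\<close>
  define A1 where "A1 N = {\<omega> \<in> space M. \<exists>i\<in>{..Suc N}. \<bar>J (?g N i) \<omega> - ?R N (?g N i) \<omega>\<bar> > 1/2}" for N
  define A2 where "A2 N = {\<omega> \<in> space M. \<exists>i\<in>{..Suc N}. \<bar>X (?g N i) \<omega> - x0 - J (?g N i) \<omega> - (\<Sum>j<i. B (?g N j) \<omega> * d N)\<bar> > 1/2}" for N
  have A1M: "A1 N \<in> events" for N
    unfolding A1_def
  proof (rule sets.sets_Collect_finite_Ex)
    fix i assume "i \<in> {..Suc N}"
    then have i: "i \<le> Suc N" by simp
    have "?R N (?g N i) \<in> borel_measurable M"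
      by (rule elem_integral_measurable[OF PN Had]) (use gT i in auto)
    with JM[OF gT[OF i]] show "{\<omega> \<in> space M. 1 / 2 < \<bar>J (?g N i) \<omega> - ?R N (?g N i) \<omega>\<bar>} \<in> events" by measurable
  qed auto
  have A2M: "A2 N \<in> events" for N
    unfolding A2_def
  proof (rule sets.sets_Collect_finite_Ex)
    fix i assume "i \<in> {..Suc N}"
    then have i: "i \<le> Suc N" by simp
    have [measurable]: "(\<lambda>\<omega>. \<Sum>j<i. B (?g N j) \<omega> * d N) \<in> borel_measurable M"
      using HM gT i by (intro borel_measurable_sum borel_measurable_times) auto
    note [measurable] = JM[OF gT[OF i]] XM[OF gT[OF i]]
    show "{\<omega> \<in> space M. 1 / 2 < \<bar>X (?g N i) \<omega> - x0 - J (?g N i) \<omega> - (\<Sum>j<i. B (?g N j) \<omega> * d N)\<bar>} \<in> events" by measurable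
  qed auto
  have sub: "bad N \<subseteq> A1 N \<union> A2 N" for N
  proof
    fix \<omega> assume "\<omega> \<in> bad N"
    then obtain i where i: "\<omega> \<in> space M" "i \<in> {..Suc N}" "\<bar>X (?g N i) \<omega> - Z N i \<omega>\<bar> > 1" unfolding bad_def by auto
    have "Z N i \<omega> = x0 + ?R N (?g N i) \<omega> + (\<Sum>j<i. B (?g N j) \<omega> * d N)"
      using i(2) by (simp add: Z_def elem_integral_unigrid D_def sum.distrib)
    then have "\<bar>J (?g N i) \<omega> - ?R N (?g N i) \<omega>\<bar> > 1/2 \<or> \<bar>X (?g N i) \<omega> - x0 - J (?g N i) \<omega> - (\<Sum>j<i. B (?g N j) \<omega> * d N)\<bar> > 1/2"
      using i(3) by linarith
    then show "\<omega> \<in> A1 N \<union> A2 N" unfolding A1_def A2_def using i(1,2) by blast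
  qed
  have "(\<lambda>N. prob (A1 N)) \<longlonglongrightarrow> 0"
    unfolding A1_def by (rule riemann_sums_tendsto_ito[OF Hc Had J(1)]) auto
  moreover have "(\<lambda>N. prob (A2 N)) \<longlonglongrightarrow> 0"
  proof (rule prob_tendsto_0_if_AE_eventually[OF A2M])
    \<comment> \<open>The variables \<open>J t\<close> were chosen separately for each
      \<open>t\<close>, so the equation can be used simultaneously only at the countably many grid
      times.\<close>
    have "AE \<omega> in M. \<forall>N. \<forall>i\<in>{..Suc N}. X (?g N i) \<omega> = x0 + J (?g N i) \<omega> + (LINT s:{0..?g N i}|lborel. B s \<omega>)"
      unfolding AE_all_countable
    proof
      fix N
      show "AE \<omega> in M. \<forall>i\<in>{..Suc N}. X (?g N i) \<omega> = x0 + J (?g N i) \<omega> + (LINT s:{0..?g N i}|lborel. B s \<omega>)"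
        using J(2)[OF gT] by (intro AE_finite_allI) auto
    qed
    with Xc show "AE \<omega> in M. \<forall>\<^sub>F N in sequentially. \<omega> \<notin> A2 N"
    proof eventually_elim
      case (elim \<omega>)
      have "continuous_on {0..T} (\<lambda>t. B t \<omega>)" unfolding B_def by (rule sde_coefficient_continuous[OF coeff(2) elim(1)])
      from unigrid_riemann_integral[OF T_pos this, of "1/2"]
      have "eventually (\<lambda>N. \<forall>i\<le>Suc N. \<bar>(LINT s:{0..?g N i}|lborel. B s \<omega>) - (\<Sum>j<i. B (?g N j) \<omega> * d N)\<bar> \<le> 1/2) sequentially"
        by (simp add: d_def)
      then show ?case
      proof eventually_elim
        case e: (elim N)
        show ?case
        proof
          assume "\<omega> \<in> A2 N"
          then obtain i where i: "i \<in> {..Suc N}" "\<bar>X (?g N i) \<omega> - x0 - J (?g N i) \<omega> - (\<Sum>j<i. B (?g N j) \<omega> * d N)\<bar> > 1/2"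
            unfolding A2_def by auto
          have "X (?g N i) \<omega> = x0 + J (?g N i) \<omega> + (LINT s:{0..?g N i}|lborel. B s \<omega>)" using elim(2) i(1) by blast
          moreover have "\<bar>(LINT s:{0..?g N i}|lborel. B s \<omega>) - (\<Sum>j<i. B (?g N j) \<omega> * d N)\<bar> \<le> 1/2" using e i(1) by simp
          ultimately show False using i(2) by simp
        qed
      qed
    qed
  qed
  ultimately have "(\<lambda>N. prob (A1 N) + prob (A2 N)) \<longlonglongrightarrow> 0 + 0" by (intro tendsto_add)
  then have "(\<lambda>N. prob (A1 N) + prob (A2 N)) \<longlonglongrightarrow> 0" by simp
  then have bad0: "(\<lambda>N. prob (bad N)) \<longlonglongrightarrow> 0"
  proof (rule tendsto_sandwich[OF _ _ tendsto_const, rotated 2])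
    have "prob (bad N) \<le> prob (A1 N) + prob (A2 N)" for N
      using finite_measure_mono[OF sub] measure_Un_le[OF A1M A2M] A1M A2M by (meson order_trans sets.Un)
    then show "\<forall>\<^sub>F N in sequentially. prob (bad N) \<le> prob (A1 N) + prob (A2 N)" by simp
  qed simp
  \<comment> \<open>Decided at time \<open>?g N j\<close>. Since \<open>E\<close> decreases in
    \<open>j\<close>, the stopped scheme still equals \<open>Z\<close> as long as \<open>E\<close>
    holds, hence is within 1 of \<open>X\<close>; this turns \<open>1 + |X|\<close> into the
    \<open>2 + |Y|\<close> of the moment lemma.\<close>
  define E where "E N j \<omega> \<longleftrightarrow> (\<forall>k\<in>{..j}. \<bar>X (?g N k) \<omega> - Z N k \<omega>\<bar> \<le> 1)" for N j \<omega>
  define h where "h N j \<omega> = (if E N j \<omega> then H (?g N j) \<omega> else 0)" for N j \<omega>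
  define \<beta> where "\<beta> N j \<omega> = (if E N j \<omega> then B (?g N j) \<omega> else 0)" for N j \<omega>
  define Y where "Y N i \<omega> = x0 + (\<Sum>j<i. h N j \<omega> * (W (?g N (Suc j)) \<omega> - W (?g N j) \<omega>) + \<beta> N j \<omega> * (T / real (Suc N)))" for N i \<omega>
  have YZ: "Y N i \<omega> = Z N i \<omega>" if "\<And>j. j < i \<Longrightarrow> E N j \<omega>" for N i \<omega>
    unfolding Y_def Z_def D_def d_def using that by (simp add: h_def \<beta>_def)
  have Edec: "E N i \<omega>" if "E N j \<omega>" "i \<le> j" for N i j \<omega> using that by (auto simp: E_def)
  have Em: "Measurable.pred (F (?g N j)) (E N j)" if j: "j < Suc N" for N j
  proof -
    have spc: "space (F (?g N j)) = space M" using space_F gT[of j N] j by simp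
    have "{\<omega> \<in> space (F (?g N j)). \<forall>k\<in>{..j}. \<bar>X (?g N k) \<omega> - Z N k \<omega>\<bar> \<le> 1} \<in> sets (F (?g N j))"
    proof (rule sets.sets_Collect_finite_All)
      fix k assume "k \<in> {..j}"
      then have k: "k \<le> j" by simp
      have le: "?g N i \<le> ?g N j" if "i \<le> j" for i using partition_mono[OF PN that] j by simp
      have lift: "f \<in> borel_measurable (F (?g N j))" if "f \<in> borel_measurable (F (?g N i))" "i \<le> j" for f i
        by (rule measurable_F_mono[OF that(1) _ le[OF that(2)]]) (use gT[of i N] gT[of j N] j that(2) in auto)
      have g: "?g N i \<in> {0..T}" if "i \<le> j" for i using gT[of i N] that j by auto
      have [measurable]: "X (?g N k) \<in> borel_measurable (F (?g N j))" by (rule lift[OF Xad[OF g[OF k]] k])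
      have WI: "W (?g N i) \<in> borel_measurable (F (?g N j))" if "i \<le> j" for i by (rule lift[OF adapted_W[OF g[OF that]] that])
      have HI: "H (?g N i) \<in> borel_measurable (F (?g N j))" if "i \<le> j" for i by (rule lift[OF Had[OF g[OF that]] that])
      have BI: "B (?g N i) \<in> borel_measurable (F (?g N j))" if "i \<le> j" for i by (rule lift[OF Bad[OF g[OF that]] that])
      have [measurable]: "Z N k \<in> borel_measurable (F (?g N j))"
        unfolding Z_def D_def using k by (intro borel_measurable_add borel_measurable_sum borel_measurable_times borel_measurable_diff borel_measurable_const WI HI BI) auto
      show "{\<omega> \<in> space (F (?g N j)). \<bar>X (?g N k) \<omega> - Z N k \<omega>\<bar> \<le> 1} \<in> sets (F (?g N j))" by measurable
    qed auto
    then show ?thesis unfolding pred_def E_def .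
  qed
  have hm: "h N j \<in> borel_measurable (F (?g N j))" "\<beta> N j \<in> borel_measurable (F (?g N j))" if j: "j < Suc N" for N j
  proof -
    have "?g N j \<in> {0..T}" using gT j by simp
    note [measurable] = Em[OF j] Had[OF this] Bad[OF this]
    show "h N j \<in> borel_measurable (F (?g N j))" "\<beta> N j \<in> borel_measurable (F (?g N j))"
      unfolding h_def \<beta>_def by measurable
  qed
  have bnd: "\<bar>h N j \<omega>\<bar> \<le> K * (2 + \<bar>Y N j \<omega>\<bar>)" "\<bar>\<beta> N j \<omega>\<bar> \<le> K * (2 + \<bar>Y N j \<omega>\<bar>)" if j: "j < Suc N" for N j \<omega>
  proof -
    have g: "?g N j \<in> {0..T}" using gT j by simp
    have *: "K * (1 + \<bar>X (?g N j) \<omega>\<bar>) \<le> K * (2 + \<bar>Y N j \<omega>\<bar>)" if "E N j \<omega>"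
    proof -
      have "Y N j \<omega> = Z N j \<omega>" by (rule YZ) (use Edec[OF that] in auto)
      moreover have "\<bar>X (?g N j) \<omega> - Z N j \<omega>\<bar> \<le> 1" using that by (auto simp: E_def)
      ultimately show ?thesis using K by (intro mult_left_mono) auto
    qed
    have nn: "0 \<le> K * (2 + \<bar>Y N j \<omega>\<bar>)" using K by simp
    show "\<bar>h N j \<omega>\<bar> \<le> K * (2 + \<bar>Y N j \<omega>\<bar>)"
      using * nn lin[OF coeff(1) g, of "X (?g N j) \<omega>"] by (auto simp: h_def H_def)
    show "\<bar>\<beta> N j \<omega>\<bar> \<le> K * (2 + \<bar>Y N j \<omega>\<bar>)"
      using * nn lin[OF coeff(2) g, of "X (?g N j) \<omega>"] by (auto simp: \<beta>_def B_def)
  qed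
  define n where "n = 2 * m"
  define C where "C = 4 ^ n * (1 + (\<Sum>k\<le>n. real (n choose k) * fact k)) * (1 + K) ^ n"
  define Q where "Q = 2 ^ n * (exp (C * T) * (x0 ^ n + 1))"
  have en: "even n" by (simp add: n_def)
  have XTn: "0 \<le> X T \<omega> ^ n" for \<omega> using en by (simp add: zero_le_even_power)
  note [measurable] = XM[OF TT] badM
  have trunc: "(\<integral>\<omega>. min (X T \<omega> ^ n) (real R) \<partial>M) \<le> Q + real R * prob (bad N)" if N: "T / real (Suc N) \<le> 1" for R N
  proof -
    note mom = euler_type_moment[where m=m and Y="Y N" and g="h N" and \<beta>="\<beta> N" and K=K, folded n_def, folded C_def, OF N K Y_def hm bnd]
    have Ym: "Y N (Suc N) \<in> borel_measurable M" and Yi: "integrable M (\<lambda>\<omega>. Y N (Suc N) \<omega> ^ n)"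
      and Yb: "(\<integral>\<omega>. Y N (Suc N) \<omega> ^ n \<partial>M) + 1 \<le> exp (C * T) * (x0 ^ n + 1)" using mom by blast+
    have ib: "integrable M (\<lambda>\<omega>. real R * indicator (bad N) \<omega>)"
      by (intro integrable_mult_right integrable_real_indicator) (auto simp: emeasure_eq_measure)
    have iy: "integrable M (\<lambda>\<omega>. 2 ^ n * (1 + Y N (Suc N) \<omega> ^ n))" using Yi by simp
    have "(\<integral>\<omega>. min (X T \<omega> ^ n) (real R) \<partial>M) \<le> (\<integral>\<omega>. 2 ^ n * (1 + Y N (Suc N) \<omega> ^ n) + real R * indicator (bad N) \<omega> \<partial>M)"
    proof (rule integral_mono)
      show "integrable M (\<lambda>\<omega>. min (X T \<omega> ^ n) (real R))"
        by (rule integrable_const_bound[of _ "real R"]) (use XTn in auto)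
      show "integrable M (\<lambda>\<omega>. 2 ^ n * (1 + Y N (Suc N) \<omega> ^ n) + real R * indicator (bad N) \<omega>)"
        by (rule Bochner_Integration.integrable_add[OF iy ib])
      fix \<omega> assume \<omega>: "\<omega> \<in> space M"
      have y0: "0 \<le> Y N (Suc N) \<omega> ^ n" using en by (simp add: zero_le_even_power)
      show "min (X T \<omega> ^ n) (real R) \<le> 2 ^ n * (1 + Y N (Suc N) \<omega> ^ n) + real R * indicator (bad N) \<omega>"
      proof (cases "\<omega> \<in> bad N")
        case True then show ?thesis using y0 by (simp add: add_increasing min.coboundedI2)
      next
        case False
        then have E: "E N (Suc N) \<omega>" using \<omega> by (auto simp: bad_def E_def not_less)
        have "Y N (Suc N) \<omega> = Z N (Suc N) \<omega>" by (rule YZ) (use Edec[OF E] in auto)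
        moreover have "\<bar>X T \<omega> - Z N (Suc N) \<omega>\<bar> \<le> 1" using bspec[OF E[unfolded E_def], of "Suc N"] gend[of N] by simp
        ultimately have "\<bar>X T \<omega>\<bar> \<le> 2 * max 1 \<bar>Y N (Suc N) \<omega>\<bar>" by linarith
        then have "X T \<omega> ^ n \<le> (2 * max 1 \<bar>Y N (Suc N) \<omega>\<bar>) ^ n" by (rule even_power_le_mult[OF en])
        also have "\<dots> = 2 ^ n * max 1 \<bar>Y N (Suc N) \<omega>\<bar> ^ n" by (simp add: power_mult_distrib)
        also have "max 1 \<bar>Y N (Suc N) \<omega>\<bar> ^ n \<le> 1 + \<bar>Y N (Suc N) \<omega>\<bar> ^ n" by (auto simp: max_def)
        also have "\<bar>Y N (Suc N) \<omega>\<bar> ^ n = Y N (Suc N) \<omega> ^ n" using en by (simp add: power_even_abs)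
        finally have "X T \<omega> ^ n \<le> 2 ^ n * (1 + Y N (Suc N) \<omega> ^ n)" by simp
        then show ?thesis using False by (simp add: min.coboundedI1)
      qed
    qed
    also have "\<dots> = 2 ^ n * ((\<integral>\<omega>. Y N (Suc N) \<omega> ^ n \<partial>M) + 1) + real R * prob (bad N)"
      using Yi ib iy by (subst Bochner_Integration.integral_add) (auto simp: prob_space)
    also have "\<dots> \<le> Q + real R * prob (bad N)" unfolding Q_def using Yb by simp
    finally show ?thesis .
  qed
  have "eventually (\<lambda>N. T / real (Suc N) \<le> 1) sequentially"
  proof -
    have "(\<lambda>N. T / real (Suc N)) \<longlonglongrightarrow> 0" by (rule LIMSEQ_Suc[OF lim_const_over_n])
    then have "eventually (\<lambda>N. T / real (Suc N) < 1) sequentially" by (rule order_tendstoD(2)) simp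
    then show ?thesis by eventually_elim simp
  qed
  note evN = this
  have "integrable M (\<lambda>\<omega>. X T \<omega> ^ n)"
  proof (rule integrable_if_truncations_bounded[where B=Q])
    fix R :: nat
    have "(\<lambda>N. Q + real R * prob (bad N)) \<longlonglongrightarrow> Q + real R * 0" by (intro tendsto_intros bad0)
    then have "(\<lambda>N. Q + real R * prob (bad N)) \<longlonglongrightarrow> Q" by simp
    then show "(\<integral>\<omega>. min (X T \<omega> ^ n) (real R) \<partial>M) \<le> Q"
    proof (rule tendsto_lowerbound[OF _ _ sequentially_bot])
      show "\<forall>\<^sub>F N in sequentially. (\<integral>\<omega>. min (X T \<omega> ^ n) (real R) \<partial>M) \<le> Q + real R * prob (bad N)"
        using evN by eventually_elim (rule trunc)
    qed
  qed (use XTn in auto)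
  then show ?thesis by (simp add: n_def)
qed

lemma sde_solution_in_Lr:
  assumes "sde_coefficient T K \<alpha> \<sigma>" "sde_coefficient T K \<alpha> b" "sde_solution M F W T \<sigma> b x0 X" "0 \<le> r"
  shows "in_Lr M r (X T)"
proof -
  have TT: "T \<in> {0..T}" using T_pos by simp
  have "\<forall>t\<in>{0..T}. X t \<in> borel_measurable (F t)"
    using assms(3) unfolding sde_solution_def by (rule conjunct1)
  then have "X T \<in> borel_measurable (F T)" using TT by (rule bspec)
  then have [measurable]: "X T \<in> borel_measurable M" by (rule measurable_F_M) (use T_pos in simp_all)
  obtain m :: nat where m: "r \<le> real m" using real_arch_simple by blast
  have le: "\<bar>x\<bar> powr r \<le> 1 + x ^ (2 * m)" for x :: real
  proof (cases "\<bar>x\<bar> \<le> 1")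
    case True
    then have "\<bar>x\<bar> powr r \<le> 1 powr r" using assms(4) by (intro powr_mono2) auto
    moreover have "0 \<le> x ^ (2 * m)" by (simp add: zero_le_even_power)
    ultimately show ?thesis unfolding powr_one_eq_one by linarith
  next
    case False
    then have "\<bar>x\<bar> powr r \<le> \<bar>x\<bar> powr real (2 * m)" using m by (intro powr_mono) auto
    also have "\<dots> = x ^ (2 * m)" using False by (subst powr_realpow) (auto simp: power_even_abs)
    finally show ?thesis by simp
  qed
  have "integrable M (\<lambda>\<omega>. 1 + X T \<omega> ^ (2 * m))" using sde_solution_moments[OF assms(1-3)] by simp
  then have "integrable M (\<lambda>\<omega>. \<bar>X T \<omega>\<bar> powr r)"
    by (rule Bochner_Integration.integrable_bound) (use le in \<open>auto intro: order_trans[OF _ abs_ge_self]\<close>)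
  then show ?thesis unfolding in_Lr_def by simp
qed

end

lemma brownianI:
  assumes "T > 0" "prob_space M" "F = aug_filtration M W" "brownian_motion M F T W"
  shows "brownian M F W T"
proof -
  interpret prob_space M by fact
  have gen: "{W s -` B \<inter> space M | s B. s \<in> {0..t} \<and> B \<in> sets borel} \<union> null_sets M \<subseteq> sets M" if "t \<le> T" for t
    using assms(4) that unfolding brownian_motion_def by (auto intro: measurable_sets)
  have spc: "space (F t) = space M" for t unfolding assms(3) aug_filtration_def by (simp add: space_measure_of_conv)
  have genp: "{W s -` B \<inter> space M | s B. s \<in> {0..t} \<and> B \<in> sets borel} \<union> null_sets M \<subseteq> Pow (space M)" for t
    by (auto dest: sets.sets_into_space)
  have setsF: "sets (F t) = sigma_sets (space M) ({W s -` B \<inter> space M | s B. s \<in> {0..t} \<and> B \<in> sets borel} \<union> null_sets M)" for t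
    unfolding assms(3) aug_filtration_def using genp by (rule sets_measure_of)
  show ?thesis
  proof
    show "0 < T" by fact
    show "space (F t) = space M" for t by (rule spc)
    show "sets (F t) \<subseteq> events" if "t \<in> {0..T}" for t
      unfolding setsF using gen[of t] that by (intro sets.sigma_sets_subset) auto
    show "sets (F s) \<subseteq> sets (F t)" if "0 \<le> s" "s \<le> t" "t \<le> T" for s t
      unfolding setsF
    proof (rule sigma_sets_mono', rule Un_mono[OF _ order_refl])
      show "{W u -` B \<inter> space M | u B. u \<in> {0..s} \<and> B \<in> sets borel}
          \<subseteq> {W u -` B \<inter> space M | u B. u \<in> {0..t} \<and> B \<in> sets borel}" using that by fastforce
    qed
  qed (use assms(4) in \<open>auto simp: brownian_motion_def\<close>)
qed

section \<open>Bump functions and total variation\<close>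

lemma Lr_norm_nonneg: "0 \<le> Lr_norm M r Z"
  by (simp add: Lr_norm_def)

lemma bump_function_measurable:
  assumes "bump_function \<phi>"
  shows "\<phi> \<in> borel_measurable borel"
proof -
  have 1: "\<phi> \<in> borel_measurable (restrict_space borel {..0})"
    using assms by (intro borel_measurable_mono_on_fnc) (simp add: bump_function_def)
  have "mono_on {0<..} (\<lambda>x. - \<phi> x)"
    using assms by (auto simp: bump_function_def monotone_on_def)
  then have "(\<lambda>x. - \<phi> x) \<in> borel_measurable (restrict_space borel {0<..})"
    by (rule borel_measurable_mono_on_fnc)
  then have "(\<lambda>x. - (- \<phi> x)) \<in> borel_measurable (restrict_space borel {0<..})" by measurable
  then have 2: "\<phi> \<in> borel_measurable (restrict_space borel {0<..})" by simp
  show ?thesis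
    by (rule measurable_piecewise_restrict[of "{{..0}, {0<..}}"]) (use 1 2 in auto)
qed

context
  fixes M :: "'a measure" and Z :: "'a \<Rightarrow> real" and C :: "real \<Rightarrow> real" and \<theta> :: real
  assumes \<theta>: "0 < \<theta>"
begin

lemma phi0_bdd_below: "bdd_below ((\<lambda>r. (C r + Lr_norm M r Z) powr (\<theta> * r) / \<bar>z\<bar> powr (\<theta> * r)) ` {1..})"
  by (rule bdd_belowI[of _ 0]) auto

lemma phi0_nonneg: "0 \<le> phi0 M Z C \<theta> z"
  unfolding phi0_def by (auto intro!: cINF_greatest)

lemma phi0_le_1: "phi0 M Z C \<theta> z \<le> 1"
  unfolding phi0_def by auto

lemma phi0_le: "z \<noteq> 0 \<Longrightarrow> 1 \<le> r \<Longrightarrow> phi0 M Z C \<theta> z \<le> (C r + Lr_norm M r Z) powr (\<theta> * r) / \<bar>z\<bar> powr (\<theta> * r)"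
  unfolding phi0_def using cINF_lower[OF phi0_bdd_below[of z], of r] by (auto intro: min.coboundedI2)

lemma phi0_antimono:
  assumes "\<bar>z\<bar> \<le> \<bar>w\<bar>"
  shows "phi0 M Z C \<theta> w \<le> phi0 M Z C \<theta> z"
proof (cases "z = 0")
  case True
  then show ?thesis using phi0_le_1 by (simp add: phi0_def)
next
  case False
  then have w: "w \<noteq> 0" using assms by auto
  have "(INF r\<in>{1..}. (C r + Lr_norm M r Z) powr (\<theta> * r) / \<bar>w\<bar> powr (\<theta> * r))
      \<le> (INF r\<in>{1..}. (C r + Lr_norm M r Z) powr (\<theta> * r) / \<bar>z\<bar> powr (\<theta> * r))"
  proof (rule cINF_mono[OF _ phi0_bdd_below])
    fix r :: real assume "r \<in> {1..}"
    then have "\<bar>z\<bar> powr (\<theta> * r) \<le> \<bar>w\<bar> powr (\<theta> * r)" using assms \<theta> by (intro powr_mono2) auto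
    then show "\<exists>n\<in>{1..}. (C n + Lr_norm M n Z) powr (\<theta> * n) / \<bar>w\<bar> powr (\<theta> * n)
        \<le> (C r + Lr_norm M r Z) powr (\<theta> * r) / \<bar>z\<bar> powr (\<theta> * r)"
      using False w \<open>r \<in> {1..}\<close> by (intro bexI[of _ r] divide_left_mono mult_pos_pos) auto
  qed auto
  then show ?thesis using False w by (simp add: phi0_def min.coboundedI2 min_le_iff_disj)
qed

text \<open>A single exponent in the infimum suffices: with \<open>\<theta> * r\<close> at least
  \<open>k + 1\<close> the product is bounded by a constant over \<open>|z|\<close> as soon as
  \<open>|z| \<ge> 1\<close>. The maximum with 1 keeps \<open>r\<close> in the range of the
  infimum.\<close>

lemma phi0_decay: "((\<lambda>z. \<bar>z\<bar> ^ k * phi0 M Z C \<theta> z) \<longlongrightarrow> 0) at_infinity"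
proof -
  define r where "r = max 1 (real (Suc k) / \<theta>)"
  have r: "1 \<le> r" "real (Suc k) \<le> \<theta> * r"
    using \<theta> by (auto simp: r_def pos_divide_le_eq[symmetric] mult.commute[of \<theta>] le_max_iff_disj)
  define A where "A = (C r + Lr_norm M r Z) powr (\<theta> * r)"
  have "((\<lambda>z::real. A / \<bar>z\<bar>) \<longlongrightarrow> 0) at_infinity"
    by (intro tendsto_divide_0[OF tendsto_const] filterlim_at_top_imp_at_infinity
        filterlim_norm_at_top[where 'a=real, unfolded real_norm_def])
  then show ?thesis
  proof (rule Lim_null_comparison[rotated])
    have "eventually (\<lambda>z::real. 1 \<le> \<bar>z\<bar>) at_infinity"
      unfolding eventually_at_infinity by (auto intro!: exI[of _ 1])
    then show "\<forall>\<^sub>F z in at_infinity. norm (\<bar>z\<bar> ^ k * phi0 M Z C \<theta> z) \<le> A / \<bar>z\<bar>"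
    proof eventually_elim
      case (elim z)
      then have z: "z \<noteq> 0" by auto
      have "\<bar>z\<bar> ^ k * phi0 M Z C \<theta> z \<le> \<bar>z\<bar> ^ k * (A / \<bar>z\<bar> powr (\<theta> * r))"
        unfolding A_def by (intro mult_left_mono phi0_le[OF z r(1)]) auto
      also have "A / \<bar>z\<bar> powr (\<theta> * r) \<le> A / \<bar>z\<bar> powr real (Suc k)"
        using elim r by (intro divide_left_mono powr_mono mult_pos_pos) (auto simp: A_def)
      also have "\<bar>z\<bar> powr real (Suc k) = \<bar>z\<bar> ^ Suc k" using z by (intro powr_realpow) auto
      also have "\<bar>z\<bar> ^ k * (A / \<bar>z\<bar> ^ Suc k) = A / \<bar>z\<bar>" using z by simp
      finally show ?case using phi0_nonneg[of z] by (simp add: mult_left_mono)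
    qed
  qed
qed

end

lemma
  assumes \<theta>: "0 < \<theta>" and \<psi>: "bump_function \<psi>" "decays_faster_than_polynomials \<psi>"
  shows bump_function_phi_bump: "bump_function (phi_bump M Z C \<theta> \<psi>)"
    and phi_bump_decays: "decays_faster_than_polynomials (phi_bump M Z C \<theta> \<psi>)"
proof -
  let ?\<phi> = "phi_bump M Z C \<theta> \<psi>"
  have \<psi>p: "0 < \<psi> z" "\<psi> z \<le> 1" for z using \<psi> by (auto simp: bump_function_def)
  show dec: "decays_faster_than_polynomials ?\<phi>"
    unfolding decays_faster_than_polynomials_def
  proof
    fix k :: nat
    have "((\<lambda>z. \<bar>z\<bar> ^ k * phi0 M Z C \<theta> z + \<bar>z\<bar> ^ k * \<psi> z) \<longlongrightarrow> 0 + 0) at_infinity"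
      using \<psi>(2) by (intro tendsto_add phi0_decay[OF \<theta>]) (simp add: decays_faster_than_polynomials_def)
    then have "((\<lambda>z. \<bar>z\<bar> ^ k * phi0 M Z C \<theta> z + \<bar>z\<bar> ^ k * \<psi> z) \<longlongrightarrow> 0) at_infinity" by simp
    then show "((\<lambda>z. \<bar>z\<bar> ^ k * ?\<phi> z) \<longlongrightarrow> 0) at_infinity"
    proof (rule Lim_null_comparison[rotated], intro always_eventually allI)
      fix z
      have "?\<phi> z \<le> phi0 M Z C \<theta> z + \<psi> z" "0 \<le> ?\<phi> z"
        using phi0_nonneg[OF \<theta>, of M Z C z] \<psi>p[of z] by (auto simp: phi_bump_def)
      then show "norm (\<bar>z\<bar> ^ k * ?\<phi> z) \<le> \<bar>z\<bar> ^ k * phi0 M Z C \<theta> z + \<bar>z\<bar> ^ k * \<psi> z"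
        by (simp add: distrib_left[symmetric] mult_left_mono)
    qed
  qed
  show "bump_function ?\<phi>"
    unfolding bump_function_def
  proof (intro conjI allI)
    fix z
    show "0 < ?\<phi> z" using \<psi>p[of z] by (simp add: phi_bump_def less_max_iff_disj)
    show "?\<phi> z \<le> 1" using \<psi>p[of z] phi0_le_1[OF \<theta>] by (simp add: phi_bump_def)
  next
    show "mono_on {..0} ?\<phi>"
    proof (intro monotone_onI)
      fix x y :: real assume xy: "x \<in> {..0}" "y \<in> {..0}" "x \<le> y"
      have "\<psi> x \<le> \<psi> y" using \<psi>(1) xy by (auto simp: bump_function_def monotone_on_def)
      moreover have "phi0 M Z C \<theta> x \<le> phi0 M Z C \<theta> y" using xy by (intro phi0_antimono[OF \<theta>]) auto
      ultimately show "?\<phi> x \<le> ?\<phi> y" unfolding phi_bump_def by (intro max.mono)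
    qed
    show "antimono_on {0<..} ?\<phi>"
    proof (intro monotone_onI)
      fix x y :: real assume xy: "x \<in> {0<..}" "y \<in> {0<..}" "x \<le> y"
      have "\<psi> y \<le> \<psi> x" using \<psi>(1) xy by (auto simp: bump_function_def monotone_on_def)
      moreover have "phi0 M Z C \<theta> y \<le> phi0 M Z C \<theta> x" using xy by (intro phi0_antimono[OF \<theta>]) auto
      ultimately show "?\<phi> y \<le> ?\<phi> x" unfolding phi_bump_def by (intro max.mono)
    qed
    show "(?\<phi> \<longlongrightarrow> 0) at_infinity"
      using dec unfolding decays_faster_than_polynomials_def by (auto dest: spec[of _ 0])
  qed
qed

text \<open>\<open>measure_of\<close> gives the intended values only once countable additivity is
  checked. Nothing here asks the two measures to be mutually singular, so
  \<open>total_variation\<close> of a pair also serves below as the plain sum of two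
  measures.\<close>

lemma
  assumes "sets (fst \<mu>) = sets borel" "sets (snd \<mu>) = sets borel"
  shows sets_total_variation [simp]: "sets (total_variation \<mu>) = sets borel"
    and emeasure_total_variation:
      "A \<in> sets borel \<Longrightarrow> emeasure (total_variation \<mu>) A = emeasure (fst \<mu>) A + emeasure (snd \<mu>) A"
    and nn_integral_total_variation: "f \<in> borel_measurable borel \<Longrightarrow>
      (\<integral>\<^sup>+x. f x \<partial>total_variation \<mu>) = (\<integral>\<^sup>+x. f x \<partial>fst \<mu>) + (\<integral>\<^sup>+x. f x \<partial>snd \<mu>)"
proof -
  have s: "sigma_sets UNIV (sets borel) = (sets borel :: real set set)"
    using sets.sigma_sets_eq[of "borel :: real measure"] by simp
  show sets: "sets (total_variation \<mu>) = sets borel"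
    unfolding total_variation_def by (subst sets_measure_of) (auto simp: s)
  have "measure_space UNIV (sets borel) (\<lambda>A. emeasure (fst \<mu>) A + emeasure (snd \<mu>) A)"
    unfolding measure_space_def
  proof (intro conjI)
    show "sigma_algebra UNIV (sets (borel :: real measure))"
      using sets.sigma_algebra_axioms[of "borel :: real measure"] by simp
    show "positive (sets borel) (\<lambda>A. emeasure (fst \<mu>) A + emeasure (snd \<mu>) A)" by (simp add: positive_def)
    show "countably_additive (sets borel) (\<lambda>A. emeasure (fst \<mu>) A + emeasure (snd \<mu>) A)"
      unfolding countably_additive_def
    proof (intro allI impI)
      fix A :: "nat \<Rightarrow> real set" assume A: "range A \<subseteq> sets borel" "disjoint_family A"
      have "(\<Sum>i. emeasure (fst \<mu>) (A i) + emeasure (snd \<mu>) (A i)) = (\<Sum>i. emeasure (fst \<mu>) (A i)) + (\<Sum>i. emeasure (snd \<mu>) (A i))"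
        by (intro suminf_add[symmetric] summableI)
      then show "(\<Sum>i. emeasure (fst \<mu>) (A i) + emeasure (snd \<mu>) (A i)) = emeasure (fst \<mu>) (\<Union> (range A)) + emeasure (snd \<mu>) (\<Union> (range A))"
        using A assms by (simp add: suminf_emeasure)
    qed
  qed
  then show em: "emeasure (total_variation \<mu>) A = emeasure (fst \<mu>) A + emeasure (snd \<mu>) A" if "A \<in> sets borel" for A
    unfolding total_variation_def using that by (subst emeasure_measure_of_sigma) (auto simp: measure_space_def)
  have tr: "w \<in> borel_measurable (total_variation \<mu>)" "w \<in> borel_measurable (fst \<mu>)" "w \<in> borel_measurable (snd \<mu>)"
    if "w \<in> borel_measurable borel" for w :: "real \<Rightarrow> ennreal"
    using that unfolding measurable_cong_sets[OF sets refl] measurable_cong_sets[OF assms(1) refl]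
      measurable_cong_sets[OF assms(2) refl] by blast+
  show "(\<integral>\<^sup>+x. f x \<partial>total_variation \<mu>) = (\<integral>\<^sup>+x. f x \<partial>fst \<mu>) + (\<integral>\<^sup>+x. f x \<partial>snd \<mu>)"
    if "f \<in> borel_measurable borel"
    using that
  proof (induct rule: borel_measurable_induct)
    case (cong f g)
    then have "f = g" by (intro ext) simp
    with cong show ?case by simp
  next
    case (set A)
    then show ?case using sets assms em[OF set] by (simp add: nn_integral_indicator)
  next
    case (mult u c)
    show ?case unfolding nn_integral_cmult[OF tr(1)[OF mult(2)]] nn_integral_cmult[OF tr(2)[OF mult(2)]]
      nn_integral_cmult[OF tr(3)[OF mult(2)]] mult(4) by (rule distrib_left)
  next
    case (add u v)
    note m = nn_integral_add[OF tr(1)[OF add(4)] tr(1)[OF add(1)]] nn_integral_add[OF tr(2)[OF add(4)] tr(2)[OF add(1)]]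
      nn_integral_add[OF tr(3)[OF add(4)] tr(3)[OF add(1)]]
    show ?case unfolding m add(3) add(7) by (simp only: ac_simps)
  next
    case (seq U)
    have inc: "incseq (\<lambda>i. \<integral>\<^sup>+x. U i x \<partial>N)" for N
      using seq(4) by (auto simp: incseq_def le_fun_def intro!: nn_integral_mono)
    have e: "(\<integral>\<^sup>+x. (SUP i. U i) x \<partial>N) = (SUP i. \<integral>\<^sup>+x. U i x \<partial>N)" if "\<And>i. U i \<in> borel_measurable N" for N
      using nn_integral_monotone_convergence_SUP[OF seq(4) that] by (simp add: image_comp)
    note m = e[OF tr(1)[OF seq(1)]] e[OF tr(2)[OF seq(1)]] e[OF tr(3)[OF seq(1)]]
    show ?case unfolding m seq(3) by (rule ennreal_SUP_add[OF inc inc])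
  qed
qed

section \<open>Polynomials belong to G\<close>

text \<open>The small power \<open>s\<close> of the bump function is compensated by a large degree:
  a monomial of degree \<open>i\<close> is at most the \<open>s\<close>-th power of
  \<open>|z| ^ k\<close> once \<open>k * s \<ge> i\<close> and \<open>|z| \<ge> 1\<close>.\<close>

lemma poly_times_decaying:
  fixes q :: "real poly"
  assumes pos: "\<And>z. 0 \<le> \<phi> z" and dec: "decays_faster_than_polynomials \<phi>" and s: "0 < s"
  shows "((\<lambda>z. poly q z * \<phi> z powr s) \<longlongrightarrow> 0) at_infinity"
proof -
  have mono: "((\<lambda>z. z ^ i * \<phi> z powr s) \<longlongrightarrow> 0) at_infinity" for i :: nat
  proof -
    obtain k :: nat where k: "real i / s \<le> real k" using real_arch_simple by blast
    have "((\<lambda>z. (\<bar>z\<bar> ^ k * \<phi> z) powr s) \<longlongrightarrow> 0) at_infinity"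
      using dec pos s by (intro tendsto_zero_powrI[OF _ tendsto_const]) (auto simp: decays_faster_than_polynomials_def)
    then show ?thesis
    proof (rule Lim_null_comparison[rotated])
      have "eventually (\<lambda>z::real. 1 \<le> \<bar>z\<bar>) at_infinity"
        unfolding eventually_at_infinity by (auto intro!: exI[of _ 1])
      then show "\<forall>\<^sub>F z in at_infinity. norm (z ^ i * \<phi> z powr s) \<le> (\<bar>z\<bar> ^ k * \<phi> z) powr s"
      proof eventually_elim
        case (elim z)
        then have z: "0 < \<bar>z\<bar>" by auto
        have "\<bar>z\<bar> ^ i = \<bar>z\<bar> powr real i" using z by (simp add: powr_realpow)
        also have "\<dots> \<le> \<bar>z\<bar> powr (real k * s)" using elim k s by (intro powr_mono) (auto simp: pos_divide_le_eq)
        also have "\<dots> = (\<bar>z\<bar> ^ k) powr s" using z by (simp add: powr_powr[symmetric] powr_realpow)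
        finally show ?case using pos[of z] by (simp add: abs_mult power_abs powr_mult mult_right_mono)
      qed
    qed
  qed
  have "((\<lambda>z. \<Sum>i\<le>degree q. coeff q i * (z ^ i * \<phi> z powr s)) \<longlongrightarrow> (\<Sum>i\<le>degree q. coeff q i * 0)) at_infinity"
    by (intro tendsto_sum tendsto_mult_left mono)
  then show ?thesis by (simp add: poly_altdef sum_distrib_right mult.assoc)
qed

lemma integrable_inverse_1_plus_square_lborel: "integrable lborel (\<lambda>x::real. inverse (1 + x\<^sup>2))"
  using integrable_inverse_1_plus_square by (simp add: set_integrable_def)

lemma borel_measurable_poly [measurable]: "poly (q :: real poly) \<in> borel_measurable borel"
  by (intro borel_measurable_continuous_onI continuous_intros)

text \<open>Even after multiplication by the polynomial \<open>1 + z\<^sup>2\<close> the function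
  vanishes at infinity and is bounded on compact sets, which leaves the integrable majorant
  \<open>1 / (1 + z\<^sup>2)\<close>.\<close>

lemma integrable_poly_times_decaying:
  fixes q :: "real poly"
  assumes [measurable]: "\<phi> \<in> borel_measurable borel" and \<phi>: "\<And>z. 0 < \<phi> z" "\<And>z. \<phi> z \<le> 1"
    and dec: "decays_faster_than_polynomials \<phi>" and s: "0 < s"
  shows "integrable lborel (\<lambda>z. \<bar>poly q z\<bar> * \<phi> z powr s)"
proof -
  let ?r = "[:1, 0, 1:] * q"
  have r: "poly ?r z = (1 + z\<^sup>2) * poly q z" for z by (simp add: power2_eq_square algebra_simps)
  have "((\<lambda>z. poly ?r z * \<phi> z powr s) \<longlongrightarrow> 0) at_infinity"
    by (rule poly_times_decaying[OF less_imp_le[OF \<phi>(1)] dec s])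
  then have "eventually (\<lambda>z. dist (poly ?r z * \<phi> z powr s) 0 < 1) at_infinity" by (rule tendstoD) simp
  then obtain R where "\<forall>z. R \<le> norm z \<longrightarrow> dist (poly ?r z * \<phi> z powr s) 0 < 1"
    unfolding eventually_at_infinity by blast
  then have R: "\<bar>poly ?r z * \<phi> z powr s\<bar> \<le> 1" if "R \<le> \<bar>z\<bar>" for z
    using that unfolding dist_0_norm real_norm_def dist_real_def by (simp del: poly_mult add: less_imp_le)
  have "compact (poly ?r ` {-\<bar>R\<bar>..\<bar>R\<bar>})" by (intro compact_continuous_image continuous_intros) auto
  then obtain B where B: "\<And>z. z \<in> {-\<bar>R\<bar>..\<bar>R\<bar>} \<Longrightarrow> \<bar>poly ?r z\<bar> \<le> B" by (fastforce dest!: compact_imp_bounded simp: bounded_iff)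
  have bound: "\<bar>poly q z\<bar> * \<phi> z powr s \<le> max 1 B * inverse (1 + z\<^sup>2)" for z
  proof -
    have "\<bar>poly ?r z * \<phi> z powr s\<bar> \<le> max 1 B"
    proof (cases "R \<le> \<bar>z\<bar>")
      case False
      then have "\<bar>poly ?r z\<bar> \<le> B" by (intro B) auto
      moreover have "\<phi> z powr s \<le> 1" using \<phi>[of z] s powr_mono2[of s "\<phi> z" 1] by simp
      moreover have "0 \<le> \<phi> z powr s" by simp
      ultimately have "\<bar>poly ?r z\<bar> * \<phi> z powr s \<le> B * 1" by (intro mult_mono) auto
      then show ?thesis by (simp add: abs_mult del: poly_mult)
    qed (use R in \<open>auto simp: le_max_iff_disj\<close>)
    then have "(1 + z\<^sup>2) * (\<bar>poly q z\<bar> * \<phi> z powr s) \<le> max 1 B"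
      unfolding r by (simp add: abs_mult mult.assoc)
    moreover have "0 < 1 + z\<^sup>2" by (simp add: add_pos_nonneg)
    ultimately show ?thesis by (simp add: field_simps)
  qed
  show ?thesis
  proof (rule Bochner_Integration.integrable_bound)
    show "integrable lborel (\<lambda>z::real. max 1 B * inverse (1 + z\<^sup>2))"
      by (intro integrable_mult_right integrable_inverse_1_plus_square_lborel)
    show "AE z in lborel. norm (\<bar>poly q z\<bar> * \<phi> z powr s) \<le> norm (max 1 B * inverse (1 + z\<^sup>2))"
      using bound by (intro AE_I2) (auto simp: abs_mult intro: order_trans[OF _ abs_ge_self])
  qed measurable
qed

lemma sigma_finite_density_real: "sigma_finite_measure (density lborel (\<lambda>x::real. ennreal (w x)))"
  if "w \<in> borel_measurable borel" for w :: "real \<Rightarrow> real"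
  using sigma_finite_measure.sigma_finite_iff_density_finite[OF sigma_finite_lborel, of "\<lambda>x. ennreal (w x)"] that by simp

lemma poly_in_G_class:
  fixes q :: "real poly"
  assumes [measurable]: "\<phi> \<in> borel_measurable borel" and \<phi>: "\<And>z. 0 < \<phi> z" "\<And>z. \<phi> z \<le> 1"
    and dec: "decays_faster_than_polynomials \<phi>" and p: "1 \<le> p"
  shows "poly q \<in> G_class p \<phi>"
proof -
  define sg where "sg z = (if z > 0 then 1 else -1 :: real)" for z :: real
  define w where "w z = sg z * poly (pderiv q) z / \<phi> z" for z
  \<comment> \<open>\<open>ennreal\<close> sends negative reals to 0, so these densities are the
    positive and the negative part of \<open>w\<close>.\<close>
  define \<mu> where "\<mu> = (density lborel (\<lambda>z. ennreal (w z)), density lborel (\<lambda>z. ennreal (- w z)))"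
  have [measurable]: "sg \<in> borel_measurable borel" unfolding sg_def by measurable
  have [measurable]: "w \<in> borel_measurable borel" unfolding w_def by measurable
  have sets: "sets (fst \<mu>) = sets borel" "sets (snd \<mu>) = sets borel" by (auto simp: \<mu>_def)
  have tv: "total_variation \<mu> = density lborel (\<lambda>z. ennreal \<bar>w z\<bar>)"
  proof (rule measure_eqI)
    fix A assume "A \<in> sets (total_variation \<mu>)"
    then have A[measurable]: "A \<in> sets borel" by (simp add: sets)
    have "emeasure (total_variation \<mu>) A = (\<integral>\<^sup>+z. ennreal (w z) * indicator A z \<partial>lborel) + (\<integral>\<^sup>+z. ennreal (- w z) * indicator A z \<partial>lborel)"
      using emeasure_total_variation[OF sets A] by (simp add: \<mu>_def emeasure_density)
    also have "\<dots> = (\<integral>\<^sup>+z. ennreal (w z) * indicator A z + ennreal (- w z) * indicator A z \<partial>lborel)"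
      by (rule nn_integral_add[symmetric]) measurable
    also have "\<dots> = (\<integral>\<^sup>+z. ennreal \<bar>w z\<bar> * indicator A z \<partial>lborel)"
    proof (rule nn_integral_cong)
      fix z
      have "ennreal (w z) + ennreal (- w z) = ennreal \<bar>w z\<bar>" by (cases "0 \<le> w z") (auto simp: ennreal_neg)
      then show "ennreal (w z) * indicator A z + ennreal (- w z) * indicator A z = ennreal \<bar>w z\<bar> * indicator A z"
        by (simp add: distrib_right[symmetric])
    qed
    finally show "emeasure (total_variation \<mu>) A = emeasure (density lborel (\<lambda>z. ennreal \<bar>w z\<bar>)) A"
      by (simp add: emeasure_density)
  qed (simp add: sets)
  have w\<phi>: "w z * \<phi> z = sg z * poly (pderiv q) z" for z using \<phi>(1)[of z] by (simp add: w_def)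
  have absw: "\<bar>w z\<bar> = \<bar>poly (pderiv q) z\<bar> / \<phi> z" for z
    using \<phi>(1)[of z] by (simp add: w_def sg_def abs_mult)
  have "\<mu> \<in> M_class p \<phi>"
    unfolding M_class_def signed_sigma_finite_def
  proof (intro CollectI conjI allI impI)
    show "sets (fst \<mu>) = sets borel" "sets (snd \<mu>) = sets borel" by fact+
    show "\<exists>P\<in>sets borel. emeasure (fst \<mu>) (- P) = 0 \<and> emeasure (snd \<mu>) P = 0"
    proof (intro bexI[of _ "{z. 0 \<le> w z}"] conjI)
      have [measurable]: "{z. 0 \<le> w z} \<in> sets borel" by measurable
      then show "{z. 0 \<le> w z} \<in> sets borel" .
      have "emeasure (fst \<mu>) (- {z. 0 \<le> w z}) = (\<integral>\<^sup>+z. ennreal (w z) * indicator (- {z. 0 \<le> w z}) z \<partial>lborel)"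
        unfolding \<mu>_def by (simp add: emeasure_density)
      also have "\<dots> = (\<integral>\<^sup>+z. 0 \<partial>(lborel :: real measure))" by (intro nn_integral_cong) (auto simp: indicator_def ennreal_neg)
      finally show "emeasure (fst \<mu>) (- {z. 0 \<le> w z}) = 0" by simp
      have "emeasure (snd \<mu>) {z. 0 \<le> w z} = (\<integral>\<^sup>+z. ennreal (- w z) * indicator {z. 0 \<le> w z} z \<partial>lborel)"
        unfolding \<mu>_def by (simp add: emeasure_density)
      also have "\<dots> = (\<integral>\<^sup>+z. 0 \<partial>(lborel :: real measure))" by (intro nn_integral_cong) (auto simp: indicator_def ennreal_neg)
      finally show "emeasure (snd \<mu>) {z. 0 \<le> w z} = 0" by simp
    qed
    show "sigma_finite_measure (total_variation \<mu>)" unfolding tv by (rule sigma_finite_density_real) measurable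
    show "set_integrable (total_variation \<mu>) K \<phi>" if K: "compact K" for K
    proof -
      have [measurable]: "K \<in> sets borel" using K by (intro borel_compact)
      have "set_integrable lborel K (\<lambda>z. \<bar>poly (pderiv q) z\<bar>)"
        unfolding set_integrable_def by (rule borel_integrable_compact[OF K]) (intro continuous_intros)
      moreover have "(\<lambda>z. \<bar>w z\<bar> *\<^sub>R (indicator K z *\<^sub>R \<phi> z)) = (\<lambda>z. indicator K z *\<^sub>R \<bar>poly (pderiv q) z\<bar>)"
        using \<phi>(1) by (intro ext) (simp add: absw less_imp_neq[symmetric])
      ultimately show ?thesis unfolding tv set_integrable_def by (subst integrable_density) auto
    qed
    \<comment> \<open>The division by \<phi> in \<open>w\<close> consumes one power of the weight;
      the remaining power \<open>1 / p\<close> still decays faster than any polynomial.\<close>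
    have "integrable lborel (\<lambda>z. \<bar>poly (pderiv q) z\<bar> * \<phi> z powr (1 / p))"
      using p by (intro integrable_poly_times_decaying[OF _ \<phi> dec]) auto
    moreover have "(\<lambda>z. \<bar>w z\<bar> *\<^sub>R \<phi> z powr (1 + 1 / p)) = (\<lambda>z. \<bar>poly (pderiv q) z\<bar> * \<phi> z powr (1 / p))"
      using \<phi>(1) by (intro ext) (simp add: absw powr_add less_imp_neq[symmetric] less_imp_le)
    ultimately show "integrable (total_variation \<mu>) (\<lambda>z. \<phi> z powr (1 + 1 / p))"
      unfolding tv by (subst integrable_density) auto
  qed
  moreover have "poly q = (\<lambda>x. poly q 0 + g_meas \<phi> \<mu> x + g_jump \<phi> real (\<lambda>_. 0) x)"
  proof
    fix x
    have si: "signed_integral \<mu> A \<phi> = (\<integral>z. indicator A z * (sg z * poly (pderiv q) z) \<partial>lborel)"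
      if [measurable]: "A \<in> sets borel" and int: "integrable lborel (\<lambda>z. indicator A z * poly (pderiv q) z)" for A
    proof -
      have d: "density lborel (\<lambda>z. ennreal (v z)) = density lborel (\<lambda>z. ennreal (max 0 (v z)))" for v :: "real \<Rightarrow> real"
        by (simp add: ennreal_max_0)
      have i: "integrable lborel (\<lambda>z. max 0 (c * w z) *\<^sub>R (indicator A z *\<^sub>R \<phi> z))" if c: "\<bar>c\<bar> = 1" for c
      proof (rule Bochner_Integration.integrable_bound[OF int])
        show "AE z in lborel. norm (max 0 (c * w z) *\<^sub>R indicator A z *\<^sub>R \<phi> z) \<le> norm (indicator A z * poly (pderiv q) z)"
        proof (rule AE_I2)
          fix z
          have "max 0 (c * w z) \<le> \<bar>w z\<bar>" using c abs_ge_self[of "c * w z"] by (simp add: abs_mult)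
          then have "max 0 (c * w z) * \<phi> z \<le> \<bar>w z\<bar> * \<phi> z" using \<phi>(1)[of z] by (intro mult_right_mono) auto
          also have "\<dots> = \<bar>poly (pderiv q) z\<bar>" using \<phi>(1)[of z] by (simp add: absw)
          finally show "norm (max 0 (c * w z) *\<^sub>R indicator A z *\<^sub>R \<phi> z) \<le> norm (indicator A z * poly (pderiv q) z)"
            using \<phi>(1)[of z] by (auto simp: indicator_def abs_mult)
        qed
      qed measurable
      have f: "(LINT z:A|fst \<mu>. \<phi> z) = (\<integral>z. max 0 (w z) *\<^sub>R (indicator A z *\<^sub>R \<phi> z) \<partial>lborel)"
        unfolding \<mu>_def fst_conv set_lebesgue_integral_def d[of w] by (subst integral_density) auto
      have s: "(LINT z:A|snd \<mu>. \<phi> z) = (\<integral>z. max 0 (- w z) *\<^sub>R (indicator A z *\<^sub>R \<phi> z) \<partial>lborel)"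
        unfolding \<mu>_def snd_conv set_lebesgue_integral_def d[of "\<lambda>z. - w z"] by (subst integral_density) auto
      have "signed_integral \<mu> A \<phi> = (\<integral>z. max 0 (w z) *\<^sub>R (indicator A z *\<^sub>R \<phi> z) - max 0 (- w z) *\<^sub>R (indicator A z *\<^sub>R \<phi> z) \<partial>lborel)"
        unfolding signed_integral_def f s using i[of 1] i[of "-1"]
        by (subst Bochner_Integration.integral_diff) auto
      also have "\<dots> = (\<integral>z. indicator A z * (sg z * poly (pderiv q) z) \<partial>lborel)"
      proof (rule Bochner_Integration.integral_cong[OF refl])
        fix z
        have "max 0 (w z) *\<^sub>R (indicator A z *\<^sub>R \<phi> z) - max 0 (- w z) *\<^sub>R (indicator A z *\<^sub>R \<phi> z) = indicator A z * (w z * \<phi> z)"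
          by (auto simp: max_def algebra_simps)
        then show "max 0 (w z) *\<^sub>R (indicator A z *\<^sub>R \<phi> z) - max 0 (- w z) *\<^sub>R (indicator A z *\<^sub>R \<phi> z) = indicator A z * (sg z * poly (pderiv q) z)"
          by (simp only: w\<phi>)
      qed
      finally show ?thesis .
    qed
    have ftc: "has_bochner_integral lborel (\<lambda>z. poly (pderiv q) z * indicator {a..b} z) (poly q b - poly q a)" if "a \<le> b" for a b
      by (rule has_bochner_integral_FTC_Icc_real[OF that]) (auto intro!: poly_DERIV continuous_intros)
    have half: "has_bochner_integral lborel (\<lambda>z. indicator {a<..b} z * poly (pderiv q) z) (poly q b - poly q a)" if "a \<le> b" for a b
    proof (rule has_bochner_integral_cong_AE[THEN iffD1, OF _ _ _ ftc[OF that]])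
      have "AE z in lborel. z \<noteq> (a::real)" by (rule AE_lborel_singleton)
      then show "AE z in lborel. poly (pderiv q) z * indicator {a..b} z = indicator {a<..b} z * poly (pderiv q) z"
        by eventually_elim (auto simp: indicator_def)
    qed measurable
    have "g_jump \<phi> real (\<lambda>_. 0) x = 0" by (simp add: g_jump_def)
    moreover have "g_meas \<phi> \<mu> x = poly q x - poly q 0"
    proof (cases "0 \<le> x")
      case True
      have "(\<integral>z. indicator {0<..x} z * (sg z * poly (pderiv q) z) \<partial>lborel) = (\<integral>z. indicator {0<..x} z * poly (pderiv q) z \<partial>lborel)"
        by (intro Bochner_Integration.integral_cong) (auto simp: indicator_def sg_def)
      then show ?thesis using True si[of "{0<..x}"] half[OF True]
        by (simp add: g_meas_def has_bochner_integral_iff)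
    next
      case False
      then have x0: "x \<le> 0" by simp
      have "(\<integral>z. indicator {x<..0} z * (sg z * poly (pderiv q) z) \<partial>lborel) = (\<integral>z. - (indicator {x<..0} z * poly (pderiv q) z) \<partial>lborel)"
        by (intro Bochner_Integration.integral_cong) (auto simp: indicator_def sg_def)
      then show ?thesis using False si[of "{x<..0}"] half[OF x0]
        by (simp add: g_meas_def has_bochner_integral_iff)
    qed
    ultimately show "poly q x = poly q 0 + g_meas \<phi> \<mu> x + g_jump \<phi> real (\<lambda>_. 0) x" by simp
  qed
  ultimately have "G_decomp p \<phi> (poly q) (poly q 0) \<mu> real (\<lambda>_. 0)"
    unfolding G_decomp_def by (auto simp: inj_on_def)
  then show ?thesis unfolding G_class_def by blast
qed

section \<open>Uniqueness of the decomposition\<close>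

definition locally_finite :: "real measure \<Rightarrow> bool" where
  "locally_finite m \<longleftrightarrow> sets m = sets borel \<and> (\<forall>r. emeasure m {- r..r} \<noteq> \<infinity>)"

lemma locally_finite_bounded:
  assumes m: "locally_finite m" and A: "A \<subseteq> {- r..r}"
  shows "emeasure m A \<noteq> \<infinity>"
proof -
  have "{- r..r} \<in> sets m" using m by (simp add: locally_finite_def)
  then have "emeasure m A \<le> emeasure m {- r..r}" by (rule emeasure_mono[OF A])
  then show ?thesis using m by (auto simp: locally_finite_def top_unique)
qed

text \<open>A distribution function in the sign convention of \<open>g_meas\<close>, positive on
  both half-lines. It is therefore monotone on each half-line separately, in opposite
  directions.\<close>

definition ray_measure :: "real measure \<Rightarrow> real \<Rightarrow> real" where
  "ray_measure m x = (if 0 \<le> x then measure m {0<..x} else measure m {x<..0})"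

text \<open>On the right half-line the intervals decrease to their limit, on the left one they
  increase to it, because their moving end is open there. Right continuity is what separates the
  measure part from the jump part, which lives on a countable set.\<close>

lemma ray_measure_right_continuous:
  assumes m: "locally_finite m"
  shows "(ray_measure m \<longlongrightarrow> ray_measure m x) (at_right x)"
proof (cases "0 \<le> x")
  case True
  show ?thesis
  proof (rule tendsto_at_right_sequentially[of x "x + 1"])
    fix S :: "nat \<Rightarrow> real" assume S: "\<And>n. x < S n" "\<And>n. S n < x + 1" "decseq S" "S \<longlonglongrightarrow> x"
    have "(\<lambda>n. measure m {0<..S n}) \<longlonglongrightarrow> measure m (\<Inter>n. {0<..S n})"
    proof (rule Lim_measure_decseq)
      show "range (\<lambda>n. {0<..S n}) \<subseteq> sets m" using m by (auto simp: locally_finite_def)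
      show "decseq (\<lambda>n. {0<..S n})"
      proof (unfold decseq_def, intro allI impI)
        fix i j :: nat assume "i \<le> j"
        from decseqD[OF S(3) this] show "{0<..S j} \<subseteq> {0<..S i}" by auto
      qed
      show "emeasure m {0<..S n} \<noteq> \<infinity>" for n
        by (rule locally_finite_bounded[OF m, of _ "\<bar>S n\<bar>"]) auto
    qed
    moreover have "(\<Inter>n. {0<..S n}) = {0<..x}"
    proof (intro set_eqI iffI)
      fix y assume "y \<in> (\<Inter>n. {0<..S n})"
      then have "0 < y" "\<And>n. y \<le> S n" by auto
      moreover from this(2) have "y \<le> x" by (intro LIMSEQ_le_const[OF S(4)]) auto
      ultimately show "y \<in> {0<..x}" by simp
    next
      fix y assume y: "y \<in> {0<..x}"
      show "y \<in> (\<Inter>n. {0<..S n})"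
      proof (rule INT_I)
        fix n show "y \<in> {0<..S n}" using y S(1)[of n] by simp
      qed
    qed
    moreover have "0 \<le> S n" for n using True S(1)[of n] by simp
    ultimately show "(\<lambda>n. ray_measure m (S n)) \<longlonglongrightarrow> ray_measure m x"
      using True by (simp add: ray_measure_def)
  qed simp
next
  case False
  show ?thesis
  proof (rule tendsto_at_right_sequentially[of x 0])
    show "x < 0" using False by simp
    fix S :: "nat \<Rightarrow> real" assume S: "\<And>n. x < S n" "\<And>n. S n < 0" "decseq S" "S \<longlonglongrightarrow> x"
    have un: "(\<Union>n. {S n<..0}) = {x<..0}"
    proof (intro set_eqI iffI)
      fix y assume y: "y \<in> {x<..0}"
      then have "eventually (\<lambda>n. S n < y) sequentially" by (intro order_tendstoD(2)[OF S(4)]) auto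
      then obtain n where "S n < y" by (auto simp: eventually_sequentially)
      then show "y \<in> (\<Union>n. {S n<..0})" using y by auto
    next
      fix y assume "y \<in> (\<Union>n. {S n<..0})"
      then obtain n where "S n < y" "y \<le> 0" by auto
      then show "y \<in> {x<..0}" using S(1)[of n] by simp
    qed
    have "(\<lambda>n. measure m {S n<..0}) \<longlonglongrightarrow> measure m (\<Union>n. {S n<..0})"
    proof (rule Lim_measure_incseq)
      show "range (\<lambda>n. {S n<..0}) \<subseteq> sets m" using m by (auto simp: locally_finite_def)
      show "incseq (\<lambda>n. {S n<..0})"
      proof (unfold incseq_def, intro allI impI)
        fix i j :: nat assume "i \<le> j"
        from decseqD[OF S(3) this] show "{S i<..0} \<subseteq> {S j<..0}" by auto
      qed
      show "emeasure m (\<Union>n. {S n<..0}) \<noteq> \<infinity>" unfolding un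
        by (rule locally_finite_bounded[OF m, of _ "\<bar>x\<bar>"]) auto
    qed
    moreover have "\<not> 0 \<le> S n" for n using S(2)[of n] by simp
    ultimately show "(\<lambda>n. ray_measure m (S n)) \<longlonglongrightarrow> ray_measure m x"
      unfolding un using False by (simp add: ray_measure_def)
  qed
qed

lemma measure_Ioc_eq_ray_measure:
  assumes m: "locally_finite m" and ab: "a \<le> b"
  shows "measure m {a<..b} = (if 0 \<le> b then 1 else -1) * ray_measure m b - (if 0 \<le> a then 1 else -1) * ray_measure m a"
proof -
  have split: "measure m {x<..z} = measure m {x<..y} + measure m {y<..z}" if "x \<le> y" "y \<le> z" for x y z
  proof -
    have "{x<..z} = {x<..y} \<union> {y<..z}" using that by auto
    moreover have "measure m ({x<..y} \<union> {y<..z}) = measure m {x<..y} + measure m {y<..z}"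
    proof (rule measure_Union)
      show "emeasure m {x<..y} \<noteq> \<infinity>" by (rule locally_finite_bounded[OF m, of _ "\<bar>x\<bar> + \<bar>y\<bar>"]) auto
      show "emeasure m {y<..z} \<noteq> \<infinity>" by (rule locally_finite_bounded[OF m, of _ "\<bar>y\<bar> + \<bar>z\<bar>"]) auto
    qed (use m in \<open>auto simp: locally_finite_def\<close>)
    ultimately show ?thesis by simp
  qed
  consider "0 \<le> a" | "a < 0" "0 \<le> b" | "b < 0" by linarith
  then show ?thesis
  proof cases
    case 1 then show ?thesis using split[of 0 a b] ab by (simp add: ray_measure_def)
  next
    case 2 then show ?thesis using split[of a 0 b] by (simp add: ray_measure_def)
  next
    case 3 then show ?thesis using split[of a b 0] ab by (simp add: ray_measure_def)
  qed
qed

lemma locally_finite_total_variation: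
  assumes "locally_finite m" "locally_finite n"
  shows "locally_finite (total_variation (m, n))"
proof -
  have s: "sets (fst (m, n)) = sets borel" "sets (snd (m, n)) = sets borel" using assms by (auto simp: locally_finite_def)
  show ?thesis unfolding locally_finite_def using assms emeasure_total_variation[OF s] sets_total_variation[OF s]
    by (simp add: locally_finite_def)
qed

lemma locally_finite_eqI:
  assumes m: "locally_finite m" and n: "locally_finite n"
    and eq: "\<And>a b. a \<le> b \<Longrightarrow> measure m {a<..b} = measure n {a<..b}"
  shows "m = n"
proof (rule measure_eqI_generator_eq[where E="range (\<lambda>(a, b). {a<..b::real})" and \<Omega>=UNIV and A="\<lambda>i. {- real i<..real i}"])
  have b: "sets borel = sigma_sets UNIV (range (\<lambda>(a, b). {a<..b::real}))"
    by (subst borel_sigma_sets_Ioc) simp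
  show "sets m = sigma_sets UNIV (range (\<lambda>(a, b). {a<..b::real}))"
    "sets n = sigma_sets UNIV (range (\<lambda>(a, b). {a<..b::real}))"
    using m n b by (auto simp: locally_finite_def)
  show "Int_stable (range (\<lambda>(a, b). {a<..b::real}))"
  proof (rule Int_stableI)
    fix A B assume "A \<in> range (\<lambda>(a, b). {a<..b::real})" "B \<in> range (\<lambda>(a, b). {a<..b::real})"
    then obtain a b c d where "A = {a<..b}" "B = {c<..d}" by auto
    then have "A \<inter> B = (\<lambda>(a, b). {a<..b}) (max a c, min b d)" by auto
    then show "A \<inter> B \<in> range (\<lambda>(a, b). {a<..b::real})" by (rule range_eqI)
  qed
  have fin: "emeasure k {a<..b} \<noteq> \<infinity>" if "locally_finite k" for k a b
    by (rule locally_finite_bounded[OF that, of _ "\<bar>a\<bar> + \<bar>b\<bar>"]) auto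
  fix X assume "X \<in> range (\<lambda>(a, b). {a<..b::real})"
  then obtain a b where X: "X = {a<..b}" by auto
  show "emeasure m X = emeasure n X"
  proof (cases "a \<le> b")
    case True
    then show ?thesis unfolding X using eq[OF True] fin[OF m] fin[OF n] by (simp add: emeasure_eq_ennreal_measure)
  qed (simp add: X)
next
  show "(\<Union>i. {- real i<..real i}) = UNIV"
  proof (intro set_eqI iffI UNIV_I)
    fix x :: real
    obtain i :: nat where "\<bar>x\<bar> < real i" using reals_Archimedean2 by blast
    then show "x \<in> (\<Union>i. {- real i<..real i})" by (intro UN_I[of i]) auto
  qed
  show "emeasure m {- real i<..real i} \<noteq> \<infinity>" for i
    by (rule locally_finite_bounded[OF m, of _ "real i"]) auto
  show "range (\<lambda>i. {- real i<..real i}) \<subseteq> range (\<lambda>(a, b). {a<..b::real})" by auto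
qed auto

text \<open>Both decompositions live on complementary sets, so the common refinement of the two Hahn
  decompositions splits the line into four pieces, on each of which the claim is immediate.\<close>

lemma jordan_total_variation_unique:
  fixes m n m' n' :: "real measure"
  assumes s: "sets m = sets borel" "sets n = sets borel" "sets m' = sets borel" "sets n' = sets borel"
    and P: "P \<in> sets borel" "emeasure m (- P) = 0" "emeasure n P = 0"
    and Q: "Q \<in> sets borel" "emeasure m' (- Q) = 0" "emeasure n' Q = 0"
    and eq: "total_variation (m, n') = total_variation (n, m')"
  shows "total_variation (m, n) = total_variation (m', n')"
proof (rule measure_eqI)
  show "sets (total_variation (m, n)) = sets (total_variation (m', n'))" using s by simp
  fix A assume "A \<in> sets (total_variation (m, n))"
  then have A: "A \<in> sets borel" using s by simp
  \<comment> \<open>This is the equality of \<open>m - n\<close> and \<open>m' - n'\<close> with the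
    negative parts moved across, so that no difference of infinite values arises. On each of the
    four pieces two of the four measures vanish.\<close>
  have e: "emeasure m X + emeasure n' X = emeasure n X + emeasure m' X" if X: "X \<in> sets borel" for X
    using arg_cong[OF eq, of "\<lambda>t. emeasure t X"] emeasure_total_variation[of "(m, n')" X] emeasure_total_variation[of "(n, m')" X] s X by simp
  have z: "emeasure k X = 0" if "emeasure k Y = 0" "X \<subseteq> Y" "Y \<in> sets borel" "sets k = sets borel" for k :: "real measure" and X Y
    using emeasure_mono[OF that(2), of k] that by simp
  have Pc: "- P \<in> sets borel" "- Q \<in> sets borel" using P Q by auto
  have piece: "emeasure m X + emeasure n X = emeasure m' X + emeasure n' X"
    if X: "X \<in> sets borel" "X \<subseteq> P \<or> X \<subseteq> - P" "X \<subseteq> Q \<or> X \<subseteq> - Q" for X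
    using X(2,3) e[OF X(1)] z[OF P(2) _ Pc(1) s(1)] z[OF P(3) _ P(1) s(2)] z[OF Q(2) _ Pc(2) s(3)] z[OF Q(3) _ Q(1) s(4)]
    by (elim disjE) auto
  have split: "emeasure k A = emeasure k (A \<inter> P \<inter> Q) + emeasure k (A \<inter> P \<inter> - Q) + emeasure k (A \<inter> - P \<inter> Q) + emeasure k (A \<inter> - P \<inter> - Q)"
    if k: "sets k = sets borel" for k :: "real measure"
  proof -
    have sp: "emeasure k B = emeasure k (B \<inter> R) + emeasure k (B \<inter> - R)" if "B \<in> sets borel" "R \<in> sets borel" for B R
      using plus_emeasure[of "B \<inter> R" k "B \<inter> - R"] that k by (simp add: Int_Un_distrib[symmetric] disjoint_iff)
    show ?thesis using sp[OF A P(1)] sp[of "A \<inter> P" Q] sp[of "A \<inter> - P" Q] A P(1) Q(1) Pc by (simp add: add.assoc)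
  qed
  have "emeasure m A + emeasure n A = emeasure m' A + emeasure n' A"
  proof -
    have re: "(a1 + a2 + a3 + a4) + (b1 + b2 + b3 + b4) = (a1 + b1) + (a2 + b2) + (a3 + b3) + (a4 + b4)"
      for a1 a2 a3 a4 b1 b2 b3 b4 :: ennreal by (simp only: ac_simps)
    have b: "A \<inter> P \<inter> Q \<in> sets borel" "A \<inter> P \<inter> - Q \<in> sets borel" "A \<inter> - P \<inter> Q \<in> sets borel" "A \<inter> - P \<inter> - Q \<in> sets borel"
      using A P(1) Q(1) Pc by auto
    have p: "emeasure m X + emeasure n X = emeasure m' X + emeasure n' X"
      if "X \<in> {A \<inter> P \<inter> Q, A \<inter> P \<inter> - Q, A \<inter> - P \<inter> Q, A \<inter> - P \<inter> - Q}" for X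
      by (rule piece) (use that b in auto)
    show ?thesis unfolding split[OF s(1)] split[OF s(2)] split[OF s(3)] split[OF s(4)] re
      using p by simp
  qed
  then show "emeasure (total_variation (m, n)) A = emeasure (total_variation (m', n')) A"
    using emeasure_total_variation[of "(m, n)" A] emeasure_total_variation[of "(m', n')" A] s A by simp
qed

section \<open>The weighted parts of a signed measure and the value of V\<close>

lemma borel_measurable_if_sets_borel:
  assumes "sets N = sets borel" "f \<in> borel_measurable borel"
  shows "f \<in> borel_measurable N"
  using assms(2) unfolding measurable_cong_sets[OF assms(1) refl] .

text \<open>Parts of \<phi>\<mu> instead of \<mu>: local integrability of \<phi> makes them locally
  finite, and \<open>g_meas\<close> sees \<mu> only through them.\<close>

definition pos_part :: "(real \<Rightarrow> real) \<Rightarrow> signed_measure \<Rightarrow> real measure" where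
  "pos_part \<phi> \<mu> = density (fst \<mu>) (\<lambda>x. ennreal (\<phi> x))"

definition neg_part :: "(real \<Rightarrow> real) \<Rightarrow> signed_measure \<Rightarrow> real measure" where
  "neg_part \<phi> \<mu> = density (snd \<mu>) (\<lambda>x. ennreal (\<phi> x))"

text \<open>No finiteness is assumed: if the mass is infinite, the Bochner integral and
  \<open>measure\<close> both take the default value 0.\<close>

lemma set_integral_eq_measure_density:
  assumes N: "sets N = sets borel" and [measurable]: "\<phi> \<in> borel_measurable borel" and nn: "\<And>x. 0 \<le> \<phi> x" and A: "A \<in> sets borel"
  shows "(LINT x:A|N. \<phi> x) = measure (density N (\<lambda>x. ennreal (\<phi> x))) A"
proof -
  have m: "\<phi> \<in> borel_measurable N" by (rule borel_measurable_if_sets_borel[OF N]) measurable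
  have [measurable]: "A \<in> sets N" using N A by simp
  note [measurable] = m
  have "(LINT x:A|N. \<phi> x) = enn2real (\<integral>\<^sup>+x. ennreal (indicator A x *\<^sub>R \<phi> x) \<partial>N)"
    unfolding set_lebesgue_integral_def by (rule integral_eq_nn_integral) (use nn in auto)
  also have "(\<integral>\<^sup>+x. ennreal (indicator A x *\<^sub>R \<phi> x) \<partial>N) = (\<integral>\<^sup>+x. ennreal (\<phi> x) * indicator A x \<partial>N)"
    by (intro nn_integral_cong) (auto simp: indicator_def)
  also have "\<dots> = emeasure (density N (\<lambda>x. ennreal (\<phi> x))) A"
    by (subst emeasure_density) auto
  finally show ?thesis by (simp add: measure_def)
qed

context
  fixes \<phi> :: "real \<Rightarrow> real" and p :: real
  assumes \<phi>_meas [measurable]: "\<phi> \<in> borel_measurable borel" and \<phi>_pos: "\<And>x. 0 < \<phi> x"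
begin

lemma M_class_sets:
  assumes "\<mu> \<in> M_class p \<phi>"
  shows "sets (fst \<mu>) = sets borel" "sets (snd \<mu>) = sets borel"
  using assms by (auto simp: M_class_def signed_sigma_finite_def)

lemma sets_parts:
  assumes "\<mu> \<in> M_class p \<phi>"
  shows "sets (pos_part \<phi> \<mu>) = sets borel" "sets (neg_part \<phi> \<mu>) = sets borel"
  using M_class_sets[OF assms] by (auto simp: pos_part_def neg_part_def)

lemma locally_finite_parts:
  assumes \<mu>: "\<mu> \<in> M_class p \<phi>"
  shows "locally_finite (pos_part \<phi> \<mu>)" "locally_finite (neg_part \<phi> \<mu>)"
proof -
  note s = M_class_sets[OF \<mu>]
  have fin: "emeasure (pos_part \<phi> \<mu>) {- r..r} + emeasure (neg_part \<phi> \<mu>) {- r..r} < \<infinity>" for r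
  proof -
    have "set_integrable (total_variation \<mu>) {- r..r} \<phi>" using \<mu> by (simp add: M_class_def)
    then have "(\<integral>\<^sup>+x. ennreal (norm (indicator {- r..r} x *\<^sub>R \<phi> x)) \<partial>total_variation \<mu>) < \<infinity>"
      unfolding set_integrable_def by (simp add: integrable_iff_bounded)
    also have "(\<integral>\<^sup>+x. ennreal (norm (indicator {- r..r} x *\<^sub>R \<phi> x)) \<partial>total_variation \<mu>)
        = (\<integral>\<^sup>+x. ennreal (\<phi> x) * indicator {- r..r} x \<partial>total_variation \<mu>)"
      using \<phi>_pos by (intro nn_integral_cong) (auto simp: indicator_def less_imp_le)
    also have "\<dots> = (\<integral>\<^sup>+x. ennreal (\<phi> x) * indicator {- r..r} x \<partial>fst \<mu>) + (\<integral>\<^sup>+x. ennreal (\<phi> x) * indicator {- r..r} x \<partial>snd \<mu>)"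
      by (rule nn_integral_total_variation[OF s]) measurable
    also have "\<dots> = emeasure (pos_part \<phi> \<mu>) {- r..r} + emeasure (neg_part \<phi> \<mu>) {- r..r}"
      unfolding pos_part_def neg_part_def
      using borel_measurable_if_sets_borel[OF s(1) \<phi>_meas] borel_measurable_if_sets_borel[OF s(2) \<phi>_meas] s
      by (subst (1 2) emeasure_density) auto
    finally show ?thesis .
  qed
  show "locally_finite (pos_part \<phi> \<mu>)" "locally_finite (neg_part \<phi> \<mu>)"
    unfolding locally_finite_def using fin sets_parts[OF \<mu>] by (auto simp: less_top)
qed

lemma g_meas_eq:
  assumes \<mu>: "\<mu> \<in> M_class p \<phi>"
  shows "g_meas \<phi> \<mu> x = ray_measure (pos_part \<phi> \<mu>) x - ray_measure (neg_part \<phi> \<mu>) x"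
proof -
  have "signed_integral \<mu> A \<phi> = measure (pos_part \<phi> \<mu>) A - measure (neg_part \<phi> \<mu>) A" if "A \<in> sets borel" for A
    unfolding signed_integral_def pos_part_def neg_part_def
    using set_integral_eq_measure_density[OF M_class_sets(1)[OF \<mu>] \<phi>_meas less_imp_le[OF \<phi>_pos] that]
      set_integral_eq_measure_density[OF M_class_sets(2)[OF \<mu>] \<phi>_meas less_imp_le[OF \<phi>_pos] that] by simp
  then show ?thesis by (simp add: g_meas_def ray_measure_def)
qed

lemma g_meas_0: "\<mu> \<in> M_class p \<phi> \<Longrightarrow> g_meas \<phi> \<mu> 0 = 0"
  by (simp add: g_meas_eq ray_measure_def)

lemma g_jump_outside: "x \<notin> range a \<Longrightarrow> g_jump \<phi> a l x = 0"
proof -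
  assume "x \<notin> range a"
  then have "indicator {a i} x = (0 :: real)" for i by (auto simp: indicator_def)
  then show ?thesis by (simp add: g_jump_def)
qed

lemma g_jump_at:
  assumes "inj a"
  shows "g_jump \<phi> a l (a i) = l i * \<phi> (a i)"
proof -
  have "(\<lambda>j. l j * \<phi> (a j) * indicator {a j} (a i)) = (\<lambda>j. if j = i then l i * \<phi> (a i) else 0)"
    using assms by (auto simp: indicator_def inj_eq)
  then show ?thesis unfolding g_jump_def using sums_unique[OF sums_single[of i "\<lambda>j. l i * \<phi> (a i)"]] by simp
qed

text \<open>The difference of the two measure parts, constants included, vanishes off the countable
  set of jump points. A right-continuous function that is nonzero at a point is nonzero on an
  interval to its right, which is uncountable; so the difference vanishes everywhere. At 0 this
  compares the constants.\<close>

lemma G_decomp_unique: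
  assumes d: "G_decomp p \<phi> g c \<mu> a l" and d': "G_decomp p \<phi> g c' \<mu>' a' l'"
  shows "g_meas \<phi> \<mu> = g_meas \<phi> \<mu>'" and "g_jump \<phi> a l = g_jump \<phi> a' l'"
proof -
  have \<mu>: "\<mu> \<in> M_class p \<phi>" "\<mu>' \<in> M_class p \<phi>" using d d' by (auto simp: G_decomp_def)
  have eq: "c + g_meas \<phi> \<mu> x + g_jump \<phi> a l x = c' + g_meas \<phi> \<mu>' x + g_jump \<phi> a' l' x" for x
    using d d' unfolding G_decomp_def by metis
  define D where "D x = (c + g_meas \<phi> \<mu> x) - (c' + g_meas \<phi> \<mu>' x)" for x
  have out: "D x = 0" if "x \<notin> range a \<union> range a'" for x
    using eq[of x] g_jump_outside[of x a l] g_jump_outside[of x a' l'] that by (simp add: D_def)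
  have D0: "D x = 0" for x
  proof (rule ccontr)
    assume nz: "D x \<noteq> 0"
    have "(D \<longlongrightarrow> D x) (at_right x)"
      unfolding D_def g_meas_eq[OF \<mu>(1)] g_meas_eq[OF \<mu>(2)]
      by (intro tendsto_intros ray_measure_right_continuous locally_finite_parts \<mu>)
    then have "eventually (\<lambda>y. D y \<noteq> 0) (at_right x)" using nz by (rule tendsto_imp_eventually_ne)
    then obtain b where b: "x < b" "\<And>y. x < y \<Longrightarrow> y < b \<Longrightarrow> D y \<noteq> 0"
      unfolding eventually_at_right_field by blast
    then have "{x<..<b} \<subseteq> range a \<union> range a'" using out by fastforce
    then have "countable {x<..<b}" by (rule countable_subset) auto
    then show False using b(1) uncountable_open_interval[of x b] by simp
  qed
  have cc: "c = c'" using D0[of 0] g_meas_0 \<mu> by (simp add: D_def)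
  show "g_meas \<phi> \<mu> = g_meas \<phi> \<mu>'" using D0 cc by (auto simp: D_def)
  then show "g_jump \<phi> a l = g_jump \<phi> a' l'" using eq cc by auto
qed

text \<open>Equal functions \<open>g_meas\<close> give equal masses on bounded half-open intervals
  for the cross sums, positive part of one plus negative part of the other. By local finiteness
  these sums are equal as measures, and uniqueness of the Jordan decomposition applies.\<close>

lemma total_variation_parts_unique:
  assumes \<mu>: "\<mu> \<in> M_class p \<phi>" "\<mu>' \<in> M_class p \<phi>" and eq: "g_meas \<phi> \<mu> = g_meas \<phi> \<mu>'"
  shows "total_variation (pos_part \<phi> \<mu>, neg_part \<phi> \<mu>) = total_variation (pos_part \<phi> \<mu>', neg_part \<phi> \<mu>')"
proof -
  note lf = locally_finite_parts[OF \<mu>(1)] locally_finite_parts[OF \<mu>(2)]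
  note st = sets_parts[OF \<mu>(1)] sets_parts[OF \<mu>(2)]
  have null: "emeasure (density N (\<lambda>x. ennreal (\<phi> x))) A = 0"
    if "sets N = sets borel" "A \<in> sets borel" "emeasure N A = 0" for N :: "real measure" and A
  proof -
    have "\<phi> \<in> borel_measurable N" by (rule borel_measurable_if_sets_borel[OF that(1)]) measurable
    then have "emeasure (density N (\<lambda>x. ennreal (\<phi> x))) A = (\<integral>\<^sup>+x\<in>A. ennreal (\<phi> x) \<partial>N)"
      using that by (subst emeasure_density) auto
    also have "\<dots> = 0" using that by (intro nn_integral_null_set) (auto simp: null_sets_def)
    finally show ?thesis .
  qed
  have hahn: "\<exists>P\<in>sets borel. emeasure (pos_part \<phi> \<nu>) (- P) = 0 \<and> emeasure (neg_part \<phi> \<nu>) P = 0" if \<nu>: "\<nu> \<in> M_class p \<phi>" for \<nu>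
  proof -
    obtain P where P: "P \<in> sets borel" "emeasure (fst \<nu>) (- P) = 0" "emeasure (snd \<nu>) P = 0"
      using \<nu> by (auto simp: M_class_def signed_sigma_finite_def)
    then show ?thesis unfolding pos_part_def neg_part_def
      using null[OF M_class_sets(1)[OF \<nu>], of "- P"] null[OF M_class_sets(2)[OF \<nu>], of P] by (intro bexI[of _ P]) auto
  qed
  obtain P where P: "P \<in> sets borel" "emeasure (pos_part \<phi> \<mu>) (- P) = 0" "emeasure (neg_part \<phi> \<mu>) P = 0"
    using hahn[OF \<mu>(1)] by blast
  obtain Q where Q: "Q \<in> sets borel" "emeasure (pos_part \<phi> \<mu>') (- Q) = 0" "emeasure (neg_part \<phi> \<mu>') Q = 0"
    using hahn[OF \<mu>(2)] by blast
  have "total_variation (pos_part \<phi> \<mu>, neg_part \<phi> \<mu>') = total_variation (neg_part \<phi> \<mu>, pos_part \<phi> \<mu>')"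
  proof (rule locally_finite_eqI[OF locally_finite_total_variation[OF lf(1,4)] locally_finite_total_variation[OF lf(2,3)]])
    fix a b :: real assume ab: "a \<le> b"
    have tv: "measure (total_variation (m, n)) {a<..b} = measure m {a<..b} + measure n {a<..b}"
      if m: "locally_finite m" and n: "locally_finite n" for m n
    proof -
      have "emeasure m {a<..b} \<noteq> \<infinity>" "emeasure n {a<..b} \<noteq> \<infinity>"
        by (rule locally_finite_bounded[OF m, of _ "\<bar>a\<bar> + \<bar>b\<bar>"], force) (rule locally_finite_bounded[OF n, of _ "\<bar>a\<bar> + \<bar>b\<bar>"], force)
      moreover have "emeasure (total_variation (m, n)) {a<..b} = emeasure m {a<..b} + emeasure n {a<..b}"
        using emeasure_total_variation[of "(m, n)" "{a<..b}"] m n by (simp add: locally_finite_def)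
      ultimately show ?thesis by (simp add: measure_def enn2real_plus less_top)
    qed
    have r: "ray_measure (pos_part \<phi> \<mu>) x - ray_measure (neg_part \<phi> \<mu>) x
        = ray_measure (pos_part \<phi> \<mu>') x - ray_measure (neg_part \<phi> \<mu>') x" for x
      using fun_cong[OF eq, of x] by (simp add: g_meas_eq \<mu>)
    show "measure (total_variation (pos_part \<phi> \<mu>, neg_part \<phi> \<mu>')) {a<..b}
        = measure (total_variation (neg_part \<phi> \<mu>, pos_part \<phi> \<mu>')) {a<..b}"
      unfolding tv[OF lf(1,4)] tv[OF lf(2,3)] measure_Ioc_eq_ray_measure[OF lf(1) ab] measure_Ioc_eq_ray_measure[OF lf(2) ab]
        measure_Ioc_eq_ray_measure[OF lf(3) ab] measure_Ioc_eq_ray_measure[OF lf(4) ab]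
      using r[of a] r[of b] by (simp split: if_splits)
  qed
  then show ?thesis by (rule jordan_total_variation_unique[OF st P Q])
qed

text \<open>Moves one factor \<phi> into the measure. The right-hand side depends only on the
  variation of \<phi>\<mu>, which is determined by \<open>g_meas\<close>.\<close>

lemma integral_total_variation_parts:
  assumes \<mu>: "\<mu> \<in> M_class p \<phi>"
  shows "(\<integral>x. \<phi> x powr (1 + 1 / p) \<partial>total_variation \<mu>)
    = enn2real (\<integral>\<^sup>+x. ennreal (\<phi> x powr (1 / p)) \<partial>total_variation (pos_part \<phi> \<mu>, neg_part \<phi> \<mu>))"
proof -
  note s = M_class_sets[OF \<mu>] and st = sets_parts[OF \<mu>]
  have d: "(\<integral>\<^sup>+x. ennreal (\<phi> x powr (1 / p)) \<partial>density N (\<lambda>x. ennreal (\<phi> x))) = (\<integral>\<^sup>+x. ennreal (\<phi> x powr (1 + 1 / p)) \<partial>N)"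
    if N: "sets N = sets borel" for N :: "real measure"
  proof -
    have [measurable]: "\<phi> \<in> borel_measurable N" by (rule borel_measurable_if_sets_borel[OF N]) measurable
    have "(\<integral>\<^sup>+x. ennreal (\<phi> x powr (1 / p)) \<partial>density N (\<lambda>x. ennreal (\<phi> x))) = (\<integral>\<^sup>+x. ennreal (\<phi> x) * ennreal (\<phi> x powr (1 / p)) \<partial>N)"
      by (rule nn_integral_density) measurable
    also have "\<dots> = (\<integral>\<^sup>+x. ennreal (\<phi> x powr (1 + 1 / p)) \<partial>N)"
      using \<phi>_pos by (intro nn_integral_cong) (simp add: ennreal_mult[symmetric] powr_add less_imp_le)
    finally show ?thesis .
  qed
  have "(\<lambda>x. \<phi> x powr (1 + 1 / p)) \<in> borel_measurable (total_variation \<mu>)"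
    by (rule borel_measurable_if_sets_borel[OF sets_total_variation[OF s]]) measurable
  then have "(\<integral>x. \<phi> x powr (1 + 1 / p) \<partial>total_variation \<mu>) = enn2real (\<integral>\<^sup>+x. ennreal (\<phi> x powr (1 + 1 / p)) \<partial>total_variation \<mu>)"
    by (rule integral_eq_nn_integral) simp
  also have "(\<integral>\<^sup>+x. ennreal (\<phi> x powr (1 + 1 / p)) \<partial>total_variation \<mu>)
      = (\<integral>\<^sup>+x. ennreal (\<phi> x powr (1 / p)) \<partial>total_variation (pos_part \<phi> \<mu>, neg_part \<phi> \<mu>))"
    using nn_integral_total_variation[OF s, of "\<lambda>x. ennreal (\<phi> x powr (1 + 1 / p))"]
      nn_integral_total_variation[of "(pos_part \<phi> \<mu>, neg_part \<phi> \<mu>)" "\<lambda>x. ennreal (\<phi> x powr (1 / p))"] st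
    by (simp add: d[OF s(1), folded pos_part_def] d[OF s(2), folded neg_part_def])
  finally show ?thesis .
qed

text \<open>Writes the series as an unordered sum over the real line in terms of the function
  \<open>g_jump\<close>, which removes the dependence on the enumeration and on zero
  coefficients.\<close>

lemma jump_sum_has_sum:
  assumes a: "inj a" and sm: "summable (\<lambda>i. \<bar>l i\<bar> * \<phi> (a i) powr (1 + 1 / p))"
  shows "((\<lambda>x. \<bar>g_jump \<phi> a l x\<bar> * \<phi> x powr (1 / p)) has_sum (\<Sum>i. \<bar>l i\<bar> * \<phi> (a i) powr (1 + 1 / p))) UNIV"
proof -
  define S where "S = (\<Sum>i. \<bar>l i\<bar> * \<phi> (a i) powr (1 + 1 / p))"
  have "((\<lambda>i. \<bar>l i\<bar> * \<phi> (a i) powr (1 + 1 / p)) has_sum S) UNIV"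
    unfolding S_def by (rule sums_nonneg_imp_has_sum) (use sm in \<open>auto simp: summable_sums\<close>)
  moreover have "(\<lambda>i. \<bar>l i\<bar> * \<phi> (a i) powr (1 + 1 / p)) = (\<lambda>x. \<bar>g_jump \<phi> a l x\<bar> * \<phi> x powr (1 / p)) \<circ> a"
    using \<phi>_pos by (intro ext) (simp add: g_jump_at[OF a] powr_add abs_mult abs_of_pos less_imp_le)
  ultimately have "((\<lambda>x. \<bar>g_jump \<phi> a l x\<bar> * \<phi> x powr (1 / p)) has_sum S) (range a)"
    unfolding has_sum_reindex[OF a] by (simp only:)
  then show ?thesis unfolding S_def[symmetric]
    by (rule has_sum_cong_neutral[THEN iffD1, rotated -1]) (auto simp: g_jump_outside)
qed

lemma V_functional_eq:
  assumes d: "G_decomp p \<phi> g c \<mu> a l"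
  shows "V_functional p \<phi> g = (\<integral>x. \<phi> x powr (1 + 1 / p) \<partial>total_variation \<mu>) + (\<Sum>i. \<bar>l i\<bar> * \<phi> (a i) powr (1 + 1 / p))"
  unfolding V_functional_def
proof (rule the_equality)
  show "\<exists>c \<mu>' a' l'. G_decomp p \<phi> g c \<mu>' a' l' \<and>
      (\<integral>x. \<phi> x powr (1 + 1 / p) \<partial>total_variation \<mu>) + (\<Sum>i. \<bar>l i\<bar> * \<phi> (a i) powr (1 + 1 / p))
      = (\<integral>x. \<phi> x powr (1 + 1 / p) \<partial>total_variation \<mu>') + (\<Sum>i. \<bar>l' i\<bar> * \<phi> (a' i) powr (1 + 1 / p))"
    using d by blast
  fix v assume "\<exists>c \<mu> a l. G_decomp p \<phi> g c \<mu> a l \<and>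
      v = (\<integral>x. \<phi> x powr (1 + 1 / p) \<partial>total_variation \<mu>) + (\<Sum>i. \<bar>l i\<bar> * \<phi> (a i) powr (1 + 1 / p))"
  then obtain c' \<mu>' a' l' where d': "G_decomp p \<phi> g c' \<mu>' a' l'"
    and v: "v = (\<integral>x. \<phi> x powr (1 + 1 / p) \<partial>total_variation \<mu>') + (\<Sum>i. \<bar>l' i\<bar> * \<phi> (a' i) powr (1 + 1 / p))" by blast
  have m: "\<mu> \<in> M_class p \<phi>" "\<mu>' \<in> M_class p \<phi>" using d d' by (auto simp: G_decomp_def)
  have "(\<integral>x. \<phi> x powr (1 + 1 / p) \<partial>total_variation \<mu>') = (\<integral>x. \<phi> x powr (1 + 1 / p) \<partial>total_variation \<mu>)"
    unfolding integral_total_variation_parts[OF m(1)] integral_total_variation_parts[OF m(2)]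
      total_variation_parts_unique[OF m G_decomp_unique(1)[OF d d']] ..
  moreover have "(\<Sum>i. \<bar>l' i\<bar> * \<phi> (a' i) powr (1 + 1 / p)) = (\<Sum>i. \<bar>l i\<bar> * \<phi> (a i) powr (1 + 1 / p))"
  proof (rule has_sum_unique)
    show "((\<lambda>x. \<bar>g_jump \<phi> a l x\<bar> * \<phi> x powr (1 / p)) has_sum (\<Sum>i. \<bar>l i\<bar> * \<phi> (a i) powr (1 + 1 / p))) UNIV"
      using d by (intro jump_sum_has_sum) (auto simp: G_decomp_def)
    show "((\<lambda>x. \<bar>g_jump \<phi> a l x\<bar> * \<phi> x powr (1 / p)) has_sum (\<Sum>i. \<bar>l' i\<bar> * \<phi> (a' i) powr (1 + 1 / p))) UNIV"
      unfolding G_decomp_unique(2)[OF d d'] using d' by (intro jump_sum_has_sum) (auto simp: G_decomp_def)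
  qed
  ultimately show "v = (\<integral>x. \<phi> x powr (1 + 1 / p) \<partial>total_variation \<mu>) + (\<Sum>i. \<bar>l i\<bar> * \<phi> (a i) powr (1 + 1 / p))"
    using v by simp
qed

end

section \<open>Probability estimates\<close>

context prob_space begin

lemma prob_abs_diff_le:
  fixes X :: "'a \<Rightarrow> real"
  assumes D: "distributed M lborel X (\<lambda>x. ennreal (f x))" and f: "\<And>x. f x \<le> B" and \<delta>: "0 \<le> \<delta>" and B: "0 \<le> B"
  shows "prob {\<omega> \<in> space M. \<bar>X \<omega> - z\<bar> \<le> \<delta>} \<le> 2 * \<delta> * B"
proof -
  have eq: "{\<omega> \<in> space M. \<bar>X \<omega> - z\<bar> \<le> \<delta>} = X -` {z - \<delta>..z + \<delta>} \<inter> space M" by auto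
  have "emeasure M (X -` {z - \<delta>..z + \<delta>} \<inter> space M) = (\<integral>\<^sup>+x. ennreal (f x) * indicator {z - \<delta>..z + \<delta>} x \<partial>lborel)"
    by (rule distributed_emeasure[OF D]) simp
  also have "\<dots> \<le> (\<integral>\<^sup>+x. ennreal B * indicator {z - \<delta>..z + \<delta>} x \<partial>lborel)"
    using f by (intro nn_integral_mono mult_right_mono ennreal_leI) auto
  also have "\<dots> = ennreal (B * (2 * \<delta>))" using \<delta> B by (simp add: nn_integral_cmult_indicator ennreal_mult)
  finally show ?thesis unfolding eq using \<delta> B by (simp add: emeasure_eq_measure ennreal_le_iff mult_ac)
qed

lemma Lr_norm_powr:
  assumes "0 < r" "in_Lr M r Z"
  shows "Lr_norm M r Z powr r = (\<integral>\<omega>. \<bar>Z \<omega>\<bar> powr r \<partial>M)"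
  using assms by (simp add: Lr_norm_def powr_powr)

lemma prob_abs_ge_le:
  assumes Z: "in_Lr M r Z" and r: "0 < r" and \<delta>: "0 < \<delta>" and A: "(\<integral>\<omega>. \<bar>Z \<omega>\<bar> powr r \<partial>M) \<le> A powr r"
  shows "prob {\<omega> \<in> space M. \<delta> \<le> \<bar>Z \<omega>\<bar>} \<le> A powr r / \<delta> powr r"
proof -
  have [measurable]: "Z \<in> borel_measurable M" using Z by (simp add: in_Lr_def)
  have "{\<omega> \<in> space M. \<delta> \<le> \<bar>Z \<omega>\<bar>} = {\<omega> \<in> space M. \<delta> powr r \<le> \<bar>Z \<omega>\<bar> powr r}"
  proof (intro Collect_cong conj_cong refl iffI)
    fix \<omega>
    show "\<delta> \<le> \<bar>Z \<omega>\<bar> \<Longrightarrow> \<delta> powr r \<le> \<bar>Z \<omega>\<bar> powr r" using \<delta> r by (intro powr_mono2) auto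
    show "\<delta> powr r \<le> \<bar>Z \<omega>\<bar> powr r \<Longrightarrow> \<delta> \<le> \<bar>Z \<omega>\<bar>"
      using powr_less_mono2[OF r abs_ge_zero, of "Z \<omega>" \<delta>] by linarith
  qed
  then have "prob {\<omega> \<in> space M. \<delta> \<le> \<bar>Z \<omega>\<bar>} = prob {\<omega> \<in> space M. \<delta> powr r \<le> \<bar>Z \<omega>\<bar> powr r}" by simp
  also have "\<dots> \<le> (\<integral>\<omega>. \<bar>Z \<omega>\<bar> powr r \<partial>M) / \<delta> powr r"
    by (rule integral_Markov_inequality_measure[of _ _ "{}"]) (use Z \<delta> in \<open>auto simp: in_Lr_def\<close>)
  also have "\<dots> \<le> A powr r / \<delta> powr r" using A by (intro divide_right_mono) auto
  finally show ?thesis .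
qed

text \<open>The bound \<open>2 \<delta> B + L\<^sup>r / \<delta>\<^sup>r\<close> is optimised by balancing \<open>\<delta> B\<close> against \<open>L\<^sup>r / \<delta>\<^sup>r\<close>.\<close>

lemma prob_between_le:
  fixes X Y :: "'a \<Rightarrow> real"
  assumes D: "distributed M lborel X (\<lambda>x. ennreal (f x))" and f: "\<And>x. f x \<le> B" and B: "0 < B"
    and Y: "Y \<in> borel_measurable M" and r: "0 < r" and XY: "in_Lr M r (\<lambda>\<omega>. X \<omega> - Y \<omega>)"
    and L: "Lr_norm M r (\<lambda>\<omega>. X \<omega> - Y \<omega>) \<le> L"
  shows "prob {\<omega> \<in> space M. min (X \<omega>) (Y \<omega>) \<le> z \<and> z \<le> max (X \<omega>) (Y \<omega>)} \<le> 3 * (B * L) powr (r / (r + 1))"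
proof -
  let ?P = "prob {\<omega> \<in> space M. min (X \<omega>) (Y \<omega>) \<le> z \<and> z \<le> max (X \<omega>) (Y \<omega>)}"
  have [measurable]: "X \<in> borel_measurable M" "Y \<in> borel_measurable M" using distributed_measurable[OF D] Y by auto
  have n0: "0 \<le> Lr_norm M r (\<lambda>\<omega>. X \<omega> - Y \<omega>)" by (simp add: Lr_norm_def)
  then have L0: "0 \<le> L" using L by simp
  have E: "(\<integral>\<omega>. \<bar>X \<omega> - Y \<omega>\<bar> powr r \<partial>M) \<le> L powr r"
    unfolding Lr_norm_powr[OF r XY, symmetric] using L n0 r by (intro powr_mono2) auto
  \<comment> \<open>If \<open>z\<close> lies between \<open>X\<close> and \<open>Y\<close>, then
    \<open>X\<close> is within \<delta> of \<open>z\<close> or differs from \<open>Y\<close> by at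
    least \<delta>.\<close>
  have main: "?P \<le> 2 * \<delta> * B + L powr r / \<delta> powr r" if \<delta>: "0 < \<delta>" for \<delta>
  proof -
    have "?P \<le> prob ({\<omega> \<in> space M. \<bar>X \<omega> - z\<bar> \<le> \<delta>} \<union> {\<omega> \<in> space M. \<delta> \<le> \<bar>X \<omega> - Y \<omega>\<bar>})"
      by (rule finite_measure_mono) (auto simp: min_def max_def split: if_splits)
    also have "\<dots> \<le> prob {\<omega> \<in> space M. \<bar>X \<omega> - z\<bar> \<le> \<delta>} + prob {\<omega> \<in> space M. \<delta> \<le> \<bar>X \<omega> - Y \<omega>\<bar>}"
      by (rule measure_Un_le) auto
    also have "\<dots> \<le> 2 * \<delta> * B + L powr r / \<delta> powr r"
      using \<delta> B by (intro add_mono prob_abs_diff_le[OF D f] prob_abs_ge_le[OF XY r \<delta> E]) auto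
    finally show ?thesis .
  qed
  show ?thesis
  proof (cases "L = 0")
    case True
    \<comment> \<open>The balancing value of \<delta> would be 0 here. Instead, the second term
      vanishes for every positive \<delta>, and \<delta> can be taken arbitrarily small.\<close>
    have "?P \<le> 0"
    proof (rule field_le_epsilon)
      fix e :: real assume e: "0 < e"
      show "?P \<le> 0 + e" using main[of "e / (2 * B)"] e B True by simp
    qed
    then show ?thesis using True by simp
  next
    case False
    then have Lp: "0 < L" using L0 by simp
    define s where "s = 1 / (r + 1)"
    have s: "r / (r + 1) = r * s" "1 - s = r * s" using r by (auto simp: s_def field_simps)
    define \<delta> where "\<delta> = (L powr r / B) powr s"
    have \<delta>: "0 < \<delta>" using Lp B by (simp add: \<delta>_def)
    have d: "\<delta> = L powr (r * s) * B powr (- s)"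
      using Lp B by (simp add: \<delta>_def powr_divide powr_powr powr_minus_divide)
    have "\<delta> * B = L powr (r * s) * (B powr (- s) * B powr 1)" using B by (simp add: d)
    also have "B powr (- s) * B powr 1 = B powr (- s + 1)" by (rule powr_add[symmetric])
    also have "- s + 1 = r * s" using s(2) by simp
    also have "L powr (r * s) * B powr (r * s) = (B * L) powr (r * s)" using Lp B by (simp add: powr_mult)
    finally have 1: "\<delta> * B = (B * L) powr (r * s)" .
    have "L powr r / \<delta> powr r = L powr r / (L powr (r * s * r) * B powr (- s * r))"
      using Lp B by (simp add: d powr_mult powr_powr)
    also have "\<dots> = L powr (r - r * s * r) * B powr (s * r)"
      using Lp B by (simp add: powr_diff powr_minus field_simps)
    also have "r - r * s * r = r * s"
    proof -
      have "r - r * s * r = r * (1 - r * s)" by (simp add: algebra_simps)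
      also have "1 - r * s = s" using s(2) by simp
      finally show ?thesis .
    qed
    finally have 2: "L powr r / \<delta> powr r = (B * L) powr (r * s)" using Lp B by (simp add: powr_mult mult_ac)
    show ?thesis using main[OF \<delta>] 1 2 by (simp add: s(1))
  qed
qed

end

text \<open>Convexity of the power with weights \<open>A / (A + B)\<close> and
  \<open>B / (A + B)\<close>. With \<open>A\<close> and \<open>B\<close> close to the norms of the
  two summands, integration gives Minkowski's inequality.\<close>

lemma powr_add_le:
  fixes x y A B r :: real
  assumes x: "0 \<le> x" and y: "0 \<le> y" and A: "0 < A" and B: "0 < B" and r: "1 \<le> r"
  shows "(x + y) powr r \<le> (A + B) powr (r - 1) * (x powr r / A powr (r - 1) + y powr r / B powr (r - 1))"
proof -
  define t where "t = A / (A + B)"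
  have t: "0 < t" "t < 1" "1 - t = B / (A + B)" using A B by (auto simp: t_def field_simps)
  have key: "(x + y) powr r \<le> t powr (1 - r) * x powr r + (1 - t) powr (1 - r) * y powr r"
  proof -
    have ge1: "1 \<le> u powr (1 - r)" if "0 < u" "u < 1" for u
      using that r powr_mono2'[of "1 - r" u 1] by simp
    consider "x = 0" | "y = 0" | "0 < x" "0 < y" using x y by linarith
    then show ?thesis
    proof cases
      case 1
      have "1 * y powr r \<le> (1 - t) powr (1 - r) * y powr r" using ge1[of "1 - t"] t by (intro mult_right_mono) auto
      then show ?thesis using 1 by simp
    next
      case 2
      have "1 * x powr r \<le> t powr (1 - r) * x powr r" using ge1[of t] t by (intro mult_right_mono) auto
      then show ?thesis using 2 by simp
    next
      case 3
      have "((1 - (1 - t)) *\<^sub>R (x / t) + (1 - t) *\<^sub>R (y / (1 - t))) powr r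
          \<le> (1 - (1 - t)) * (x / t) powr r + (1 - t) * (y / (1 - t)) powr r"
        by (rule convex_onD[OF powr_convex[OF r]]) (use t(1,2) 3 in auto)
      moreover have "t * (x / t) powr r = t powr (1 - r) * x powr r" "(1 - t) * (y / (1 - t)) powr r = (1 - t) powr (1 - r) * y powr r"
        using t(1,2) 3 by (simp_all add: powr_divide powr_diff)
      ultimately show ?thesis using t(1,2) by simp
    qed
  qed
  have e: "(u / (A + B)) powr (1 - r) = (A + B) powr (r - 1) / u powr (r - 1)" if "0 < u" for u
    using that A B by (simp add: powr_divide powr_diff)
  show ?thesis using key unfolding t(3) e[OF B] unfolding t_def e[OF A] by (simp add: algebra_simps)
qed

context prob_space begin

text \<open>Minkowski's inequality for \<open>Y = X - (X - Y)\<close>. It is stated for the moment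
  instead of the norm, the form in which Markov's inequality uses it.\<close>

lemma Lr_triangle:
  assumes X: "in_Lr M r X" and XY: "in_Lr M r (\<lambda>\<omega>. X \<omega> - Y \<omega>)" and Y: "Y \<in> borel_measurable M" and r: "1 \<le> r"
    and A: "Lr_norm M r X \<le> A" and B: "Lr_norm M r (\<lambda>\<omega>. X \<omega> - Y \<omega>) \<le> B"
  shows "in_Lr M r Y" and "(\<integral>\<omega>. \<bar>Y \<omega>\<bar> powr r \<partial>M) \<le> (A + B) powr r"
proof -
  have n0: "0 \<le> Lr_norm M r Z" for Z by (simp add: Lr_norm_def)
  have AB: "0 \<le> A" "0 \<le> B" using A B n0 order_trans by blast+
  have r0: "0 < r" using r by simp
  have E: "(\<integral>\<omega>. \<bar>X \<omega>\<bar> powr r \<partial>M) \<le> A powr r" "(\<integral>\<omega>. \<bar>X \<omega> - Y \<omega>\<bar> powr r \<partial>M) \<le> B powr r"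
    unfolding Lr_norm_powr[OF r0 X, symmetric] Lr_norm_powr[OF r0 XY, symmetric] using A B n0 r by (auto intro!: powr_mono2)
  have int: "integrable M (\<lambda>\<omega>. \<bar>X \<omega>\<bar> powr r)" "integrable M (\<lambda>\<omega>. \<bar>X \<omega> - Y \<omega>\<bar> powr r)" using X XY by (auto simp: in_Lr_def)
  note [measurable] = Y
  have pw: "\<bar>Y \<omega>\<bar> powr r \<le> (a + b) powr (r - 1) * (\<bar>X \<omega>\<bar> powr r / a powr (r - 1) + \<bar>X \<omega> - Y \<omega>\<bar> powr r / b powr (r - 1))"
    if "0 < a" "0 < b" for a b \<omega>
  proof -
    have "\<bar>Y \<omega>\<bar> powr r \<le> (\<bar>X \<omega>\<bar> + \<bar>X \<omega> - Y \<omega>\<bar>) powr r" using r by (intro powr_mono2) auto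
    also have "\<dots> \<le> (a + b) powr (r - 1) * (\<bar>X \<omega>\<bar> powr r / a powr (r - 1) + \<bar>X \<omega> - Y \<omega>\<bar> powr r / b powr (r - 1))"
      by (rule powr_add_le) (use that r in auto)
    finally show ?thesis .
  qed
  have intr: "integrable M (\<lambda>\<omega>. (a + b) powr (r - 1) * (\<bar>X \<omega>\<bar> powr r / a powr (r - 1) + \<bar>X \<omega> - Y \<omega>\<bar> powr r / b powr (r - 1)))" for a b
    using int by auto
  have intY: "integrable M (\<lambda>\<omega>. \<bar>Y \<omega>\<bar> powr r)"
    by (rule Bochner_Integration.integrable_bound[OF intr[of 1 1]])
       (use pw[of 1 1] in \<open>auto intro!: AE_I2 intro: order_trans[OF _ abs_ge_self]\<close>)
  then show "in_Lr M r Y" using Y by (simp add: in_Lr_def)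
  \<comment> \<open>The weights of \<open>powr_add_le\<close> must be positive, whereas
    \<open>A\<close> or \<open>B\<close> may be 0; both are enlarged by \<open>e\<close>, which
    tends to 0 at the end.\<close>
  have le: "(\<integral>\<omega>. \<bar>Y \<omega>\<bar> powr r \<partial>M) \<le> ((A + e) + (B + e)) powr r" if e: "0 < e" for e
  proof -
    let ?a = "A + e" and ?b = "B + e"
    have ab: "0 < ?a" "0 < ?b" using AB e by auto
    have "(\<integral>\<omega>. \<bar>Y \<omega>\<bar> powr r \<partial>M) \<le> (\<integral>\<omega>. (?a + ?b) powr (r - 1) * (\<bar>X \<omega>\<bar> powr r / ?a powr (r - 1) + \<bar>X \<omega> - Y \<omega>\<bar> powr r / ?b powr (r - 1)) \<partial>M)"
      by (rule integral_mono[OF intY intr pw[OF ab]])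
    also have "\<dots> = (?a + ?b) powr (r - 1) * ((\<integral>\<omega>. \<bar>X \<omega>\<bar> powr r \<partial>M) / ?a powr (r - 1) + (\<integral>\<omega>. \<bar>X \<omega> - Y \<omega>\<bar> powr r \<partial>M) / ?b powr (r - 1))"
      using int by simp
    also have "\<dots> \<le> (?a + ?b) powr (r - 1) * (?a powr r / ?a powr (r - 1) + ?b powr r / ?b powr (r - 1))"
    proof (intro mult_left_mono add_mono divide_right_mono)
      show "(\<integral>\<omega>. \<bar>X \<omega>\<bar> powr r \<partial>M) \<le> ?a powr r" using E(1) powr_mono2[of r A ?a] AB e r by simp
      show "(\<integral>\<omega>. \<bar>X \<omega> - Y \<omega>\<bar> powr r \<partial>M) \<le> ?b powr r" using E(2) powr_mono2[of r B ?b] AB e r by simp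
    qed auto
    also have "?a powr r / ?a powr (r - 1) = ?a" using ab by (simp add: powr_diff[symmetric])
    also have "?b powr r / ?b powr (r - 1) = ?b" using ab by (simp add: powr_diff[symmetric])
    also have "(?a + ?b) powr (r - 1) * (?a + ?b) = (?a + ?b) powr r" using ab by (simp add: powr_diff)
    finally show ?thesis .
  qed
  have "((\<lambda>e. ((A + e) + (B + e)) powr r) \<longlongrightarrow> ((A + 0) + (B + 0)) powr r) (at_right 0)"
    using r AB by (intro tendsto_powr' tendsto_intros) (auto simp: eventually_at_right_field intro!: exI[of _ 1])
  then have "(\<integral>\<omega>. \<bar>Y \<omega>\<bar> powr r \<partial>M) \<le> ((A + 0) + (B + 0)) powr r"
    by (rule tendsto_lowerbound) (use le in \<open>auto simp: eventually_at_right_field intro!: exI[of _ 1]\<close>)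
  then show "(\<integral>\<omega>. \<bar>Y \<omega>\<bar> powr r \<partial>M) \<le> (A + B) powr r" by simp
qed

end

text \<open>The power lies above its tangent at \<open>m\<close>. The negative term is moved to the
  other side so that the inequality can be integrated with extended nonnegative values.\<close>

lemma powr_above_tangent:
  fixes x m p :: real
  assumes x: "0 \<le> x" and m: "0 < m" and p: "1 \<le> p"
  shows "m powr p + p * m powr (p - 1) * x \<le> x powr p + p * m powr p"
proof (cases "x = 0")
  case True
  have "1 * m powr p \<le> p * m powr p" using p by (intro mult_right_mono) auto
  then show ?thesis using True p by simp
next
  case False
  then have x0: "0 < x" using x by simp
  have "p * m powr (p - 1) * (x - m) \<le> x powr p - m powr p"
  proof (rule convex_on_imp_above_tangent[OF powr_convex[OF p]])
    show "((\<lambda>x. x powr p) has_field_derivative p * m powr (p - 1)) (at m within {0<..})"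
      using m by (auto intro!: derivative_eq_intros)
  qed (use x0 m in \<open>auto simp: interior_open\<close>)
  moreover have "p * m powr (p - 1) * m = p * m powr p" using m by (simp add: powr_diff)
  ultimately show ?thesis unfolding right_diff_distrib by linarith
qed

text \<open>Jensen's inequality for a measure that is not normalised, which produces the power
  \<open>p - 1\<close> of the total mass. It is stated for a real \<open>t\<close> below the
  integral because the integral of \<open>u\<close> may be infinite.\<close>

lemma (in finite_measure) nn_integral_jensen_powr:
  fixes u :: "'a \<Rightarrow> real"
  assumes [measurable]: "u \<in> borel_measurable M" and u: "\<And>z. 0 \<le> u z" and p: "1 \<le> p"
    and t: "0 \<le> t" "ennreal t \<le> (\<integral>\<^sup>+z. ennreal (u z) \<partial>M)"
  shows "ennreal (t powr p) \<le> ennreal (measure M (space M) powr (p - 1)) * (\<integral>\<^sup>+z. ennreal (u z powr p) \<partial>M)"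
proof -
  define V where "V = measure M (space M)"
  have eV: "emeasure M (space M) = ennreal V" by (simp add: V_def emeasure_eq_measure)
  have V0: "0 \<le> V" by (simp add: V_def)
  consider "t = 0" | "V = 0" "0 < t" | "0 < V" "0 < t" using V0 t by linarith
  then show ?thesis
  proof cases
    case 1 then show ?thesis using p by simp
  next
    case 2
    then have "AE z in M. False" using eV by (subst AE_iff_measurable[where N="space M"]) auto
    then have "(\<integral>\<^sup>+z. ennreal (u z) \<partial>M) = (\<integral>\<^sup>+z. 0 \<partial>M)" by (intro nn_integral_cong_AE) auto
    then show ?thesis using 2 t by simp
  next
    case 3
    define m where "m = t / V"
    have m: "0 < m" "m * V = t" using 3 by (auto simp: m_def)
    have mp: "m powr (p - 1) * t = m powr p * V"
      using m 3 by (simp add: m(2)[symmetric] powr_diff)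
    let ?I = "\<integral>\<^sup>+z. ennreal (u z powr p) \<partial>M"
    \<comment> \<open>With the tangent point \<open>m = t / V\<close> the linear term at
      \<open>t\<close> equals the constant term \<open>p * m powr p\<close> integrated over the
      whole space, and the two cancel.\<close>
    have "ennreal (m powr p * V) + ennreal (p * (m powr p * V)) = ennreal (m powr p * V) + ennreal (p * m powr (p - 1)) * ennreal t"
      using mp p m 3 by (simp add: ennreal_mult[symmetric] mult.assoc)
    also have "\<dots> \<le> ennreal (m powr p * V) + ennreal (p * m powr (p - 1)) * (\<integral>\<^sup>+z. ennreal (u z) \<partial>M)"
      using t by (intro add_left_mono mult_left_mono) auto
    also have "\<dots> = (\<integral>\<^sup>+z. ennreal (m powr p) + ennreal (p * m powr (p - 1)) * ennreal (u z) \<partial>M)"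
      using V0 by (subst nn_integral_add) (auto simp: nn_integral_cmult eV ennreal_mult)
    also have "\<dots> \<le> (\<integral>\<^sup>+z. ennreal (u z powr p) + ennreal (p * m powr p) \<partial>M)"
    proof (rule nn_integral_mono)
      fix z
      have "ennreal (m powr p) + ennreal (p * m powr (p - 1)) * ennreal (u z) = ennreal (m powr p + p * m powr (p - 1) * u z)"
        using u[of z] p by (simp add: ennreal_mult[symmetric] ennreal_plus[symmetric] del: ennreal_plus)
      also have "\<dots> \<le> ennreal (u z powr p + p * m powr p)" by (intro ennreal_leI powr_above_tangent u m p)
      also have "\<dots> = ennreal (u z powr p) + ennreal (p * m powr p)" using p by simp
      finally show "ennreal (m powr p) + ennreal (p * m powr (p - 1)) * ennreal (u z) \<le> ennreal (u z powr p) + ennreal (p * m powr p)" .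
    qed
    also have "\<dots> = ?I + ennreal (p * (m powr p * V))"
      using V0 p by (subst nn_integral_add) (auto simp: eV ennreal_mult[symmetric] mult.assoc)
    finally have le: "ennreal (m powr p * V) \<le> ?I" by (simp add: ennreal_add_left_cancel_le add.commute)
    have "t powr p = V powr (p - 1) * (m powr p * V)"
      using m 3 by (simp add: m(2)[symmetric] powr_mult powr_diff)
    then have "ennreal (t powr p) = ennreal (V powr (p - 1)) * ennreal (m powr p * V)"
      using V0 by (simp add: ennreal_mult[symmetric])
    also have "\<dots> \<le> ennreal (V powr (p - 1)) * ?I" by (intro mult_left_mono le) auto
    finally show ?thesis unfolding V_def .
  qed
qed

section \<open>Differences of functions in G\<close>

text \<open>On one side of 0 this is an equality. Across 0 the mass of the interval is the sum of
  the two ray measures, which bounds their difference.\<close>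

lemma ray_measure_diff_le:
  assumes m: "locally_finite m" and xy: "x \<le> y"
  shows "\<bar>ray_measure m y - ray_measure m x\<bar> \<le> measure m {x<..y}"
proof -
  have "0 \<le> ray_measure m x" "0 \<le> ray_measure m y" by (auto simp: ray_measure_def)
  then show ?thesis using measure_Ioc_eq_ray_measure[OF m xy] measure_nonneg[of m "{x<..y}"] xy
    by (auto split: if_splits)
qed

text \<open>The measure \<nu> of the overview, with \<open>total_variation\<close> used as a sum of
  two measures. The atoms are the image under \<open>a\<close> of a weighted counting measure on the
  indices.\<close>

definition weight_measure :: "real \<Rightarrow> (real \<Rightarrow> real) \<Rightarrow> signed_measure \<Rightarrow> (nat \<Rightarrow> real) \<Rightarrow> (nat \<Rightarrow> real) \<Rightarrow> real measure" where
  "weight_measure p \<phi> \<mu> a l = total_variation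
     (density (total_variation \<mu>) (\<lambda>z. ennreal (\<phi> z powr (1 + 1 / p))),
      distr (density (count_space UNIV) (\<lambda>i. ennreal (\<bar>l i\<bar> * \<phi> (a i) powr (1 + 1 / p)))) borel a)"

context
  fixes \<phi> :: "real \<Rightarrow> real" and p :: real
  assumes \<phi>_meas [measurable]: "\<phi> \<in> borel_measurable borel" and \<phi>_pos: "\<And>x. 0 < \<phi> x" and p: "1 \<le> p"
begin

lemma
  assumes \<mu>: "\<mu> \<in> M_class p \<phi>"
  shows sets_weight_measure: "sets (weight_measure p \<phi> \<mu> a l) = sets borel"
    and nn_integral_weight_measure: "f \<in> borel_measurable borel \<Longrightarrow>
      (\<integral>\<^sup>+z. f z \<partial>weight_measure p \<phi> \<mu> a l)
      = (\<integral>\<^sup>+z. ennreal (\<phi> z powr (1 + 1 / p)) * f z \<partial>total_variation \<mu>)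
        + (\<Sum>i. ennreal (\<bar>l i\<bar> * \<phi> (a i) powr (1 + 1 / p)) * f (a i))"
proof -
  let ?m = "density (total_variation \<mu>) (\<lambda>z. ennreal (\<phi> z powr (1 + 1 / p)))"
  let ?c = "density (count_space UNIV) (\<lambda>i. ennreal (\<bar>l i\<bar> * \<phi> (a i) powr (1 + 1 / p)))"
  note tv = sets_total_variation[OF M_class_sets[OF \<phi>_meas \<phi>_pos \<mu>]]
  have s: "sets (fst (?m, distr ?c borel a)) = sets borel" "sets (snd (?m, distr ?c borel a)) = sets borel"
    using tv by auto
  show "sets (weight_measure p \<phi> \<mu> a l) = sets borel"
    unfolding weight_measure_def by (rule sets_total_variation[OF s])
  assume f: "f \<in> borel_measurable borel"
  have "(\<integral>\<^sup>+z. f z \<partial>?m) = (\<integral>\<^sup>+z. ennreal (\<phi> z powr (1 + 1 / p)) * f z \<partial>total_variation \<mu>)"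
  proof (rule nn_integral_density)
    show "(\<lambda>z. ennreal (\<phi> z powr (1 + 1 / p))) \<in> borel_measurable (total_variation \<mu>)"
      by (rule borel_measurable_if_sets_borel[OF tv]) measurable
    show "f \<in> borel_measurable (total_variation \<mu>)" by (rule borel_measurable_if_sets_borel[OF tv f])
  qed
  moreover have "(\<integral>\<^sup>+z. f z \<partial>distr ?c borel a) = (\<Sum>i. ennreal (\<bar>l i\<bar> * \<phi> (a i) powr (1 + 1 / p)) * f (a i))"
    using f by (subst nn_integral_distr) (auto simp: nn_integral_density nn_integral_count_space_nat)
  ultimately show "(\<integral>\<^sup>+z. f z \<partial>weight_measure p \<phi> \<mu> a l)
      = (\<integral>\<^sup>+z. ennreal (\<phi> z powr (1 + 1 / p)) * f z \<partial>total_variation \<mu>)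
        + (\<Sum>i. ennreal (\<bar>l i\<bar> * \<phi> (a i) powr (1 + 1 / p)) * f (a i))"
    unfolding weight_measure_def using nn_integral_total_variation[OF s f] by simp
qed

lemma emeasure_weight_measure:
  assumes d: "G_decomp p \<phi> g c \<mu> a l"
  shows "emeasure (weight_measure p \<phi> \<mu> a l) UNIV = ennreal (V_functional p \<phi> g)" and "0 \<le> V_functional p \<phi> g"
proof -
  have \<mu>: "\<mu> \<in> M_class p \<phi>" and sm: "summable (\<lambda>i. \<bar>l i\<bar> * \<phi> (a i) powr (1 + 1 / p))"
    using d by (auto simp: G_decomp_def)
  have s: "sets (weight_measure p \<phi> \<mu> a l) = sets borel" by (rule sets_weight_measure[OF \<mu>])
  have sp: "space (weight_measure p \<phi> \<mu> a l) = UNIV" using sets_eq_imp_space_eq[OF s] by simp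
  have V: "V_functional p \<phi> g = (\<integral>x. \<phi> x powr (1 + 1 / p) \<partial>total_variation \<mu>) + (\<Sum>i. \<bar>l i\<bar> * \<phi> (a i) powr (1 + 1 / p))"
    by (rule V_functional_eq[OF \<phi>_meas \<phi>_pos d])
  have int: "integrable (total_variation \<mu>) (\<lambda>x. \<phi> x powr (1 + 1 / p))" using \<mu> by (simp add: M_class_def)
  have nn: "0 \<le> (\<integral>x. \<phi> x powr (1 + 1 / p) \<partial>total_variation \<mu>)" "0 \<le> (\<Sum>i. \<bar>l i\<bar> * \<phi> (a i) powr (1 + 1 / p))"
    using sm by (auto intro!: integral_nonneg_AE suminf_nonneg)
  show "0 \<le> V_functional p \<phi> g" unfolding V using nn by simp
  have "emeasure (weight_measure p \<phi> \<mu> a l) UNIV = (\<integral>\<^sup>+z. 1 \<partial>weight_measure p \<phi> \<mu> a l)" using sp by simp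
  also have "\<dots> = (\<integral>\<^sup>+z. ennreal (\<phi> z powr (1 + 1 / p)) * 1 \<partial>total_variation \<mu>) + (\<Sum>i. ennreal (\<bar>l i\<bar> * \<phi> (a i) powr (1 + 1 / p)) * 1)"
    by (rule nn_integral_weight_measure[OF \<mu>]) simp
  also have "(\<integral>\<^sup>+z. ennreal (\<phi> z powr (1 + 1 / p)) * 1 \<partial>total_variation \<mu>) = ennreal (\<integral>x. \<phi> x powr (1 + 1 / p) \<partial>total_variation \<mu>)"
    using nn_integral_eq_integral[OF int] by simp
  also have "(\<Sum>i. ennreal (\<bar>l i\<bar> * \<phi> (a i) powr (1 + 1 / p)) * 1) = ennreal (\<Sum>i. \<bar>l i\<bar> * \<phi> (a i) powr (1 + 1 / p))"
    using sm by (simp add: suminf_ennreal2)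
  finally show "emeasure (weight_measure p \<phi> \<mu> a l) UNIV = ennreal (V_functional p \<phi> g)"
    unfolding V using nn by simp
qed

lemma abs_g_meas_diff_le:
  assumes \<mu>: "\<mu> \<in> M_class p \<phi>" and xy: "x \<le> y"
  shows "ennreal \<bar>g_meas \<phi> \<mu> x - g_meas \<phi> \<mu> y\<bar> \<le> (\<integral>\<^sup>+z. ennreal (\<phi> z) * indicator {x..y} z \<partial>total_variation \<mu>)"
proof -
  note s = M_class_sets[OF \<phi>_meas \<phi>_pos \<mu>] and lf = locally_finite_parts[OF \<phi>_meas \<phi>_pos \<mu>]
  have m: "ennreal (measure m {x<..y}) \<le> emeasure m {x..y}" if "locally_finite m" for m
  proof -
    have "{x<..y} \<subseteq> {- (\<bar>x\<bar> + \<bar>y\<bar>)..\<bar>x\<bar> + \<bar>y\<bar>}" by auto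
    from locally_finite_bounded[OF that this] have "ennreal (measure m {x<..y}) = emeasure m {x<..y}"
      by (subst emeasure_eq_ennreal_measure) auto
    also have "\<dots> \<le> emeasure m {x..y}" using that by (intro emeasure_mono) (auto simp: locally_finite_def)
    finally show ?thesis .
  qed
  have "\<bar>g_meas \<phi> \<mu> x - g_meas \<phi> \<mu> y\<bar> \<le> measure (pos_part \<phi> \<mu>) {x<..y} + measure (neg_part \<phi> \<mu>) {x<..y}"
    unfolding g_meas_eq[OF \<phi>_meas \<phi>_pos \<mu>]
    using ray_measure_diff_le[OF lf(1) xy] ray_measure_diff_le[OF lf(2) xy] by linarith
  then have "ennreal \<bar>g_meas \<phi> \<mu> x - g_meas \<phi> \<mu> y\<bar> \<le> ennreal (measure (pos_part \<phi> \<mu>) {x<..y}) + ennreal (measure (neg_part \<phi> \<mu>) {x<..y})"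
    by (simp add: ennreal_plus[symmetric] ennreal_leI del: ennreal_plus)
  also have "\<dots> \<le> emeasure (pos_part \<phi> \<mu>) {x..y} + emeasure (neg_part \<phi> \<mu>) {x..y}"
    by (intro add_mono m lf)
  also have "\<dots> = (\<integral>\<^sup>+z. ennreal (\<phi> z) * indicator {x..y} z \<partial>fst \<mu>) + (\<integral>\<^sup>+z. ennreal (\<phi> z) * indicator {x..y} z \<partial>snd \<mu>)"
    unfolding pos_part_def neg_part_def
    using borel_measurable_if_sets_borel[OF s(1) \<phi>_meas] borel_measurable_if_sets_borel[OF s(2) \<phi>_meas] s
    by (subst (1 2) emeasure_density) auto
  also have "\<dots> = (\<integral>\<^sup>+z. ennreal (\<phi> z) * indicator {x..y} z \<partial>total_variation \<mu>)"
    by (rule nn_integral_total_variation[OF s, symmetric]) measurable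
  finally show ?thesis .
qed

lemma abs_g_jump_le:
  assumes a: "inj a"
  shows "ennreal \<bar>g_jump \<phi> a l x\<bar> \<le> (\<Sum>i. ennreal (\<bar>l i\<bar> * \<phi> (a i)) * indicator {x} (a i))"
proof (cases "x \<in> range a")
  case False
  then show ?thesis by (simp add: g_jump_outside[OF \<phi>_meas \<phi>_pos])
next
  case True
  then obtain i where i: "x = a i" by auto
  have "ennreal \<bar>g_jump \<phi> a l x\<bar> = (\<Sum>j\<in>{i}. ennreal (\<bar>l j\<bar> * \<phi> (a j)) * indicator {x} (a j))"
    unfolding i g_jump_at[OF \<phi>_meas \<phi>_pos a] using \<phi>_pos[of "a i"] by (simp add: abs_mult abs_of_pos)
  also have "\<dots> \<le> (\<Sum>i. ennreal (\<bar>l i\<bar> * \<phi> (a i)) * indicator {x} (a i))"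
    by (rule sum_le_suminf) auto
  finally show ?thesis .
qed

text \<open>The integrand \<open>\<phi> powr (- (1 / p))\<close> cancels the surplus power in the
  weight. The interval is closed at both ends because \<open>g\<close> may jump at either of the two
  points.\<close>

lemma abs_G_diff_le:
  assumes d: "G_decomp p \<phi> g c \<mu> a l"
  shows "ennreal \<bar>g x - g y\<bar> \<le> (\<integral>\<^sup>+z. ennreal (\<phi> z powr (- (1 / p)) * indicator {min x y..max x y} z) \<partial>weight_measure p \<phi> \<mu> a l)"
proof -
  have *: "ennreal \<bar>g x - g y\<bar> \<le> (\<integral>\<^sup>+z. ennreal (\<phi> z powr (- (1 / p)) * indicator {x..y} z) \<partial>weight_measure p \<phi> \<mu> a l)"
    \<comment> \<open>Strictness keeps the atoms at \<open>x\<close> and \<open>y\<close> apart, so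
      that both fit into the closed interval without being counted twice.\<close>
    if xy: "x < y" for x y
  proof -
    have \<mu>: "\<mu> \<in> M_class p \<phi>" and a: "inj a" and g: "g = (\<lambda>x. c + g_meas \<phi> \<mu> x + g_jump \<phi> a l x)"
      using d by (auto simp: G_decomp_def)
    have pw: "\<phi> z powr (1 + 1 / p) * (\<phi> z powr (- (1 / p)) * t) = \<phi> z * t" for z t
      using \<phi>_pos[of z] by (simp add: powr_add powr_minus field_simps)
    have I: "(\<integral>\<^sup>+z. ennreal (\<phi> z powr (- (1 / p)) * indicator {x..y} z) \<partial>weight_measure p \<phi> \<mu> a l)
      = (\<integral>\<^sup>+z. ennreal (\<phi> z) * indicator {x..y} z \<partial>total_variation \<mu>) + (\<Sum>i. ennreal (\<bar>l i\<bar> * \<phi> (a i)) * indicator {x..y} (a i))"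
    proof -
      have "(\<integral>\<^sup>+z. ennreal (\<phi> z powr (- (1 / p)) * indicator {x..y} z) \<partial>weight_measure p \<phi> \<mu> a l)
        = (\<integral>\<^sup>+z. ennreal (\<phi> z powr (1 + 1 / p)) * ennreal (\<phi> z powr (- (1 / p)) * indicator {x..y} z) \<partial>total_variation \<mu>)
        + (\<Sum>i. ennreal (\<bar>l i\<bar> * \<phi> (a i) powr (1 + 1 / p)) * ennreal (\<phi> (a i) powr (- (1 / p)) * indicator {x..y} (a i)))"
        by (rule nn_integral_weight_measure[OF \<mu>]) measurable
      moreover have "ennreal (\<phi> z powr (1 + 1 / p)) * ennreal (\<phi> z powr (- (1 / p)) * indicator {x..y} z) = ennreal (\<phi> z) * indicator {x..y} z" for z
      proof -
        have "ennreal (\<phi> z powr (1 + 1 / p)) * ennreal (\<phi> z powr (- (1 / p)) * indicator {x..y} z) = ennreal (\<phi> z * indicator {x..y} z)"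
          by (subst ennreal_mult[symmetric]) (auto simp: pw)
        then show ?thesis by (auto simp: indicator_def)
      qed
      moreover have "ennreal (\<bar>l i\<bar> * \<phi> (a i) powr (1 + 1 / p)) * ennreal (\<phi> (a i) powr (- (1 / p)) * indicator {x..y} (a i))
          = ennreal (\<bar>l i\<bar> * \<phi> (a i)) * indicator {x..y} (a i)" for i
      proof -
        have "ennreal (\<bar>l i\<bar> * \<phi> (a i) powr (1 + 1 / p)) * ennreal (\<phi> (a i) powr (- (1 / p)) * indicator {x..y} (a i))
           = ennreal (\<bar>l i\<bar> * (\<phi> (a i) * indicator {x..y} (a i)))"
          by (subst ennreal_mult[symmetric]) (auto simp: pw mult.assoc)
        then show ?thesis by (auto simp: indicator_def)
      qed
      ultimately show ?thesis by simp
    qed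
    have "\<bar>g x - g y\<bar> \<le> \<bar>g_meas \<phi> \<mu> x - g_meas \<phi> \<mu> y\<bar> + (\<bar>g_jump \<phi> a l x\<bar> + \<bar>g_jump \<phi> a l y\<bar>)"
      unfolding g by linarith
    then have "ennreal \<bar>g x - g y\<bar> \<le> ennreal \<bar>g_meas \<phi> \<mu> x - g_meas \<phi> \<mu> y\<bar> + (ennreal \<bar>g_jump \<phi> a l x\<bar> + ennreal \<bar>g_jump \<phi> a l y\<bar>)"
      by (simp add: ennreal_plus[symmetric] ennreal_leI del: ennreal_plus)
    also have "\<dots> \<le> (\<integral>\<^sup>+z. ennreal (\<phi> z) * indicator {x..y} z \<partial>total_variation \<mu>)
       + ((\<Sum>i. ennreal (\<bar>l i\<bar> * \<phi> (a i)) * indicator {x} (a i)) + (\<Sum>i. ennreal (\<bar>l i\<bar> * \<phi> (a i)) * indicator {y} (a i)))"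
      using xy by (intro add_mono abs_g_meas_diff_le[OF \<mu>] abs_g_jump_le[OF a]) auto
    also have "(\<Sum>i. ennreal (\<bar>l i\<bar> * \<phi> (a i)) * indicator {x} (a i)) + (\<Sum>i. ennreal (\<bar>l i\<bar> * \<phi> (a i)) * indicator {y} (a i))
        = (\<Sum>i. ennreal (\<bar>l i\<bar> * \<phi> (a i)) * indicator {x} (a i) + ennreal (\<bar>l i\<bar> * \<phi> (a i)) * indicator {y} (a i))"
      by (intro suminf_add summableI)
    also have "\<dots> \<le> (\<Sum>i. ennreal (\<bar>l i\<bar> * \<phi> (a i)) * indicator {x..y} (a i))"
      using xy by (intro suminf_le summableI) (auto simp: indicator_def)
    finally show ?thesis unfolding I by (auto intro: add_left_mono)
  qed
  consider "x < y" | "x = y" | "y < x" by linarith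
  then show ?thesis
  proof cases
    case 1 then show ?thesis using *[of x y] by simp
  next
    case 3 then show ?thesis using *[of y x] by (simp add: abs_minus_commute)
  qed simp
qed

text \<open>The measure part is a difference of two ray measures, each monotone on either side of 0;
  the jump part is a series of measurable functions.\<close>

lemma G_measurable:
  assumes d: "G_decomp p \<phi> g c \<mu> a l"
  shows "g \<in> borel_measurable borel"
proof -
  have \<mu>: "\<mu> \<in> M_class p \<phi>" and g: "g = (\<lambda>x. c + g_meas \<phi> \<mu> x + g_jump \<phi> a l x)"
    using d by (auto simp: G_decomp_def)
  have ray: "ray_measure m \<in> borel_measurable borel" if m: "locally_finite m" for m
  proof -
    have le: "measure m A \<le> measure m B" if "A \<subseteq> B" "A \<in> sets borel" "B \<in> sets borel" "B \<subseteq> {-r..r}" for A B r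
    proof -
      have "emeasure m B \<noteq> \<infinity>" by (rule locally_finite_bounded[OF m that(4)])
      then show ?thesis using m that by (intro measure_mono_fmeasurable) (auto simp: fmeasurable_def locally_finite_def less_top)
    qed
    have 1: "mono_on {0..} (ray_measure m)"
    proof (rule monotone_onI)
      fix x y :: real assume "x \<in> {0..}" "y \<in> {0..}" "x \<le> y"
      moreover from this have "{0<..x} \<subseteq> {0<..y}" "{0<..y} \<subseteq> {- y..y}" by auto
      ultimately show "ray_measure m x \<le> ray_measure m y"
        using le[of "{0<..x}" "{0<..y}" y] by (simp add: ray_measure_def)
    qed
    have 2: "mono_on {..<0} (\<lambda>x. - ray_measure m x)"
    proof (rule monotone_onI)
      fix x y :: real assume "x \<in> {..<0}" "y \<in> {..<0}" "x \<le> y"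
      moreover from this have "{y<..0} \<subseteq> {x<..0}" "{x<..0} \<subseteq> {- (- x)..- x}" by auto
      ultimately show "- ray_measure m x \<le> - ray_measure m y"
        using le[of "{y<..0}" "{x<..0}" "- x"] by (simp add: ray_measure_def)
    qed
    have "(\<lambda>x. - (- ray_measure m x)) \<in> borel_measurable (restrict_space borel {..<0})"
      by (intro borel_measurable_uminus borel_measurable_mono_on_fnc[OF 2])
    then have 3: "ray_measure m \<in> borel_measurable (restrict_space borel {..<0})" by simp
    show ?thesis
      by (rule measurable_piecewise_restrict[of "{{0..}, {..<0}}"]) (use borel_measurable_mono_on_fnc[OF 1] 3 in auto)
  qed
  have "g_meas \<phi> \<mu> = (\<lambda>x. ray_measure (pos_part \<phi> \<mu>) x - ray_measure (neg_part \<phi> \<mu>) x)"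
    by (rule ext) (rule g_meas_eq[OF \<phi>_meas \<phi>_pos \<mu>])
  then have [measurable]: "g_meas \<phi> \<mu> \<in> borel_measurable borel"
    using ray locally_finite_parts[OF \<phi>_meas \<phi>_pos \<mu>] by auto
  have [measurable]: "g_jump \<phi> a l \<in> borel_measurable borel" unfolding g_jump_def by measurable
  show ?thesis unfolding g by measurable
qed

end

text \<open>The \<open>p\<close>-th power of the integrand in \<open>abs_G_diff_le\<close> is
  \<open>1 / \<phi> z\<close> on the interval, and after exchanging the integrals the assumed bound
  on the probability cancels it. What remains is \<open>K\<close> times the mass \<open>V\<close>,
  which joins the \<open>V powr (p - 1)\<close> of Jensen's inequality. Integrability is a
  conclusion of its own, since a Bochner integral defaults to 0.\<close>

lemma (in prob_space) G_diff_moment: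
  assumes \<phi>_meas [measurable]: "\<phi> \<in> borel_measurable borel" and \<phi>_pos: "\<And>x. 0 < \<phi> x" and p: "1 \<le> p"
    and d: "G_decomp p \<phi> g c \<mu> a l"
    and [measurable]: "X \<in> borel_measurable M" "Y \<in> borel_measurable M"
    and K: "0 \<le> K" "\<And>z. prob {\<omega> \<in> space M. min (X \<omega>) (Y \<omega>) \<le> z \<and> z \<le> max (X \<omega>) (Y \<omega>)} \<le> K * \<phi> z"
  shows "integrable M (\<lambda>\<omega>. \<bar>g (X \<omega>) - g (Y \<omega>)\<bar> powr p)"
    and "(\<integral>\<omega>. \<bar>g (X \<omega>) - g (Y \<omega>)\<bar> powr p \<partial>M) \<le> K * V_functional p \<phi> g powr p"
proof -
  define V where "V = V_functional p \<phi> g"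
  define \<nu> where "\<nu> = weight_measure p \<phi> \<mu> a l"
  have \<mu>: "\<mu> \<in> M_class p \<phi>" using d by (simp add: G_decomp_def)
  have s[measurable_cong]: "sets \<nu> = sets borel" unfolding \<nu>_def by (rule sets_weight_measure[OF \<phi>_meas \<phi>_pos p \<mu>])
  have sp: "space \<nu> = UNIV" using sets_eq_imp_space_eq[OF s] by simp
  have eV: "emeasure \<nu> UNIV = ennreal V" "0 \<le> V" using emeasure_weight_measure[OF \<phi>_meas \<phi>_pos p d] by (auto simp: V_def \<nu>_def)
  interpret \<nu>: finite_measure \<nu> by standard (simp add: sp eV)
  have mV: "measure \<nu> (space \<nu>) = V" using eV by (simp add: sp measure_def)
  interpret PM: pair_sigma_finite \<nu> M ..
  have [measurable]: "g \<in> borel_measurable borel" by (rule G_measurable[OF \<phi>_meas \<phi>_pos p d])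
  \<comment> \<open>Written as a function of both variables by means of the two comparisons, so that
    joint measurability for Fubini is immediate.\<close>
  define h where "h z \<omega> = (if min (X \<omega>) (Y \<omega>) \<le> z \<and> z \<le> max (X \<omega>) (Y \<omega>) then ennreal (1 / \<phi> z) else 0)" for z \<omega>
  have hm: "case_prod h \<in> borel_measurable (\<nu> \<Otimes>\<^sub>M M)" unfolding h_def by measurable
  have pw: "ennreal (\<bar>g (X \<omega>) - g (Y \<omega>)\<bar> powr p) \<le> ennreal (V powr (p - 1)) * (\<integral>\<^sup>+z. h z \<omega> \<partial>\<nu>)" for \<omega>
  proof -
    let ?u = "\<lambda>z. \<phi> z powr (- (1 / p)) * indicator {min (X \<omega>) (Y \<omega>)..max (X \<omega>) (Y \<omega>)} z"
    have "ennreal (\<bar>g (X \<omega>) - g (Y \<omega>)\<bar> powr p) \<le> ennreal (measure \<nu> (space \<nu>) powr (p - 1)) * (\<integral>\<^sup>+z. ennreal (?u z powr p) \<partial>\<nu>)"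
    proof (rule \<nu>.nn_integral_jensen_powr[OF _ _ p])
      show "?u \<in> borel_measurable \<nu>" by measurable
      show "ennreal \<bar>g (X \<omega>) - g (Y \<omega>)\<bar> \<le> (\<integral>\<^sup>+z. ennreal (?u z) \<partial>\<nu>)" unfolding \<nu>_def by (rule abs_G_diff_le[OF \<phi>_meas \<phi>_pos p d])
    qed auto
    also have "(\<integral>\<^sup>+z. ennreal (?u z powr p) \<partial>\<nu>) = (\<integral>\<^sup>+z. h z \<omega> \<partial>\<nu>)"
    proof (rule nn_integral_cong)
      fix z
      have "(\<phi> z powr (- (1 / p))) powr p = \<phi> z powr (- 1)" using p by (simp add: powr_powr)
      also have "\<dots> = 1 / \<phi> z" using \<phi>_pos[of z] by (simp add: powr_minus_divide)
      finally have "(\<phi> z powr (- (1 / p))) powr p = 1 / \<phi> z" .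
      then show "ennreal (?u z powr p) = h z \<omega>" using p by (auto simp: h_def indicator_def)
    qed
    finally show ?thesis by (simp add: mV)
  qed
  have "(\<integral>\<^sup>+\<omega>. (\<integral>\<^sup>+z. h z \<omega> \<partial>\<nu>) \<partial>M) = (\<integral>\<^sup>+z. (\<integral>\<^sup>+\<omega>. h z \<omega> \<partial>M) \<partial>\<nu>)"
    by (rule PM.Fubini'[OF hm])
  also have "\<dots> \<le> (\<integral>\<^sup>+z. ennreal K \<partial>\<nu>)"
  proof (rule nn_integral_mono)
    fix z
    let ?B = "{\<omega> \<in> space M. min (X \<omega>) (Y \<omega>) \<le> z \<and> z \<le> max (X \<omega>) (Y \<omega>)}"
    have "(\<integral>\<^sup>+\<omega>. h z \<omega> \<partial>M) = (\<integral>\<^sup>+\<omega>. ennreal (1 / \<phi> z) * indicator ?B \<omega> \<partial>M)"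
      by (intro nn_integral_cong) (auto simp: h_def indicator_def)
    also have "\<dots> = ennreal (1 / \<phi> z) * ennreal (prob ?B)"
      by (subst nn_integral_cmult_indicator) (auto simp: emeasure_eq_measure)
    also have "\<dots> = ennreal (prob ?B / \<phi> z)" using \<phi>_pos[of z] by (simp add: ennreal_mult[symmetric])
    also have "\<dots> \<le> ennreal K" using K(2)[of z] \<phi>_pos[of z] by (intro ennreal_leI) (simp add: pos_divide_le_eq)
    finally show "(\<integral>\<^sup>+\<omega>. h z \<omega> \<partial>M) \<le> ennreal K" .
  qed
  also have "\<dots> = ennreal (K * V)" using K(1) eV by (simp add: sp ennreal_mult)
  finally have F: "(\<integral>\<^sup>+\<omega>. (\<integral>\<^sup>+z. h z \<omega> \<partial>\<nu>) \<partial>M) \<le> ennreal (K * V)" .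
  have hM: "(\<lambda>\<omega>. \<integral>\<^sup>+z. h z \<omega> \<partial>\<nu>) \<in> borel_measurable M"
    using hm by measurable
  have "(\<integral>\<^sup>+\<omega>. ennreal (\<bar>g (X \<omega>) - g (Y \<omega>)\<bar> powr p) \<partial>M) \<le> (\<integral>\<^sup>+\<omega>. ennreal (V powr (p - 1)) * (\<integral>\<^sup>+z. h z \<omega> \<partial>\<nu>) \<partial>M)"
    by (rule nn_integral_mono) (rule pw)
  also have "\<dots> = ennreal (V powr (p - 1)) * (\<integral>\<^sup>+\<omega>. (\<integral>\<^sup>+z. h z \<omega> \<partial>\<nu>) \<partial>M)"
    by (rule nn_integral_cmult[OF hM])
  also have "\<dots> \<le> ennreal (V powr (p - 1)) * ennreal (K * V)" by (intro mult_left_mono F) auto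
  also have "\<dots> = ennreal (K * V powr p)"
  proof -
    have "V powr (p - 1) * V = V powr p" using eV(2) by (cases "V = 0") (auto simp: powr_diff)
    then have "V powr (p - 1) * (K * V) = K * V powr p" by (simp add: mult_ac)
    then show ?thesis using K(1) eV(2) by (subst ennreal_mult[symmetric]) auto
  qed
  finally have le: "(\<integral>\<^sup>+\<omega>. ennreal (\<bar>g (X \<omega>) - g (Y \<omega>)\<bar> powr p) \<partial>M) \<le> ennreal (K * V powr p)" .
  show int: "integrable M (\<lambda>\<omega>. \<bar>g (X \<omega>) - g (Y \<omega>)\<bar> powr p)"
    by (rule integrableI_bounded) (use le in \<open>auto intro: le_less_trans\<close>)
  show "(\<integral>\<omega>. \<bar>g (X \<omega>) - g (Y \<omega>)\<bar> powr p \<partial>M) \<le> K * V_functional p \<phi> g powr p"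
    using le nn_integral_eq_integral[OF int] K(1) by (simp add: V_def ennreal_le_iff)
qed

section \<open>The error bound\<close>

context prob_space begin

text \<open>A nonzero \<open>z\<close> between \<open>X\<close> and \<open>Y\<close> is exceeded or
  attained in absolute value by one of them; this gives the factor 2. The moment of \<open>Y\<close>
  is bounded through those of \<open>X\<close> and of the difference.\<close>

lemma prob_between_tail:
  fixes X Y :: "'a \<Rightarrow> real"
  assumes X: "in_Lr M r X" and XY: "in_Lr M r (\<lambda>\<omega>. X \<omega> - Y \<omega>)" and Y: "Y \<in> borel_measurable M" and r: "1 \<le> r"
    and B: "Lr_norm M r (\<lambda>\<omega>. X \<omega> - Y \<omega>) \<le> B" and z: "z \<noteq> 0"
  shows "prob {\<omega> \<in> space M. min (X \<omega>) (Y \<omega>) \<le> z \<and> z \<le> max (X \<omega>) (Y \<omega>)}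
    \<le> 2 * ((B + Lr_norm M r X) powr r / \<bar>z\<bar> powr r)"
proof -
  let ?A = "Lr_norm M r X"
  have r0: "0 < r" using r by simp
  have [measurable]: "X \<in> borel_measurable M" "Y \<in> borel_measurable M" using X Y by (auto simp: in_Lr_def)
  have B0: "0 \<le> B" using B Lr_norm_nonneg order_trans by blast
  have EX: "(\<integral>\<omega>. \<bar>X \<omega>\<bar> powr r \<partial>M) \<le> (?A + B) powr r"
    unfolding Lr_norm_powr[OF r0 X, symmetric] using B0 r by (intro powr_mono2) (auto simp: Lr_norm_nonneg)
  note LY = Lr_triangle[OF X XY Y r order_refl B]
  have z0: "0 < \<bar>z\<bar>" using z by simp
  have "prob {\<omega> \<in> space M. min (X \<omega>) (Y \<omega>) \<le> z \<and> z \<le> max (X \<omega>) (Y \<omega>)}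
      \<le> prob ({\<omega> \<in> space M. \<bar>z\<bar> \<le> \<bar>X \<omega>\<bar>} \<union> {\<omega> \<in> space M. \<bar>z\<bar> \<le> \<bar>Y \<omega>\<bar>})"
    by (rule finite_measure_mono) (auto simp: min_def max_def split: if_splits)
  also have "\<dots> \<le> prob {\<omega> \<in> space M. \<bar>z\<bar> \<le> \<bar>X \<omega>\<bar>} + prob {\<omega> \<in> space M. \<bar>z\<bar> \<le> \<bar>Y \<omega>\<bar>}"
    by (rule measure_Un_le) auto
  also have "\<dots> \<le> (?A + B) powr r / \<bar>z\<bar> powr r + (?A + B) powr r / \<bar>z\<bar> powr r"
    by (intro add_mono prob_abs_ge_le[OF X r0 z0 EX] prob_abs_ge_le[OF LY(1) r0 z0 LY(2)])
  finally show ?thesis by (simp add: add.commute)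
qed

text \<open>The power \<theta> turns the exponent \<open>r\<close> of Markov's inequality into the
  \<open>\<theta> * r\<close> of \<open>phi0\<close>, and the infimum is taken since every
  \<open>r\<close> is admissible. The cap at 1 and the point \<open>z = 0\<close> are covered by the
  trivial bound of a probability.\<close>

lemma prob_between_powr_le_phi0:
  fixes X Y :: "'a \<Rightarrow> real"
  assumes X: "\<And>r. 1 \<le> r \<Longrightarrow> in_Lr M r X" and XY: "\<And>r. 1 \<le> r \<Longrightarrow> in_Lr M r (\<lambda>\<omega>. X \<omega> - Y \<omega>)"
    and Y: "Y \<in> borel_measurable M" and C: "\<And>r. 1 \<le> r \<Longrightarrow> Lr_norm M r (\<lambda>\<omega>. X \<omega> - Y \<omega>) \<le> C r" and \<theta>: "0 < \<theta>"
  shows "prob {\<omega> \<in> space M. min (X \<omega>) (Y \<omega>) \<le> z \<and> z \<le> max (X \<omega>) (Y \<omega>)} powr \<theta> \<le> 2 powr \<theta> * phi0 M X C \<theta> z"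
proof -
  let ?P = "prob {\<omega> \<in> space M. min (X \<omega>) (Y \<omega>) \<le> z \<and> z \<le> max (X \<omega>) (Y \<omega>)}"
  have "?P powr \<theta> \<le> 1 powr \<theta>" using \<theta> by (intro powr_mono2) auto
  also have "1 powr \<theta> \<le> 2 powr \<theta>" using \<theta> by (intro powr_mono2) auto
  finally have P1: "?P powr \<theta> / 2 powr \<theta> \<le> 1" by simp
  show ?thesis
  proof (cases "z = 0")
    case True
    then show ?thesis using P1 by (simp add: phi0_def)
  next
    case False
    have "?P powr \<theta> / 2 powr \<theta> \<le> (INF r\<in>{1..}. (C r + Lr_norm M r X) powr (\<theta> * r) / \<bar>z\<bar> powr (\<theta> * r))"
    proof (rule cINF_greatest)
      fix r :: real assume "r \<in> {1..}"
      then have r: "1 \<le> r" by simp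
      have "?P powr \<theta> \<le> (2 * ((C r + Lr_norm M r X) powr r / \<bar>z\<bar> powr r)) powr \<theta>"
        using prob_between_tail[OF X[OF r] XY[OF r] Y r C[OF r] False] \<theta> by (intro powr_mono2) auto
      also have "\<dots> = 2 powr \<theta> * ((C r + Lr_norm M r X) powr (r * \<theta>) / \<bar>z\<bar> powr (r * \<theta>))"
        by (simp add: powr_mult powr_divide powr_powr)
      finally show "?P powr \<theta> / 2 powr \<theta> \<le> (C r + Lr_norm M r X) powr (\<theta> * r) / \<bar>z\<bar> powr (\<theta> * r)"
        by (simp add: pos_divide_le_eq mult_ac)
    qed auto
    then have "?P powr \<theta> / 2 powr \<theta> \<le> phi0 M X C \<theta> z" using P1 False by (simp add: phi0_def)
    then show ?thesis by (simp add: pos_divide_le_eq mult.commute)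
  qed
qed

text \<open>Interpolation: the fraction \<open>\<theta>\<close> of the exponent is spent on the decay in \<open>z\<close>, the fraction
  \<open>1 - \<theta>\<close> on the rate.\<close>

lemma prob_between_interpolated:
  fixes X Y :: "'a \<Rightarrow> real"
  assumes X: "\<And>r. 1 \<le> r \<Longrightarrow> in_Lr M r X" and XY: "\<And>r. 1 \<le> r \<Longrightarrow> in_Lr M r (\<lambda>\<omega>. X \<omega> - Y \<omega>)"
    and Y: "Y \<in> borel_measurable M" and C: "\<And>r. 1 \<le> r \<Longrightarrow> Lr_norm M r (\<lambda>\<omega>. X \<omega> - Y \<omega>) \<le> C r"
    and \<theta>: "0 < \<theta>" "\<theta> < 1"
    and D: "distributed M lborel X (\<lambda>x. ennreal (f x))" and f: "\<And>x. f x \<le> B" and B: "0 < B"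
    and L: "Lr_norm M (1 / \<theta>) (\<lambda>\<omega>. X \<omega> - Y \<omega>) \<le> L"
  shows "prob {\<omega> \<in> space M. min (X \<omega>) (Y \<omega>) \<le> z \<and> z \<le> max (X \<omega>) (Y \<omega>)}
    \<le> 3 * (B * L) powr ((1 - \<theta>) / (1 + \<theta>)) * phi0 M X C \<theta> z"
proof -
  let ?P = "prob {\<omega> \<in> space M. min (X \<omega>) (Y \<omega>) \<le> z \<and> z \<le> max (X \<omega>) (Y \<omega>)}"
  have r: "0 < 1 / \<theta>" "1 \<le> 1 / \<theta>" using \<theta> by (auto simp: pos_le_divide_eq)
  have ex: "(1 / \<theta>) / (1 / \<theta> + 1) = 1 / (1 + \<theta>)" using \<theta> by (simp add: field_simps)
  have L0: "0 \<le> L" using L Lr_norm_nonneg order_trans by blast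
  have P2: "?P \<le> 3 * (B * L) powr (1 / (1 + \<theta>))"
    using prob_between_le[OF D f B Y r(1) XY[OF r(2)] L] unfolding ex .
  \<comment> \<open>The two factors are estimated differently: the first by the tails, the second by
    the density bound.\<close>
  have "?P = ?P powr \<theta> * ?P powr (1 - \<theta>)" by (cases "?P = 0") (auto simp: powr_add[symmetric])
  also have "\<dots> \<le> (2 powr \<theta> * phi0 M X C \<theta> z) * (3 * (B * L) powr (1 / (1 + \<theta>))) powr (1 - \<theta>)"
    using prob_between_powr_le_phi0[OF X XY Y C \<theta>(1)] P2 \<theta>
    by (intro mult_mono powr_mono2) (auto simp: phi0_nonneg[OF \<theta>(1)])
  also have "(3 * (B * L) powr (1 / (1 + \<theta>))) powr (1 - \<theta>) = 3 powr (1 - \<theta>) * (B * L) powr ((1 - \<theta>) / (1 + \<theta>))"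
    by (simp add: powr_mult powr_powr)
  also have "(2 powr \<theta> * phi0 M X C \<theta> z) * (3 powr (1 - \<theta>) * (B * L) powr ((1 - \<theta>) / (1 + \<theta>)))
      = (2 powr \<theta> * 3 powr (1 - \<theta>)) * ((B * L) powr ((1 - \<theta>) / (1 + \<theta>)) * phi0 M X C \<theta> z)" by (simp add: mult_ac)
  also have "\<dots> \<le> 3 * ((B * L) powr ((1 - \<theta>) / (1 + \<theta>)) * phi0 M X C \<theta> z)"
  proof (rule mult_right_mono)
    \<comment> \<open>The geometric mean of the constants 2 and 3 of the two estimates is at most
      3.\<close>
    have "2 powr \<theta> * 3 powr (1 - \<theta>) \<le> 3 powr \<theta> * 3 powr (1 - \<theta> :: real)"
      using \<theta> by (intro mult_right_mono powr_mono2) auto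
    also have "\<dots> = 3" by (simp add: powr_add[symmetric])
    finally show "2 powr \<theta> * 3 powr (1 - \<theta>) \<le> (3 :: real)" .
  qed (simp add: phi0_nonneg[OF \<theta>(1)])
  finally show ?thesis by (simp add: mult_ac)
qed

end

lemma mesh_nonneg:
  assumes "is_partition T n \<pi>" "0 < T"
  shows "0 \<le> mesh n \<pi>"
proof -
  have "n \<noteq> 0" using assms by (auto simp: is_partition_def intro: gr0I)
  then have "\<bar>\<pi> (Suc 0) - \<pi> 0\<bar> \<le> mesh n \<pi>" unfolding mesh_def by (intro Max_ge) auto
  then show ?thesis by (rule order_trans[OF abs_ge_zero])
qed

text \<open>A bound that is not positive would leave no mass. Positivity is required because the
  optimal \<delta> in \<open>prob_between_le\<close> is obtained by dividing by
  \<open>B\<close>.\<close>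

lemma (in prob_space) density_bound_pos:
  assumes D: "distributed M lborel X (\<lambda>x. ennreal (f x))" and f: "\<And>x. f x \<le> B"
  shows "0 < B"
proof (rule ccontr)
  assume "\<not> 0 < B"
  then have "f x \<le> 0" for x using f[of x] by linarith
  then have "ennreal (f x) = 0" for x by (simp add: ennreal_neg)
  then show False using distributed_emeasure[OF D, of UNIV] emeasure_space_1 by simp
qed

theorem corollary6p4:
  fixes M :: "'a measure"
    and W X :: "real \<Rightarrow> 'a \<Rightarrow> real"
    and F :: "real \<Rightarrow> 'a measure"
    and \<sigma> b :: "real \<Rightarrow> real \<Rightarrow> real"
    and T x0 K \<alpha> p \<gamma> \<epsilon> \<theta> :: real
    and f :: "real \<Rightarrow> real"
    and n :: nat and \<pi> :: "nat \<Rightarrow> real"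
    and X\<pi> :: "'a \<Rightarrow> real"
    and C \<psi> \<phi> :: "real \<Rightarrow> real"
  assumes T: "T > 0"
    and prob: "prob_space M" and complete: "complete_measure M"
    and F: "F = aug_filtration M W"
    and BM: "brownian_motion M F T W"
    and \<alpha>: "\<alpha> \<ge> 1 / 2"
    and coeff: "sde_coefficient T K \<alpha> \<sigma>" "sde_coefficient T K \<alpha> b"
    and sde: "sde_solution M F W T \<sigma> b x0 X"
    and p: "p \<ge> 1"
    and density: "distributed M lborel (X T) (\<lambda>x. ennreal (f x))" "\<And>x. f x \<ge> 0"
    and bounded: "bdd_above (range f)"
    and partition: "is_partition T n \<pi>"
    and approx: "X\<pi> \<in> borel_measurable M"
    and \<gamma>: "\<gamma> > 0"
    and C: "\<And>r. r \<ge> 1 \<Longrightarrow> C r \<ge> 0"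
    and rate: "\<And>r. r \<ge> 1 \<Longrightarrow> in_Lr M r (\<lambda>\<omega>. X T \<omega> - X\<pi> \<omega>) \<and>
                 Lr_norm M r (\<lambda>\<omega>. X T \<omega> - X\<pi> \<omega>) \<le> C r * mesh n \<pi> powr \<gamma>"
    and \<epsilon>: "0 < \<epsilon>" "\<epsilon> < \<gamma>"
    and \<theta>: "\<theta> = \<epsilon> / (2 * \<gamma> - \<epsilon>)"
    and \<psi>: "bump_function \<psi>" "decays_faster_than_polynomials \<psi>"
    and \<phi>: "\<phi> = phi_bump M (X T) C \<theta> \<psi>"
  shows "(mesh n \<pi> \<le> 1 \<longrightarrow>
           (\<forall>g \<in> G_class p \<phi>.
              integrable M (\<lambda>\<omega>. \<bar>g (X T \<omega>) - g (X\<pi> \<omega>)\<bar> powr p) \<and>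
              (\<integral>\<omega>. \<bar>g (X T \<omega>) - g (X\<pi> \<omega>)\<bar> powr p \<partial>M)
                \<le> 3 * 2 powr p * (SUP x. f x) powr (1 - \<epsilon> / \<gamma>) * V_functional p \<phi> g powr p
                    * C (1 / \<theta>) powr (1 - \<epsilon> / \<gamma>) * mesh n \<pi> powr (\<gamma> - \<epsilon>)))
         \<and> (\<forall>q :: real poly. poly q \<in> G_class p \<phi>)"
proof -
  interpret prob_space M by (rule prob)
  interpret brownian M F W T by (rule brownianI[OF T prob F BM])
  have \<theta>01: "0 < \<theta>" "\<theta> < 1" using \<epsilon> by (auto simp: \<theta> pos_divide_less_eq)
  \<comment> \<open>This identity is the reason for the choice of \<theta>: the interpolated
    exponent becomes \<open>1 - \<epsilon> / \<gamma>\<close>, and multiplied by \<gamma> it gives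
    the rate \<open>\<gamma> - \<epsilon>\<close>.\<close>
  have expo: "(1 - \<theta>) / (1 + \<theta>) = 1 - \<epsilon> / \<gamma>"
  proof -
    have "2 * \<gamma> - \<epsilon> \<noteq> 0" using \<epsilon> by simp
    then have "1 - \<theta> = (2 * \<gamma> - 2 * \<epsilon>) / (2 * \<gamma> - \<epsilon>)" "1 + \<theta> = 2 * \<gamma> / (2 * \<gamma> - \<epsilon>)"
      by (auto simp: \<theta> field_simps)
    then have "(1 - \<theta>) / (1 + \<theta>) = ((2 * \<gamma> - 2 * \<epsilon>) / (2 * \<gamma> - \<epsilon>)) / (2 * \<gamma> / (2 * \<gamma> - \<epsilon>))" by (simp only:)
    also have "\<dots> = (2 * \<gamma> - 2 * \<epsilon>) / (2 * \<gamma>)" using \<open>2 * \<gamma> - \<epsilon> \<noteq> 0\<close> by simp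
    also have "\<dots> = 1 - \<epsilon> / \<gamma>" using \<gamma> by (simp add: diff_divide_distrib)
    finally show ?thesis .
  qed
  have bump: "bump_function \<phi>" unfolding \<phi> by (rule bump_function_phi_bump[OF \<theta>01(1) \<psi>])
  have dec: "decays_faster_than_polynomials \<phi>" unfolding \<phi> by (rule phi_bump_decays[OF \<theta>01(1) \<psi>])
  have \<phi>m: "\<phi> \<in> borel_measurable borel" by (rule bump_function_measurable[OF bump])
  have \<phi>p: "0 < \<phi> z" "\<phi> z \<le> 1" for z using bump by (auto simp: bump_function_def)
  have Xr: "in_Lr M r (X T)" if "1 \<le> r" for r using sde_solution_in_Lr[OF coeff sde] that by simp
  have XT: "X T \<in> borel_measurable M" using Xr[of 1] by (simp add: in_Lr_def)
  define e where "e = 1 - \<epsilon> / \<gamma>"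
  define B where "B = (SUP x. f x)"
  have fB: "f x \<le> B" for x unfolding B_def by (rule cSUP_upper[OF _ bounded]) simp
  have B0: "0 < B" by (rule density_bound_pos[OF density(1) fB])
  have m0: "0 \<le> mesh n \<pi>" by (rule mesh_nonneg[OF partition T])
  have r1: "1 \<le> 1 / \<theta>" using \<theta>01 by (simp add: pos_le_divide_eq)
  have "integrable M (\<lambda>\<omega>. \<bar>g (X T \<omega>) - g (X\<pi> \<omega>)\<bar> powr p) \<and>
      (\<integral>\<omega>. \<bar>g (X T \<omega>) - g (X\<pi> \<omega>)\<bar> powr p \<partial>M)
        \<le> 3 * 2 powr p * B powr e * V_functional p \<phi> g powr p * C (1 / \<theta>) powr e * mesh n \<pi> powr (\<gamma> - \<epsilon>)"
    if mesh: "mesh n \<pi> \<le> 1" and g: "g \<in> G_class p \<phi>" for g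
  proof -
    obtain c \<mu> a l where d: "G_decomp p \<phi> g c \<mu> a l" using g unfolding G_class_def by blast
    \<comment> \<open>\<open>phi0\<close> is built from \<open>C r\<close> alone, so the power of
      the mesh has to be dropped in the tail bound; the density bound keeps it and produces the
      rate.\<close>
    have m1: "mesh n \<pi> powr \<gamma> \<le> 1" using mesh m0 \<gamma> powr_mono2[of \<gamma> "mesh n \<pi>" 1] by simp
    have XY: "in_Lr M r (\<lambda>\<omega>. X T \<omega> - X\<pi> \<omega>)" if "1 \<le> r" for r using rate[OF that] by simp
    have Cr: "Lr_norm M r (\<lambda>\<omega>. X T \<omega> - X\<pi> \<omega>) \<le> C r" if "1 \<le> r" for r
      using rate[OF that] mult_left_mono[OF m1 C[OF that]] by simp
    define K' where "K' = 3 * 2 powr p * (B powr e * C (1 / \<theta>) powr e * mesh n \<pi> powr (\<gamma> - \<epsilon>))"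
    have K0: "0 \<le> K'" by (simp add: K'_def)
    have K: "prob {\<omega> \<in> space M. min (X T \<omega>) (X\<pi> \<omega>) \<le> z \<and> z \<le> max (X T \<omega>) (X\<pi> \<omega>)} \<le> K' * \<phi> z" for z
    proof -
      let ?P = "prob {\<omega> \<in> space M. min (X T \<omega>) (X\<pi> \<omega>) \<le> z \<and> z \<le> max (X T \<omega>) (X\<pi> \<omega>)}"
      have "?P \<le> 3 * (B * (C (1 / \<theta>) * mesh n \<pi> powr \<gamma>)) powr e * phi0 M (X T) C \<theta> z"
        unfolding e_def expo[symmetric]
        by (rule prob_between_interpolated[OF Xr XY approx Cr \<theta>01 density(1) fB B0 conjunct2[OF rate[OF r1]]])
      also have "(B * (C (1 / \<theta>) * mesh n \<pi> powr \<gamma>)) powr e = B powr e * C (1 / \<theta>) powr e * mesh n \<pi> powr (\<gamma> - \<epsilon>)"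
      proof -
        have "\<gamma> * e = \<gamma> - \<epsilon>" using \<gamma> by (simp add: e_def right_diff_distrib)
        then show ?thesis using B0 C[OF r1] by (simp add: powr_mult powr_powr mult.assoc)
      qed
      also have "3 * (B powr e * C (1 / \<theta>) powr e * mesh n \<pi> powr (\<gamma> - \<epsilon>)) * phi0 M (X T) C \<theta> z \<le> K' * \<phi> z"
      proof (rule mult_mono)
        \<comment> \<open>The probability estimate comes with the constant 3; enlarging it by a
          factor of at least 1 gives the form of the claim.\<close>
        have "1 \<le> 2 powr p" using p by (simp add: ge_one_powr_ge_zero)
        then have "3 * 1 \<le> 3 * 2 powr p" by simp
        then show "3 * (B powr e * C (1 / \<theta>) powr e * mesh n \<pi> powr (\<gamma> - \<epsilon>)) \<le> K'"
          unfolding K'_def by (intro mult_right_mono) auto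
        show "phi0 M (X T) C \<theta> z \<le> \<phi> z" by (simp add: \<phi> phi_bump_def)
      qed (auto simp: K0 phi0_nonneg[OF \<theta>01(1)])
      finally show ?thesis .
    qed
    note main = G_diff_moment[OF \<phi>m \<phi>p(1) p d XT approx K0 K]
    then show ?thesis by (simp add: K'_def mult_ac)
  qed
  moreover have "poly q \<in> G_class p \<phi>" for q
    by (rule poly_in_G_class[OF \<phi>m \<phi>p dec p])
  ultimately show ?thesis unfolding B_def e_def by blast
qed

end
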